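(* Fix $k\ge1$. For a prime $p>2$ with $k<p$, let $\chi$ be the quadratic character (Legendre symbol) of $\mathbb{F}_p$, let $\Delta_{p-1}$ be the simplex on vertex set $\mathbb{F}_p$, and let $\phi_k\in C^k(\Delta_{p-1};\mathbb{Z}_2)$ be the Paley $k$-cochain: $\phi_k(\{x_0,\ldots,x_k\})=1$ if $\chi(x_0+\cdots+x_k)=1$ and $0$ otherwise. Then $$\|\phi_k\|_{csy}\ \ge\ \frac12\binom{p}{k+1}\Big(1-O\big(p^{-2^{-k}}\big)\Big),$$ where the implied constant depends only on $k$.
   Context: $\|\phi\|$ is the number of $k$-simplices on which $\phi$ is nonzero, and $\|\phi\|_{csy}=\min_{\psi\in C^{k-1}}\|\phi+d_{k-1}\psi\|$ with $d_{k-1}$ the $\mathbb{Z}_2$ coboundary. *)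

theory Defs
  imports "HOL-Number_Theory.Number_Theory" "HOL-Library.Z2"
begin

(* A simplicial complex is given by its set of faces. *)

definition full_simplex :: "'a set \<Rightarrow> 'a set set" where
  "full_simplex V = {\<sigma>. \<sigma> \<subseteq> V \<and> finite \<sigma> \<and> \<sigma> \<noteq> {}}"

definition simplices :: "'a set set \<Rightarrow> nat \<Rightarrow> 'a set set" where
  "simplices X k = {\<sigma> \<in> X. card \<sigma> = Suc k}"

(* Cochains with coefficients in Z_2 (the type bit), extended by 0 off the k-simplices so that
   equality of functions is equality of cochains.  No orientations are needed over Z_2. *)

definition cochains :: "'a set set \<Rightarrow> nat \<Rightarrow> ('a set \<Rightarrow> bit) set" where
  "cochains X k = {\<phi>. \<forall>\<sigma>. \<sigma> \<notin> simplices X k \<longrightarrow> \<phi> \<sigma> = 0}"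

(* coboundary X k is the map d_k from C^k to C^(k+1). *)

definition coboundary :: "'a set set \<Rightarrow> nat \<Rightarrow> ('a set \<Rightarrow> bit) \<Rightarrow> ('a set \<Rightarrow> bit)" where
  "coboundary X k \<psi> =
     (\<lambda>\<sigma>. if \<sigma> \<in> simplices X (Suc k) then \<Sum>v\<in>\<sigma>. \<psi> (\<sigma> - {v}) else 0)"

definition cochain_norm :: "'a set set \<Rightarrow> nat \<Rightarrow> ('a set \<Rightarrow> bit) \<Rightarrow> nat" where
  "cochain_norm X k \<phi> = card {\<sigma> \<in> simplices X k. \<phi> \<sigma> \<noteq> 0}"

(* Meant for k \<ge> 1 only: for k = 0 the truncated k - 1 is not the degree -1.  On a finite
   complex there are finitely many cochains (finite_cochains below), so Min is a true minimum. *)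

definition csy_norm :: "'a set set \<Rightarrow> nat \<Rightarrow> ('a set \<Rightarrow> bit) \<Rightarrow> nat" where
  "csy_norm X k \<phi> =
     Min ((\<lambda>\<psi>. cochain_norm X k (\<lambda>\<sigma>. \<phi> \<sigma> + coboundary X (k - 1) \<psi> \<sigma>)) ` cochains X (k - 1))"

(* F_p is represented by its residues 0, ..., p - 1.  The vertices are added as integers; this
   agrees with addition in F_p since Legendre a p depends only on a modulo p. *)

definition paley_simplex :: "nat \<Rightarrow> int set set" where
  "paley_simplex p = full_simplex {0..<int p}"

definition paley_cochain :: "nat \<Rightarrow> nat \<Rightarrow> (int set \<Rightarrow> bit)" where
  "paley_cochain p k =
     (\<lambda>\<sigma>. if \<sigma> \<in> simplices (paley_simplex p) k \<and> Legendre (\<Sum>x\<in>\<sigma>. x) (int p) = 1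
          then 1 else 0)"

lemma finite_simplices_full_simplex:
  assumes "finite V"
  shows "finite (simplices (full_simplex V) k)"
  by (rule finite_subset[of _ "Pow V"]) (use assms in \<open>auto simp: simplices_def full_simplex_def\<close>)

lemma finite_cochains:
  assumes "finite (simplices X k)"
  shows "finite (cochains X k)"
proof -
  have "(UNIV :: bit set) = {0, 1}"
    using bit_not_zero_iff by blast
  hence "finite (UNIV :: bit set)"
    by (metis finite.emptyI finite.insertI)
  hence "finite {\<phi> :: 'a set \<Rightarrow> bit. \<forall>\<sigma>. (\<sigma> \<in> simplices X k \<longrightarrow> \<phi> \<sigma> \<in> UNIV) \<and>
                                    (\<sigma> \<notin> simplices X k \<longrightarrow> \<phi> \<sigma> = 0)}"
    using assms by (intro finite_set_of_finite_funs)
  thus ?thesis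
    by (simp add: cochains_def)
qed

lemma coboundary_in_cochains: "coboundary X k \<psi> \<in> cochains X (Suc k)"
  by (simp add: cochains_def coboundary_def)

lemma paley_cochain_in_cochains: "paley_cochain p k \<in> cochains (paley_simplex p) k"
  by (simp add: cochains_def paley_cochain_def)

end

theory Submission
  imports "HOL-Algebra.Algebraic_Closure_Type" "Berlekamp_Zassenhaus.Finite_Field" "HOL-Analysis.Analysis"
    "HOL-Combinatorics.Multiset_Permutations" Defs
begin

text \<open>
  Adding a coboundary multiplies the sign of \<open>\<phi>\<^sub>k\<close> on a simplex by a product of functions each of which
  ignores one vertex, so one has to bound the sum of \<open>\<chi>(x\<^sub>0 + \<dots> + x\<^sub>k)\<close> against such products. After
  \<open>k - 1\<close> applications of Cauchy--Schwarz the kernel is \<open>\<chi>\<close> of a product of shifted linear factors and the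
  sum is bilinear, hence at most \<open>p\<close> times the largest Fourier coefficient of the kernel. Stopping here,
  rather than removing all the functions, is what gives the exponent \<open>2\<^sup>-\<^sup>k\<close>; it requires
  square-root cancellation in sums of \<open>\<chi>(f(x))\<close> twisted by an additive character.

  This Weil bound is proved elementarily. The L-function of the twisted sum is a polynomial of degree
  at most \<open>deg f\<close>, so the sums over the extensions of degree \<open>n\<close> are \<open>-\<Sum>\<omega>\<^sup>n\<close> over its
  inverse roots. Summed over all additive characters, they count the values of \<open>\<chi>(f(z\<^sup>p - z))\<close>, to
  which Stepanov's method applies; as \<open>n\<close> grows, this forces every \<open>\<omega>\<close> to have modulus at most
  \<open>\<surd>p\<close>.
\<close>

section \<open>Frobenius and minimal polynomials over the prime field\<close>

hide_const (open) Polynomials.degree Polynomials.lead_coeff Coset.order Divisibility.prime Divisibility.irreducible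

text \<open>All extensions live in one algebraic closure: the field with p^n elements is the fixed
  set of \<open>frob n\<close>, and Frobenius orbits are the root sets of monic irreducible
  polynomials, which makes traces, norms and the Euler product explicit. Only extensions of even
  degree 2m are estimated. With Q = p^m, z^(Q^2) = z turns x^(jQ) into x^j after a Q-th power, so
  simple zeros suffice and no derivatives occur; and the squares of the inverse roots already
  determine their moduli. Stepanov's method yields upper bounds only, but it applies to both
  character values 1 and -1, whose counts add up to almost Q^2, so each bound also bounds the other
  count from below. Its constant may depend on p, because letting m grow discards it; what remains
  is the number of inverse roots. In the combinatorial part the bilinear bound saves p^(-1/2), and
  each of the k - 1 Cauchy-Schwarz steps halves the exponent of the saving. The obstacle there is a
  repeated linear factor, for which the Weil bound fails: shifts producing one are few and are
  estimated trivially.\<close>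

interpretation to_ac: field_hom "to_ac :: 'a :: field \<Rightarrow> _"
  by unfold_locales auto

interpretation map_poly_to_ac: map_poly_inj_idom_hom "to_ac :: 'a :: field \<Rightarrow> _" ..

abbreviation poly_ac :: "'a :: field poly \<Rightarrow> 'a alg_closure \<Rightarrow> 'a alg_closure" where
  "poly_ac f x \<equiv> poly (map_poly to_ac f) x"

text \<open>X^p - X has at most p roots, and the p elements of the prime field are already roots by
  Fermat.\<close>

lemma frob_fixed_range:
  fixes x :: "'p::prime_card mod_ring alg_closure"
  shows "x ^ CARD('p) = x \<longleftrightarrow> x \<in> range to_ac"
proof
  let ?f = "monom 1 CARD('p) - monom 1 1 :: 'p mod_ring alg_closure poly"
  have p1: "CARD('p) > 1" using prime_card prime_gt_1_nat by blast
  have c: "poly.coeff ?f CARD('p) = 1" using p1 by simp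
  have f0: "?f \<noteq> 0"
  proof
    assume "?f = 0"
    hence "poly.coeff ?f CARD('p) = 0" by simp
    with c show False by simp
  qed
  have degf: "degree ?f \<le> CARD('p)"
    by (rule degree_diff_le) (use p1 in \<open>auto simp: Polynomial.degree_monom_eq\<close>)
  have sub: "range to_ac \<subseteq> {x. poly ?f x = 0}"
    using finite_field_power_card_eq_same[where ?'a = "'p mod_ring"]
    by (auto simp: Polynomial.poly_monom simp flip: to_ac_power)
  have fin: "finite {x. poly ?f x = 0}" using f0 by (rule poly_roots_finite)
  have "card {x. poly ?f x = 0} \<le> CARD('p)"
    using card_poly_roots_bound[OF f0] degf by simp
  moreover have "card (range (to_ac :: 'p mod_ring \<Rightarrow> _)) = CARD('p)"
    by (simp add: card_image inj_to_ac)
  ultimately have eq: "range to_ac = {x. poly ?f x = 0}"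
    using card_seteq[OF fin sub] by simp
  assume "x ^ CARD('p) = x"
  hence "x \<in> {x. poly ?f x = 0}" by (simp add: Polynomial.poly_monom)
  thus "x \<in> range to_ac" using eq by blast
next
  assume "x \<in> range to_ac"
  thus "x ^ CARD('p) = x"
    using finite_field_power_card_eq_same[where ?'a = "'p mod_ring"]
    by (auto simp flip: to_ac_power)
qed

definition frob :: "nat \<Rightarrow> 'p::prime_card mod_ring alg_closure \<Rightarrow> 'p mod_ring alg_closure" where
  "frob n x = x ^ (CARD('p) ^ n)"

interpretation frob: field_hom "frob n :: 'p::prime_card mod_ring alg_closure \<Rightarrow> _" for n
proof unfold_locales
  fix x y :: "'p mod_ring alg_closure"
  show "frob n (x + y) = frob n x + frob n y"
    unfolding frob_def by (rule freshmans_dream') (simp_all add: prime_card)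
qed (auto simp: frob_def power_mult_distrib power_0_left)

lemma frob_0 [simp]: "frob 0 x = x"
  by (simp add: frob_def)

lemma frob_frob: "frob n (frob m x) = frob (m + n) x"
  by (simp add: frob_def power_mult [symmetric] power_add)

lemma frob_1_fixed_iff: "frob 1 x = x \<longleftrightarrow> x \<in> range to_ac"
  using frob_fixed_range[of x] by (simp add: frob_def)

lemma frob_to_ac [simp]: "frob n (to_ac a) = to_ac a"
proof (induction n)
  case (Suc n)
  have "frob (Suc n) (to_ac a) = frob 1 (frob n (to_ac a))" by (simp only: frob_frob) simp
  thus ?case using Suc frob_1_fixed_iff[of "to_ac a"] by simp
qed simp

lemma frob_poly_ac: "frob n (poly_ac f x) = poly_ac f (frob n x)"
  by (induction f) (auto simp: frob.hom_add frob.hom_mult)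

lemma frob_cancel: "frob (i + k) x = frob i x \<longleftrightarrow> frob k x = x"
  using frob_frob[of i k x] by (metis add.commute frob.eq_iff frob_frob)

lemma frob_periodic: "\<exists>r>0. frob r x = x"
proof -
  obtain f where f: "f \<noteq> 0" "poly_ac f x = 0"
    using alg_closure_algebraic[of x] by blast
  have "poly_ac f (frob i x) = 0" for i
    using frob_poly_ac[of i f x] f by simp
  hence "range (\<lambda>i. frob i x) \<subseteq> {y. poly_ac f y = 0}" by auto
  moreover have "finite {y. poly_ac f y = 0}"
    using f by (intro poly_roots_finite) auto
  ultimately have "finite (range (\<lambda>i. frob i x))" by (rule finite_subset)
  hence "\<not> inj (\<lambda>i. frob i x)"
    using finite_imageD by blast
  then obtain i j where ij: "i < j" "frob i x = frob j x"
    by (metis (mono_tags, lifting) injI linorder_neqE_nat)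
  hence "frob (j - i) x = x" using frob_cancel[of i "j - i" x] by simp
  thus ?thesis using ij by (intro exI[of _ "j - i"]) auto
qed

text \<open>The degree of \<open>x\<close> over the prime field, which is also the size of its
  Frobenius orbit.\<close>

definition frob_period :: "'p::prime_card mod_ring alg_closure \<Rightarrow> nat" where
  "frob_period x = (LEAST r. r > 0 \<and> frob r x = x)"

lemma frob_period: "frob_period x > 0" "frob (frob_period x) x = x"
  using LeastI_ex[OF frob_periodic[of x]] by (auto simp: frob_period_def)

lemma frob_period_mult: "frob (frob_period x * k) x = x"
proof (induction k)
  case (Suc k)
  thus ?case using frob_cancel[of "frob_period x * k" "frob_period x" x] frob_period(2)[of x]
    by (simp add: add.commute)
qed auto

lemma frob_mod_period: "frob i x = frob (i mod frob_period x) x"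
proof -
  have "frob i x = frob (i mod frob_period x) (frob (frob_period x * (i div frob_period x)) x)"
    by (simp add: frob_frob)
  thus ?thesis by (simp add: frob_period_mult)
qed

lemma frob_fixed_iff_period_dvd: "frob n x = x \<longleftrightarrow> frob_period x dvd n"
proof
  assume "frob n x = x"
  hence "frob (n mod frob_period x) x = x" using frob_mod_period[of n x] by simp
  moreover have "n mod frob_period x < frob_period x" using frob_period(1)[of x] by simp
  ultimately have "n mod frob_period x = 0"
    using not_less_Least[of "n mod frob_period x" "\<lambda>r. r > 0 \<and> frob r x = x"]
    by (auto simp: frob_period_def)
  thus "frob_period x dvd n" by auto
next
  assume "frob_period x dvd n"
  thus "frob n x = x" using frob_period_mult by auto
qed

lemma inj_on_frob_conjugates: "inj_on (\<lambda>i. frob i x) {..<frob_period x}"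
proof (rule linorder_inj_onI')
  fix i j assume ij: "i \<in> {..<frob_period x}" "j \<in> {..<frob_period x}" "i < j"
  show "frob i x \<noteq> frob j x"
  proof
    assume eq: "frob i x = frob j x"
    hence "frob (j - i) x = x" using frob_cancel[of i "j - i" x] ij by simp
    hence "frob_period x dvd (j - i)" by (simp add: frob_fixed_iff_period_dvd)
    thus False using ij by (auto dest: dvd_imp_le)
  qed
qed

text \<open>The minimal polynomial of \<open>x\<close>, written over the closure as a product along
  the orbit, so that traces and norms can be read off.\<close>

definition conj_poly :: "'p::prime_card mod_ring alg_closure \<Rightarrow> 'p mod_ring alg_closure poly" where
  "conj_poly x = (\<Prod>i<frob_period x. [:- frob i x, 1:])"

lemma frob_cycle_prod:
  "(\<Prod>i<frob_period x. h (frob (Suc i) x)) = (\<Prod>i<frob_period x. h (frob i x))"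
  for h :: "'p::prime_card mod_ring alg_closure \<Rightarrow> 'b :: comm_monoid_mult"
proof -
  obtain r where r: "frob_period x = Suc r" using frob_period(1)[of x] by (cases "frob_period x") auto
  have "(\<Prod>i<Suc r. h (frob (Suc i) x)) = (\<Prod>i<r. h (frob (Suc i) x)) * h (frob (Suc r) x)"
    by simp
  also have "frob (Suc r) x = frob 0 x" using frob_period(2)[of x] by (simp add: r)
  also have "(\<Prod>i<r. h (frob (Suc i) x)) * h (frob 0 x) = (\<Prod>i<Suc r. h (frob i x))"
    by (subst prod.lessThan_Suc_shift) (simp add: mult.commute)
  finally show ?thesis by (simp add: r)
qed

text \<open>Frobenius permutes the linear factors cyclically, hence fixes every coefficient, and
  fixed elements lie in the prime field.\<close>

lemma conj_poly_eq_map_poly: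
  fixes x :: "'p::prime_card mod_ring alg_closure"
  shows "\<exists>f. conj_poly x = map_poly to_ac f"
proof -
  interpret fm: map_poly_comm_ring_hom "frob 1 :: 'p mod_ring alg_closure \<Rightarrow> _" by unfold_locales
  have "map_poly (frob 1) (conj_poly x) = (\<Prod>i<frob_period x. map_poly (frob 1) [:- frob i x, 1:])"
    unfolding conj_poly_def by (rule fm.hom_prod)
  also have "\<dots> = (\<Prod>i<frob_period x. [:- frob (Suc i) x, 1:])"
    by (intro prod.cong refl) (simp add: frob.hom_uminus frob_frob)
  also have "\<dots> = conj_poly x"
    unfolding conj_poly_def by (rule frob_cycle_prod[of "\<lambda>y. [:- y, 1:]"])
  finally have eq: "map_poly (frob 1) (conj_poly x) = conj_poly x" .
  have "poly.coeff (conj_poly x) n \<in> range to_ac" for n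
  proof -
    have "frob 1 (poly.coeff (conj_poly x) n) = poly.coeff (map_poly (frob 1) (conj_poly x)) n"
      by (subst coeff_map_poly) auto
    thus ?thesis using eq frob_1_fixed_iff[of "poly.coeff (conj_poly x) n"] by metis
  qed
  hence "conj_poly x = map_poly to_ac (map_poly of_ac (conj_poly x))"
    by (intro poly_eqI) (simp add: coeff_map_poly to_ac_of_ac)
  thus ?thesis by blast
qed

lemma poly_conj_poly: "poly (conj_poly x) y = (\<Prod>i<frob_period x. y - frob i x)"
  by (simp add: conj_poly_def poly_prod)

lemma degree_conj_poly [simp]: "degree (conj_poly x) = frob_period x"
  unfolding conj_poly_def by (subst degree_prod_sum_eq) auto

lemma lead_coeff_conj_poly [simp]: "poly.coeff (conj_poly x) (frob_period x) = 1"
proof -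
  have "lead_coeff (conj_poly x) = 1"
    unfolding conj_poly_def lead_coeff_prod by simp
  thus ?thesis by simp
qed

lemma irreducible_root_dvd:
  fixes P f :: "'p::prime_card mod_ring poly"
  assumes "irreducible P" "poly_ac P x = 0" "poly_ac f x = 0"
  shows "P dvd f"
proof (rule ccontr)
  assume "\<not> P dvd f"
  hence "coprime P f"
    using assms(1) by (metis irreducible_imp_prime_elem prime_elem_imp_coprime)
  then obtain a b where "a * P + b * f = 1"
    using bezout_coefficients_fst_snd[of P f] by (metis coprime_imp_gcd_eq_1)
  hence "map_poly to_ac (a * P + b * f) = map_poly to_ac 1" by simp
  hence "poly (map_poly to_ac a * map_poly to_ac P + map_poly to_ac b * map_poly to_ac f) x = 1"
    by (simp add: map_poly_to_ac.hom_add map_poly_to_ac.hom_mult)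
  thus False using assms by simp
qed

lemma frob_period_le_degree:
  fixes P :: "'p::prime_card mod_ring poly"
  assumes "P \<noteq> 0" "poly_ac P x = 0"
  shows "frob_period x \<le> degree P"
proof -
  have "(\<lambda>i. frob i x) ` {..<frob_period x} \<subseteq> {y. poly_ac P y = 0}"
    using frob_poly_ac[of _ P x] assms(2) by auto
  hence "card ((\<lambda>i. frob i x) ` {..<frob_period x}) \<le> card {y. poly_ac P y = 0}"
    using assms by (intro card_mono poly_roots_finite) auto
  also have "\<dots> \<le> degree P"
    using card_poly_roots_bound[of "map_poly to_ac P"] assms(1) by simp
  finally show ?thesis
    using inj_on_frob_conjugates[of x] by (simp add: card_image)
qed

text \<open>\<open>P\<close> divides the descended \<open>conj_poly x\<close>, since coprimality
  would give a Bezout identity that fails at \<open>x\<close>. Conversely the whole orbit consists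
  of roots of \<open>P\<close>, so the degrees agree.\<close>

lemma irreducible_monic_eq_conj_poly:
  fixes P :: "'p::prime_card mod_ring poly"
  assumes "irreducible P" "monic P" "poly_ac P x = 0"
  shows "map_poly to_ac P = conj_poly x" "degree P = frob_period x"
proof -
  obtain f where f: "conj_poly x = map_poly to_ac f" using conj_poly_eq_map_poly by blast
  have "poly (conj_poly x) x = 0"
    unfolding poly_conj_poly using frob_period(1)[of x] by (auto intro!: bexI[of _ 0])
  hence dvd: "P dvd f" using assms by (intro irreducible_root_dvd) (auto simp: f)
  have f_deg: "degree f = frob_period x"
    using degree_conj_poly[of x] unfolding f by simp
  have f_mon: "monic f"
    using lead_coeff_conj_poly[of x] unfolding f by (simp add: f_deg)
  have P0: "P \<noteq> 0" using assms by auto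
  have ge: "frob_period x \<le> degree P"
    using frob_period_le_degree[OF P0 assms(3)] .
  obtain g where g: "f = P * g" using dvd by blast
  have "g \<noteq> 0" using f_mon g by auto
  hence "degree f = degree P + degree g"
    using P0 by (simp add: g degree_mult_eq)
  hence dg: "degree g = 0" and "degree P = frob_period x" using ge f_deg by auto
  thus "degree P = frob_period x" by simp
  have "lead_coeff g = 1" using f_mon assms(2) by (simp add: g lead_coeff_mult)
  hence "g = 1" using dg by (metis degree_eq_zeroE lead_coeff_pCons(2) one_pCons)
  thus "map_poly to_ac P = conj_poly x" using f g by simp
qed

text \<open>The descended \<open>conj_poly x\<close> is itself irreducible: in a factorization, the
  factor vanishing at \<open>x\<close> vanishes on the whole orbit and takes up the full
  degree.\<close>

lemma ex_irreducible_monic_root: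
  fixes x :: "'p::prime_card mod_ring alg_closure"
  shows "\<exists>P. irreducible P \<and> monic P \<and> poly_ac P x = 0"
proof -
  obtain f :: "'p mod_ring poly" where f: "conj_poly x = map_poly to_ac f"
    using conj_poly_eq_map_poly by blast
  have root: "poly_ac f x = 0"
    unfolding f[symmetric] poly_conj_poly using frob_period(1)[of x] by (auto intro!: bexI[of _ 0])
  have f_deg: "degree f = frob_period x"
    using degree_conj_poly[of x] unfolding f by simp
  have f_mon: "monic f"
    using lead_coeff_conj_poly[of x] unfolding f by (simp add: f_deg)
  have unit: "a dvd 1" if "f = a * b" "poly_ac b x = 0" for a b
  proof -
    have ab: "a \<noteq> 0" "b \<noteq> 0" using f_mon that by auto
    have "degree a + degree b = frob_period x"
      using f_deg ab by (simp add: that degree_mult_eq)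
    hence "degree a = 0" using frob_period_le_degree[OF ab(2) that(2)] by simp
    thus ?thesis using ab by (simp add: is_unit_iff_degree)
  qed
  have "irreducible f"
  proof (rule irreducibleI)
    show "f \<noteq> 0" using f_mon by auto
    show "\<not> f dvd 1"
      using f_deg frob_period(1)[of x] by (auto simp: poly_dvd_1)
    fix a b assume ab: "f = a * b"
    hence "poly_ac a x = 0 \<or> poly_ac b x = 0" using root by (simp add: map_poly_to_ac.hom_mult)
    thus "a dvd 1 \<or> b dvd 1" using unit[of a b] unit[of b a] ab by (auto simp: mult.commute)
  qed
  thus ?thesis using f_mon root by blast
qed

lemma irreducible_common_root:
  fixes P Q :: "'p::prime_card mod_ring poly"
  assumes "irreducible P" "monic P" "poly_ac P x = 0"
    "irreducible Q" "monic Q" "poly_ac Q x = 0"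
  shows "P = Q"
  using irreducible_monic_eq_conj_poly(1)[OF assms(1-3)] irreducible_monic_eq_conj_poly(1)[OF assms(4-6)]
  by (metis map_poly_to_ac.eq_iff)

text \<open>For monic \<open>f\<close> this is minus the sum of the roots. In degree 0 the truncated
  index would hit the leading coefficient; the value 0 makes the function additive on products of
  all monic polynomials.\<close>

definition monic_trace :: "'a::comm_ring_1 poly \<Rightarrow> 'a" where
  "monic_trace f = (if degree f = 0 then 0 else poly.coeff f (degree f - 1))"

lemma monic_trace_mult:
  fixes f g :: "'a::idom poly"
  assumes "monic f" "monic g"
  shows "monic_trace (f * g) = monic_trace f + monic_trace g"
proof -
  have nz: "f \<noteq> 0" "g \<noteq> 0" using assms by auto
  have deg: "degree (f * g) = degree f + degree g"
    using nz by (rule degree_mult_eq)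
  consider "degree f = 0" | "degree g = 0"
    | "degree f > 0" "degree g > 0" by auto
  thus ?thesis
  proof cases
    case 1
    hence "f = 1" using assms(1) by (metis degree_eq_zeroE lead_coeff_pCons(2) one_pCons)
    thus ?thesis by (simp add: monic_trace_def)
  next
    case 2
    hence "g = 1" using assms(2) by (metis degree_eq_zeroE lead_coeff_pCons(2) one_pCons)
    thus ?thesis by (simp add: monic_trace_def)
  next
    case 3
    define a b where "a = degree f" "b = degree g"
    have a: "a > 0" and b: "b > 0" using 3 by (auto simp: a_b_def)
    have "poly.coeff (f * g) (a + b - 1) = (\<Sum>i\<le>a + b - 1. poly.coeff f i * poly.coeff g (a + b - 1 - i))"
      by (rule coeff_mult)
    also have "\<dots> = (\<Sum>i\<in>{a - 1, a}. poly.coeff f i * poly.coeff g (a + b - 1 - i))"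
    proof (rule sum.mono_neutral_right)
      show "\<forall>i\<in>{..a + b - 1} - {a - 1, a}. poly.coeff f i * poly.coeff g (a + b - 1 - i) = 0"
      proof
        fix i assume i: "i \<in> {..a + b - 1} - {a - 1, a}"
        hence "i > a \<or> a + b - 1 - i > b" using a b by auto
        thus "poly.coeff f i * poly.coeff g (a + b - 1 - i) = 0"
          using a_b_def by (auto simp: coeff_eq_0)
      qed
    qed (use a b in auto)
    also have "\<dots> = poly.coeff f (a - 1) * poly.coeff g b + poly.coeff f a * poly.coeff g (b - 1)"
      using a b by (subst sum.insert) (auto simp: Suc_diff_le)
    finally show ?thesis using assms a b deg by (simp add: monic_trace_def a_b_def)
  qed
qed

lemma monic_trace_prod:
  fixes f :: "'b \<Rightarrow> 'a::idom poly"
  assumes "finite A" "\<And>i. i \<in> A \<Longrightarrow> monic (f i)"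
  shows "monic_trace (\<Prod>i\<in>A. f i) = (\<Sum>i\<in>A. monic_trace (f i))"
  using assms
proof (induction A rule: finite_induct)
  case (insert x A)
  thus ?case by (simp add: monic_trace_mult lead_coeff_prod)
qed (simp add: monic_trace_def)

lemma monic_trace_map_to_ac: "monic_trace (map_poly to_ac f) = to_ac (monic_trace f)"
  by (simp add: monic_trace_def coeff_map_poly)

section \<open>Traces and norms along Frobenius orbits\<close>

lemma periodic_sum:
  fixes h :: "nat \<Rightarrow> 'a::comm_semiring_1"
  assumes "\<And>i. h (i + r) = h i"
  shows "(\<Sum>i<r * k. h i) = of_nat k * (\<Sum>i<r. h i)"
proof (induction k)
  case (Suc k)
  have per: "h (r * k + i) = h i" for i
  proof (induction k)
    case (Suc k)
    thus ?case using assms[of "r * k + i"] by (simp add: algebra_simps)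
  qed simp
  have "(\<Sum>i<r * k + m. h i) = (\<Sum>i<r * k. h i) + (\<Sum>i<m. h i)" for m
    by (induction m) (simp_all add: per add.assoc mult.assoc)
  from this[of r] show ?case using Suc by (simp add: algebra_simps)
qed simp

lemma periodic_prod:
  fixes h :: "nat \<Rightarrow> 'a::comm_semiring_1"
  assumes "\<And>i. h (i + r) = h i"
  shows "(\<Prod>i<r * k. h i) = (\<Prod>i<r. h i) ^ k"
proof (induction k)
  case (Suc k)
  have per: "h (r * k + i) = h i" for i
  proof (induction k)
    case (Suc k)
    thus ?case using assms[of "r * k + i"] by (simp add: algebra_simps)
  qed simp
  have "(\<Prod>i<r * k + m. h i) = (\<Prod>i<r * k. h i) * (\<Prod>i<m. h i)" for m
    by (induction m) (simp_all add: per add.assoc mult.assoc)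
  from this[of r] show ?case using Suc by (simp add: algebra_simps)
qed simp

lemma frob_add_period: "frob (i + frob_period x) x = frob i x"
  using frob_cancel[of i "frob_period x" x] frob_period(2)[of x] by simp

text \<open>The trace of \<open>x\<close> from the field with p^(degree P * k) elements: the orbit
  is run through \<open>k\<close> times, and the sign is that of Vieta's formula.\<close>

lemma frob_trace:
  assumes "irreducible P" "monic P" "poly_ac P x = 0"
  shows "(\<Sum>i<degree P * k. frob i x) = - to_ac (of_nat k * monic_trace P)"
proof -
  have "to_ac (monic_trace P) = monic_trace (conj_poly x)"
    using irreducible_monic_eq_conj_poly(1)[OF assms] by (simp flip: monic_trace_map_to_ac)
  also have "\<dots> = - (\<Sum>i<frob_period x. frob i x)"
    unfolding conj_poly_def by (subst monic_trace_prod) (auto simp: monic_trace_def sum_negf)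
  finally have "(\<Sum>i<frob_period x. frob i x) = - to_ac (monic_trace P)" by simp
  thus ?thesis
    unfolding irreducible_monic_eq_conj_poly(2)[OF assms]
    by (subst periodic_sum) (auto simp: frob_add_period)
qed

text \<open>The norm of a - x: Frobenius fixes \<open>a\<close> and moves \<open>x\<close> through
  the roots of \<open>P\<close>, so one turn around the orbit gives P(a).\<close>

lemma frob_norm:
  assumes "irreducible P" "monic P" "poly_ac P x = 0"
  shows "(\<Prod>i<degree P * k. frob i (to_ac a - x)) = to_ac (poly P a ^ k)"
proof -
  have "to_ac (poly P a) = poly (conj_poly x) (to_ac a)"
    using irreducible_monic_eq_conj_poly(1)[OF assms] by (metis to_ac.poly_map_poly)
  hence "(\<Prod>i<frob_period x. frob i (to_ac a - x)) = to_ac (poly P a)"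
    by (simp add: poly_conj_poly frob.hom_minus)
  thus ?thesis
    unfolding irreducible_monic_eq_conj_poly(2)[OF assms]
    by (subst periodic_prod) (auto simp: frob.hom_minus frob_add_period)
qed

section \<open>Counting roots and elements of finite fields\<close>

lemma card_roots_irreducible:
  fixes P :: "'p::prime_card mod_ring poly"
  assumes "irreducible P" "monic P"
  shows "card {x. poly_ac P x = 0} = degree P"
proof -
  have "degree P > 0"
    using assms by (metis irreducible_def degree_0_id irreducible_not_unit is_unit_iff_degree bot_nat_0.not_eq_extremum not_irreducible_zero)
  then obtain x where x: "poly_ac P x = 0"
    using alg_closed_imp_poly_has_root[of "map_poly to_ac P"] by auto
  have "{y. poly_ac P y = 0} = (\<lambda>i. frob i x) ` {..<frob_period x}"
    unfolding irreducible_monic_eq_conj_poly(1)[OF assms x] poly_conj_poly by auto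
  thus ?thesis
    using inj_on_frob_conjugates[of x] irreducible_monic_eq_conj_poly(2)[OF assms x]
    by (simp add: card_image)
qed

lemma order_eq_1:
  fixes f :: "'a::idom poly"
  assumes "poly f x = 0" "poly (pderiv f) x \<noteq> 0"
  shows "order x f = 1"
proof -
  have f0: "f \<noteq> 0" using assms(2) by auto
  have "order x f \<le> 1"
  proof (rule ccontr)
    assume "\<not> order x f \<le> 1"
    hence "[:-x, 1:] ^ 2 dvd f" using order_1[of x f] by (metis dvd_trans le_imp_power_dvd not_less_eq_eq Suc_1 One_nat_def)
    then obtain h where "f = [:-x, 1:] ^ 2 * h" by blast
    hence "f = [:-x, 1:] * ([:-x, 1:] * h)" by (simp only: power2_eq_square mult.assoc)
    hence "poly (pderiv f) x = 0"
      by (simp_all only: pderiv_mult poly_mult poly_add) simp_all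
    thus False using assms by blast
  qed
  moreover have "order x f \<noteq> 0" using assms(1) f0 by (simp add: order_root)
  ultimately show ?thesis by simp
qed

text \<open>Over an algebraically closed field the roots form a multiset of size
  \<open>degree f\<close>; a repeated entry would be a double root, hence also a root of the
  derivative.\<close>

lemma card_roots_separable:
  fixes f :: "'a::alg_closed_field poly"
  assumes "\<And>x. poly f x = 0 \<Longrightarrow> poly (pderiv f) x \<noteq> 0"
  shows "card {x. poly f x = 0} = degree f"
proof -
  have f0: "f \<noteq> 0" using assms[of 0] by auto
  have ord: "order x f \<le> 1" for x
  proof (cases "poly f x = 0")
    case True
    thus ?thesis using order_eq_1[OF True assms[OF True]] by simp
  qed (simp add: order_0I)
  obtain A where A: "size A = degree f" "f = smult (lead_coeff f) (\<Prod>x\<in>#A. [:-x, 1:])"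
    using alg_closed_imp_factorization[OF f0] by blast
  have roots: "{x. poly f x = 0} = set_mset A"
  proof -
    have "poly f x = lead_coeff f * (\<Prod>y\<in>#A. x - y)" for x
      by (subst A(2)) (simp add: poly_prod_mset)
    thus ?thesis using f0 by (auto simp: prod_mset_zero_iff)
  qed
  have "count A x \<le> 1" for x
  proof -
    have "replicate_mset (count A x) x \<subseteq># A" by (simp add: count_le_replicate_mset_subset_eq[symmetric])
    then obtain B where B: "A = replicate_mset (count A x) x + B" by (metis subset_mset.le_iff_add)
    have "[:-x, 1:] ^ count A x dvd (\<Prod>x\<in>#A. [:-x, 1:])"
      by (subst (2) B) (simp add: image_replicate_mset)
    hence "[:-x, 1:] ^ count A x dvd f" by (subst A(2)) (rule dvd_smult)
    hence "count A x \<le> order x f" using f0 by (simp add: order_divides)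
    thus ?thesis using ord[of x] by simp
  qed
  hence "count A x = 1" if "x \<in># A" for x
    using that by (metis count_greater_eq_one_iff le_antisym)
  hence "size A = card (set_mset A)"
    unfolding size_multiset_overloaded_eq by simp
  thus ?thesis using A roots by simp
qed

text \<open>With q = p^n, the polynomial X^q - X has derivative -1 and hence no double root.\<close>

lemma card_frob_fixed:
  assumes "n > 0"
  shows "card {x :: 'p::prime_card mod_ring alg_closure. frob n x = x} = CARD('p) ^ n"
proof -
  have p1: "CARD('p) > 1" using prime_card prime_gt_1_nat by blast
  hence q: "CARD('p) ^ n > 1" using assms by (rule one_less_power)
  let ?f = "monom 1 (CARD('p) ^ n) - monom 1 1 :: 'p mod_ring alg_closure poly"
  have "of_nat (CARD('p) ^ n) = (0 :: 'p mod_ring alg_closure)"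
    using assms by (simp add: of_nat_eq_0_iff_char_dvd del: of_nat_power)
  hence "pderiv ?f = -1"
    by (simp add: pderiv_diff pderiv_monom monom_0 one_pCons del: of_nat_power)
  hence "card {x. poly ?f x = 0} = degree ?f"
    by (intro card_roots_separable) auto
  also have "degree ?f = CARD('p) ^ n"
  proof -
    have "degree (- monom 1 1 + monom 1 (CARD('p) ^ n) :: 'p mod_ring alg_closure poly)
        = degree (monom 1 (CARD('p) ^ n) :: 'p mod_ring alg_closure poly)"
      by (rule degree_add_eq_right) (use q in \<open>simp add: Polynomial.degree_monom_eq\<close>)
    thus ?thesis by (simp only: uminus_add_conv_diff) (simp add: Polynomial.degree_monom_eq)
  qed
  also have "{x. poly ?f x = 0} = {x :: 'p mod_ring alg_closure. frob n x = x}"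
    by (auto simp: frob_def Polynomial.poly_monom)
  finally show ?thesis .
qed

text \<open>The Artin-Schreier map is additive with kernel the prime field, and it is onto because
  the closure is algebraically closed; so each fibre is a coset of the prime field.\<close>

lemma card_frob_diff_fibre:
  fixes y :: "'p::prime_card mod_ring alg_closure"
  shows "card {z. frob 1 z - z = y} = CARD('p)"
proof -
  have p1: "CARD('p) > 1" using prime_card prime_gt_1_nat by blast
  let ?f = "monom 1 CARD('p) - [:y, 1:] :: 'p mod_ring alg_closure poly"
  have "degree (- [:y, 1:] + monom 1 CARD('p)) 
      = degree (monom 1 CARD('p) :: 'p mod_ring alg_closure poly)"
    by (rule degree_add_eq_right) (use p1 in \<open>simp add: Polynomial.degree_monom_eq\<close>)
  hence "degree ?f = CARD('p)" by (simp only: uminus_add_conv_diff) (simp add: Polynomial.degree_monom_eq)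
  then obtain z0 where "poly ?f z0 = 0"
    using alg_closed_imp_poly_has_root[of ?f] p1 by auto
  hence z0: "frob 1 z0 - z0 = y" by (simp add: frob_def Polynomial.poly_monom algebra_simps)
  have "{z. frob 1 z - z = y} = (\<lambda>a. z0 + a) ` range to_ac"
  proof (intro equalityI subsetI)
    fix z assume "z \<in> {z. frob 1 z - z = y}"
    hence "frob 1 (z - z0) = z - z0" using z0 by (simp add: frob.hom_minus algebra_simps)
    hence "z - z0 \<in> range to_ac" using frob_1_fixed_iff by blast
    thus "z \<in> (\<lambda>a. z0 + a) ` range to_ac" by (rule_tac image_eqI[of _ _ "z - z0"]) auto
  qed (use z0 in \<open>auto simp: frob.hom_add algebra_simps\<close>)
  hence "card {z. frob 1 z - z = y} = card (range (to_ac :: 'p mod_ring \<Rightarrow> _))"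
    by (simp add: card_image)
  thus ?thesis by (simp add: card_image inj_to_ac)
qed

section \<open>Stepanov's method\<close>

text \<open>Stated by coefficients so that the zero polynomial always belongs; over a finite ring
  these sets have the cardinalities needed for the pigeonhole argument.\<close>

definition polys_below :: "nat \<Rightarrow> 'a::zero poly set" where
  "polys_below n = {f. \<forall>i\<ge>n. poly.coeff f i = 0}"

lemma polys_below_0 [simp]: "polys_below 0 = {0}"
  by (auto simp: polys_below_def poly_eq_iff)

lemma polys_below_Suc:
  "polys_below (Suc n) = (\<lambda>(a, f). pCons a f) ` (UNIV \<times> polys_below n)"
proof (intro equalityI subsetI)
  fix f :: "'a poly" assume f: "f \<in> polys_below (Suc n)"
  obtain a g where g: "f = pCons a g" by (metis pCons_cases)
  have "poly.coeff g i = 0" if "i \<ge> n" for i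
    using f that unfolding polys_below_def g mem_Collect_eq
    by (metis Suc_le_mono coeff_pCons_Suc)
  thus "f \<in> (\<lambda>(a, f). pCons a f) ` (UNIV \<times> polys_below n)"
    unfolding g polys_below_def by auto
qed (auto simp: polys_below_def coeff_pCons split: nat.splits)

lemma card_polys_below:
  "finite (polys_below n :: 'a::{finite,zero} poly set)"
  "card (polys_below n :: 'a::{finite,zero} poly set) = CARD('a) ^ n"
proof (induction n)
  case (Suc n)
  { case 1 show ?case using Suc.IH by (simp add: polys_below_Suc) }
  { case 2
    have "inj_on (\<lambda>(a, f). pCons a f) (UNIV \<times> polys_below n :: ('a \<times> 'a poly) set)"
      by (auto simp: inj_on_def)
    thus ?case using Suc.IH by (simp add: polys_below_Suc card_image card_cartesian_product) }
qed simp_all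

lemma polys_below_degree: "f \<noteq> 0 \<Longrightarrow> f \<in> polys_below n \<longleftrightarrow> degree f < n"
  unfolding polys_below_def using coeff_eq_0[of f] leading_coeff_0_iff[of f]
  by (auto simp: not_le[symmetric])

lemma polys_below_iff: "f \<in> polys_below n \<longleftrightarrow> f = 0 \<or> degree f < n"
  by (cases "f = 0") (auto simp: polys_below_degree, simp add: polys_below_def)

lemma polys_below_diff:
  "f \<in> polys_below n \<Longrightarrow> g \<in> polys_below n \<Longrightarrow> f - g \<in> polys_below n" for f g :: "'a::ab_group_add poly"
  by (auto simp: polys_below_def)

lemma polys_below_add:
  "f \<in> polys_below n \<Longrightarrow> g \<in> polys_below n \<Longrightarrow> f + g \<in> polys_below n" for f g :: "'a::comm_monoid_add poly"
  by (auto simp: polys_below_def)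

lemma polys_below_sum:
  "(\<And>i. i \<in> A \<Longrightarrow> f i \<in> polys_below n) \<Longrightarrow> (\<Sum>i\<in>A. f i) \<in> polys_below n"
  for f :: "'b \<Rightarrow> 'a::comm_monoid_add poly"
  by (auto simp: polys_below_def coeff_sum)

lemma polys_below_mono: "f \<in> polys_below m \<Longrightarrow> m \<le> n \<Longrightarrow> f \<in> polys_below n"
  by (auto simp: polys_below_def)

lemma polys_below_mult:
  fixes f g :: "'a::idom poly"
  assumes "f \<in> polys_below m" "g \<in> polys_below n" "m + n \<le> Suc k"
  shows "f * g \<in> polys_below k"
  using assms by (cases "f = 0 \<or> g = 0") (auto simp: polys_below_iff degree_mult_eq)

text \<open>The sum is read as an expansion in base x^Q and \<open>a\<close> is the position of its
  lowest nonzero digit. A degree bound on the digits matters only for uniqueness.\<close>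

lemma lowest_digit_exists:
  fixes u :: "nat \<Rightarrow> 'a::comm_ring_1 poly"
  assumes "j < J" "u j \<noteq> 0"
  shows "\<exists>a<J. u a \<noteq> 0 \<and>
    (\<exists>r. (\<Sum>j<J. u j * monom 1 (j * Q)) = monom 1 (a * Q) * (u a + monom 1 Q * r))"
proof -
  define a where "a = (LEAST j. u j \<noteq> 0)"
  have a: "u a \<noteq> 0" "a \<le> j" and less: "\<And>i. i < a \<Longrightarrow> u i = 0"
    unfolding a_def using assms LeastI[of "\<lambda>j. u j \<noteq> 0" j] Least_le[of "\<lambda>j. u j \<noteq> 0" j]
    by (auto dest: not_less_Least)
  have aJ: "a < J" using a assms by simp
  define r where "r = (\<Sum>j\<in>{a<..<J}. u j * monom 1 ((j - a - 1) * Q))"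
  have "(\<Sum>j<J. u j * monom 1 (j * Q)) = (\<Sum>j\<in>insert a {a<..<J}. u j * monom 1 (j * Q))"
    by (rule sum.mono_neutral_right) (use aJ less in \<open>auto simp: not_less_iff_gr_or_eq\<close>)
  also have "\<dots> = u a * monom 1 (a * Q) + (\<Sum>j\<in>{a<..<J}. u j * monom 1 (j * Q))"
    by simp
  also have "(\<Sum>j\<in>{a<..<J}. u j * monom 1 (j * Q)) = monom 1 (a * Q) * monom 1 Q * r"
    unfolding r_def sum_distrib_left
  proof (rule sum.cong)
    fix j assume j: "j \<in> {a<..<J}"
    then obtain i where i: "j = a + 1 + i" by (metis greaterThanLessThan_iff less_iff_Suc_add add_Suc_right Suc_eq_plus1 add.assoc add.commute)
    have "monom 1 (j * Q) =
        monom 1 (a * Q) * monom 1 Q * (monom 1 ((j - a - 1) * Q) :: 'a poly)"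
      unfolding i by (simp add: Polynomial.mult_monom algebra_simps)
    thus "u j * monom 1 (j * Q) =
        monom 1 (a * Q) * monom 1 Q * (u j * monom 1 ((j - a - 1) * Q))"
      by (simp only: mult_ac)
  qed simp
  finally show ?thesis using a aJ
    by (intro exI[of _ a] conjI exI[of _ r]) (simp_all add: algebra_simps)
qed

lemma monom_dvd_polys_below:
  fixes f :: "'a::idom poly"
  assumes "monom 1 Q dvd f" "f \<in> polys_below Q"
  shows "f = 0"
proof (rule ccontr)
  assume f: "f \<noteq> 0"
  from assms obtain g where g: "f = monom 1 Q * g" by blast
  hence "degree f = Q + degree g"
    using f by (subst g, subst degree_mult_eq) (auto simp: Polynomial.degree_monom_eq)
  thus False using assms(2) f by (simp add: polys_below_iff)
qed

text \<open>If \<open>b\<close> exceeded \<open>a\<close>, cancelling x^(aQ) would make x^Q divide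
  the digit at \<open>a\<close>, whose degree is below \<open>Q\<close>.\<close>

lemma lowest_digit_le:
  fixes \<alpha> \<alpha>' :: "'a::idom poly"
  assumes "\<alpha> \<in> polys_below Q" "\<alpha> \<noteq> 0"
    and "monom 1 (a * Q) * (\<alpha> + monom 1 Q * r) = monom 1 (b * Q) * (\<alpha>' + monom 1 Q * r')"
  shows "b \<le> a"
proof (rule ccontr)
  assume "\<not> b \<le> a"
  then obtain c where b: "b = a + 1 + c" by (metis less_iff_Suc_add not_le add_Suc_right Suc_eq_plus1 add.assoc add.commute)
  have "monom 1 (a * Q) * (\<alpha> + monom 1 Q * r) =
     monom 1 (a * Q) * (monom 1 Q * monom 1 (c * Q) * (\<alpha>' + monom 1 Q * r'))"
    unfolding assms(3) b by (simp add: Polynomial.mult_monom algebra_simps flip: mult.assoc)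
  hence "\<alpha> + monom 1 Q * r = monom 1 Q * monom 1 (c * Q) * (\<alpha>' + monom 1 Q * r')"
    by (simp add: Polynomial.monom_eq_0_iff)
  hence "\<alpha> = monom 1 Q * (monom 1 (c * Q) * (\<alpha>' + monom 1 Q * r') - r)"
    by (simp add: algebra_simps)
  hence "\<alpha> = 0" using assms(1) monom_dvd_polys_below by (metis dvd_triv_left)
  thus False using assms by simp
qed

lemma lowest_digit_unique:
  fixes \<alpha> \<alpha>' :: "'a::idom poly"
  assumes "\<alpha> \<in> polys_below Q" "\<alpha> \<noteq> 0" "\<alpha>' \<in> polys_below Q" "\<alpha>' \<noteq> 0"
    and eq: "monom 1 (a * Q) * (\<alpha> + monom 1 Q * r) = monom 1 (b * Q) * (\<alpha>' + monom 1 Q * r')"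
  shows "\<alpha> = \<alpha>'"
proof -
  have "a = b"
    using lowest_digit_le[OF assms(1,2) eq] lowest_digit_le[OF assms(3,4) eq[symmetric]] by simp
  hence "\<alpha> + monom 1 Q * r = \<alpha>' + monom 1 Q * r'"
    using eq by (simp add: Polynomial.monom_eq_0_iff)
  hence "\<alpha> - \<alpha>' = monom 1 Q * (r' - r)" by (simp add: algebra_simps)
  moreover have "\<alpha> - \<alpha>' \<in> polys_below Q" using assms by (intro polys_below_diff)
  ultimately have "\<alpha> - \<alpha>' = 0" using monom_dvd_polys_below by (metis dvd_triv_left)
  thus ?thesis by simp
qed

text \<open>Q-th powers are additive in characteristic p, and coefficients in the prime field are
  fixed by them.\<close>

lemma frob_power_pcompose:
  fixes f :: "'p::prime_card mod_ring poly"
  shows "f ^ (CARD('p) ^ m) = pcompose f (monom 1 (CARD('p) ^ m))"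
proof (induction f)
  case (pCons a f)
  let ?Q = "CARD('p) ^ m"
  have a: "a ^ ?Q = a" by (rule finite_field_power_card_power_eq_same[of _ m]) simp
  have "pCons a f = [:a:] + monom 1 1 * f"
    by (simp add: monom_altdef)
  hence "pCons a f ^ ?Q = ([:a:] + monom 1 1 * f) ^ ?Q" by simp
  also have "\<dots> = [:a:] ^ ?Q + (monom 1 1 * f) ^ ?Q"
    by (rule freshmans_dream'[where n = m]) (simp_all add: prime_card)
  also have "\<dots> = [:a:] + monom 1 ?Q * f ^ ?Q"
    by (simp add: power_mult_distrib monom_power poly_const_pow a)
  finally show ?case by (simp add: pCons pcompose_pCons)
qed (simp add: power_0_left)

lemma pcompose_monom_digits:
  fixes f :: "'a::comm_ring_1 poly"
  shows "pcompose f (monom 1 Q) = (\<Sum>i<Suc (degree f). [:poly.coeff f i:] * monom 1 (i * Q))"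
proof -
  have "pcompose f q = (\<Sum>i\<le>degree f. [:poly.coeff f i:] * q ^ i)" for q
    by (simp add: pcompose_altdef poly_altdef coeff_map_poly degree_map_poly)
  thus ?thesis by (simp add: monom_power lessThan_Suc_atMost mult.commute)
qed

lemma lowest_digit_expand:
  fixes s x r g c k :: "'a::comm_ring_1"
  shows "(s + x * r) ^ 2 * (g * (c + x * k)) =
    s ^ 2 * g * c + x * ((2 * s * r + x * r ^ 2) * (g * (c + x * k)) + s ^ 2 * g * k)"
  by (simp add: power2_eq_square algebra_simps)

text \<open>If the sum vanished, squaring and comparing the lowest nonzero digits in base \<open>x\<^sup>Q\<close> would give
  \<open>u\<^sup>2 = c s\<^sup>2 g\<close>, which is impossible at a simple root of \<open>g\<close>.\<close>

lemma stepanov_nonzero: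
  fixes g :: "'p::prime_card mod_ring poly" and u s :: "nat \<Rightarrow> 'p mod_ring poly" and m :: nat
  defines "Q \<equiv> CARD('p) ^ m"
  assumes simple: "order z (map_poly to_ac g) = 1"
    and g0: "g \<noteq> 0" and "odd Q"
    and H: "2 * H + degree g \<le> Q + 1"
    and us: "\<And>j. j < J \<Longrightarrow> u j \<in> polys_below H" "\<And>j. j < J \<Longrightarrow> s j \<in> polys_below H"
    and nz: "\<exists>j<J. u j \<noteq> 0 \<or> s j \<noteq> 0"
  shows "(\<Sum>j<J. (u j + s j * g ^ ((Q + 1) div 2)) * monom 1 (j * Q)) \<noteq> 0"
proof
  define U where "U = (\<Sum>j<J. u j * monom 1 (j * Q))"
  define S where "S = (\<Sum>j<J. s j * monom 1 (j * Q))"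
  assume "(\<Sum>j<J. (u j + s j * g ^ ((Q + 1) div 2)) * monom 1 (j * Q)) = 0"
  hence "U + S * g ^ ((Q + 1) div 2) = 0"
    unfolding U_def S_def by (simp add: algebra_simps sum.distrib sum_distrib_left)
  hence "U = - S * g ^ ((Q + 1) div 2)" by (simp add: eq_neg_iff_add_eq_0)
  hence "U ^ 2 = S ^ 2 * (g ^ ((Q + 1) div 2)) ^ 2" by (simp add: power_mult_distrib)
  \<comment> \<open>Squaring removes the half power: g^(Q+1) = g * g^Q, and g^Q is a polynomial in
    x^Q, so only one factor \<open>g\<close> disturbs the expansion in base x^Q.\<close>
  also have "(g ^ ((Q + 1) div 2)) ^ 2 = g ^ (Q + 1)"
    unfolding power_mult[symmetric] using \<open>odd Q\<close> by (metis dvd_div_mult_self odd_even_add odd_one)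
  also have "\<dots> = g * pcompose g (monom 1 Q)"
    using frob_power_pcompose[of g m] by (simp add: Q_def)
  finally have eq: "U ^ 2 = S ^ 2 * (g * pcompose g (monom 1 Q))" .
  have Q0: "Q > 0" by (simp add: Q_def)
  have HQ: "2 * H \<le> Suc Q" using H by simp
  have g0': "pcompose g (monom 1 Q) \<noteq> 0"
    using g0 frob_power_pcompose[of g m] by (simp add: Q_def) (metis power_not_zero)
  have ex: "\<exists>j<J. v j \<noteq> 0" if "(\<Sum>j<J. v j * monom 1 (j * Q)) \<noteq> 0" for v :: "nat \<Rightarrow> 'p mod_ring poly"
    using that by (metis (no_types, lifting) lessThan_iff mult_zero_left sum.neutral)
  have nzsum: "(\<Sum>j<J. v j * monom 1 (j * Q)) \<noteq> 0"
    if v: "\<And>j. j < J \<Longrightarrow> v j \<in> polys_below H" and j: "j < J" "v j \<noteq> 0" for v :: "nat \<Rightarrow> 'p mod_ring poly" and j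
  proof
    assume 0: "(\<Sum>j<J. v j * monom 1 (j * Q)) = 0"
    obtain a r where a: "a < J" "v a \<noteq> 0" 
      "(\<Sum>j<J. v j * monom 1 (j * Q)) = monom 1 (a * Q) * (v a + monom 1 Q * r)"
      using lowest_digit_exists[of j J v Q] j by blast
    hence "v a = monom 1 Q * (- r)" using 0 by (simp add: Polynomial.monom_eq_0_iff eq_neg_iff_add_eq_0)
    moreover have "v a \<in> polys_below Q" using v[OF a(1)] by (rule polys_below_mono) (use HQ Q0 in simp)
    ultimately show False using monom_dvd_polys_below a(2) by (metis dvd_triv_left)
  qed
  have "U \<noteq> 0 \<and> S \<noteq> 0"
  proof -
    have iff: "U = 0 \<longleftrightarrow> S = 0" using eq g0 g0' by (metis mult_eq_0_iff power_eq_0_iff zero_neq_numeral power_zero_numeral)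
    from nz obtain j where j: "j < J" "u j \<noteq> 0 \<or> s j \<noteq> 0" by (elim exE conjE)
    have "U \<noteq> 0 \<or> S \<noteq> 0"
      using j(2)
    proof
      assume "u j \<noteq> 0"
      from nzsum[of u j, OF us(1) j(1) this] show ?thesis unfolding U_def by simp
    next
      assume "s j \<noteq> 0"
      from nzsum[of s j, OF us(2) j(1) this] show ?thesis unfolding S_def by simp
    qed
    with iff show ?thesis by blast
  qed
  hence U0: "U \<noteq> 0" and S0: "S \<noteq> 0" by blast+
  from ex[of u, folded U_def, OF U0] obtain j1 where "j1 < J" "u j1 \<noteq> 0" by (elim exE conjE)
  from lowest_digit_exists[of j1 J u, OF this, of Q] obtain a r
    where a: "a < J" "u a \<noteq> 0" "U = monom 1 (a * Q) * (u a + monom 1 Q * r)"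
    unfolding U_def by (elim exE conjE)
  from ex[of s, folded S_def, OF S0] obtain j2 where "j2 < J" "s j2 \<noteq> 0" by (elim exE conjE)
  from lowest_digit_exists[of j2 J s, OF this, of Q] obtain b r'
    where b: "b < J" "s b \<noteq> 0" "S = monom 1 (b * Q) * (s b + monom 1 Q * r')"
    unfolding S_def by (elim exE conjE)
  \<comment> \<open>The digits of g(x^Q) are the coefficients of \<open>g\<close>; the lowest is
    therefore a nonzero constant and cannot affect orders of vanishing.\<close>
  obtain e c r'' where e: "c \<noteq> 0"
     "pcompose g (monom 1 Q) = monom 1 (e * Q) * ([:c:] + monom 1 Q * r'')"
  proof -
    have "degree g < Suc (degree g)" "[:poly.coeff g (degree g):] \<noteq> 0" using g0 by auto
    from lowest_digit_exists[of _ _ "\<lambda>i. [:poly.coeff g i:]", OF this, of Q] show ?thesis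
      using that unfolding pcompose_monom_digits by (metis pCons_0_0)
  qed
  have U2: "U ^ 2 = monom 1 ((2 * a) * Q) * (u a ^ 2 + monom 1 Q * (2 * u a * r + monom 1 Q * r ^ 2))"
  proof -
    have "monom 1 ((2 * a) * Q) = (monom 1 (a * Q) :: 'p mod_ring poly) ^ 2"
      by (simp add: monom_power algebra_simps)
    thus ?thesis unfolding a(3) by (simp add: power2_eq_square algebra_simps)
  qed
  have "\<exists>R. S ^ 2 * (g * pcompose g (monom 1 Q))
     = monom 1 ((2 * b + e) * Q) * (s b ^ 2 * g * [:c:] + monom 1 Q * R)"
  proof -
    have "monom 1 ((2 * b + e) * Q) = (monom 1 (b * Q) :: 'p mod_ring poly) ^ 2 * monom 1 (e * Q)"
      by (simp add: monom_power Polynomial.mult_monom algebra_simps)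
    hence "S ^ 2 * (g * pcompose g (monom 1 Q)) = monom 1 ((2 * b + e) * Q) *
        ((s b + monom 1 Q * r') ^ 2 * (g * ([:c:] + monom 1 Q * r'')))"
      unfolding b(3) e(2) by (simp only: power_mult_distrib mult_ac)
    thus ?thesis unfolding lowest_digit_expand by blast
  qed
  then obtain R where R: "U ^ 2 = monom 1 ((2 * b + e) * Q) * (s b ^ 2 * g * [:c:] + monom 1 Q * R)"
    using eq by auto
  \<comment> \<open>Both sides have degree at most 2(H - 1) + deg g, which is below \<open>Q\<close>
    by assumption \<open>H\<close>; they are thus genuine digits.\<close>
  have "u a ^ 2 = s b ^ 2 * g * [:c:]"
  proof (rule lowest_digit_unique[OF _ _ _ _ R[unfolded U2]])
    have du: "degree (u a) < H" and ds: "degree (s b) < H" 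
      using us(1)[OF a(1)] us(2)[OF b(1)] a b by (simp_all add: polys_below_iff)
    show "u a ^ 2 \<in> polys_below Q"
      using a du HQ by (simp add: polys_below_iff degree_power_eq)
    show "s b ^ 2 * g * [:c:] \<in> polys_below Q"
      using b ds H g0 e by (simp add: polys_below_iff degree_power_eq degree_mult_eq)
  qed (use a b e g0 in auto)
  hence "map_poly to_ac (u a) ^ 2 = map_poly to_ac (s b) ^ 2 * map_poly to_ac g * map_poly to_ac [:c:]"
    by (metis map_poly_to_ac.hom_mult map_poly_to_ac.hom_power)
  moreover have "map_poly to_ac [:c:] = [:to_ac c:]" by (simp add: to_ac.map_poly_pCons_hom)
  ultimately have eq': "map_poly to_ac (u a) ^ 2 = map_poly to_ac (s b) ^ 2 * map_poly to_ac g * [:to_ac c:]" by (simp only:)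
  have nz': "map_poly to_ac (u a) \<noteq> 0" "map_poly to_ac (s b) \<noteq> 0" "map_poly to_ac g \<noteq> 0" "[:to_ac c:] \<noteq> 0"
    using a(2) b(2) g0 e(1) by simp_all
  have "order z (map_poly to_ac (u a) ^ 2) = 2 * order z (map_poly to_ac (u a))"
    using nz' by (simp add: power2_eq_square order_mult)
  moreover have "order z (map_poly to_ac (s b) ^ 2 * map_poly to_ac g * [:to_ac c:])
      = 2 * order z (map_poly to_ac (s b)) + 1 + order z [:to_ac c:]"
    using nz' simple by (simp add: power2_eq_square order_mult del: mult_pCons_right)
  moreover have "order z [:to_ac c:] = 0" using e(1) by (intro order_0I) simp
  ultimately have "2 * order z (map_poly to_ac (u a)) = 2 * order z (map_poly to_ac (s b)) + 1"
    unfolding eq' by simp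
  hence "even (2 * order z (map_poly to_ac (s b)) + 1)" by (metis dvd_triv_left)
  thus False by simp
qed

text \<open>At every \<open>z\<close> counted here, the \<open>Q\<close>-th power of \<open>W(z)\<close> is \<open>V(z)\<close>. By pigeonhole \<open>V = 0\<close> has a nontrivial
  solution \<open>(u, s)\<close>, so all these \<open>z\<close> are roots of the nonzero polynomial \<open>W\<close>.\<close>

lemma stepanov_bound:
  fixes g :: "'p::prime_card mod_ring poly" and \<epsilon> :: "'p mod_ring" and m :: nat
  defines "Q \<equiv> CARD('p) ^ m" and "D \<equiv> degree g"
  assumes simple: "order z0 (map_poly to_ac g) = 1"
    and g0: "g \<noteq> 0" and "odd Q" and large: "Q \<ge> 2 * D + 6"
  shows "2 * card {z. frob (2 * m) z = z \<and> poly_ac g z ^ ((Q ^ 2 - 1) div 2) = to_ac \<epsilon>}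
    \<le> Q ^ 2 + 2 * (2 * D + 1) * Q"
proof -
  \<comment> \<open>\<open>H\<close> is about as large as \<open>stepanov_nonzero\<close> allows.
    \<open>J\<close> lies just above Q/2: the degree of \<open>W\<close> is about J * Q, which gives
    the main term Q^2/2, and the excess D + 1 pays for the pigeonhole count.\<close>
  define H where "H = (Q - D) div 2"
  define J where "J = (Q + 1) div 2 + (D + 1)"
  define G where "G = g ^ ((Q + 1) div 2)"
  \<comment> \<open>A bound for the number of coefficients of \<open>V\<close>: substituting x^Q
    multiplies degrees by \<open>Q\<close>, the factor \<open>G\<close> adds D(Q+1)/2, and x^j adds
    less than \<open>J\<close>.\<close>
  define N where "N = Q * H + J + D * ((Q + 1) div 2)"
  define xp where "xp = (monom 1 :: nat \<Rightarrow> 'p mod_ring poly)"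
  define V where "V = (\<lambda>(u :: nat \<Rightarrow> 'p mod_ring poly, s :: nat \<Rightarrow> 'p mod_ring poly).
    \<Sum>j<J. (pcompose (u j) (xp Q) + [:\<epsilon>:] * pcompose (s j) (xp Q) * G) * xp j)"
  define T where "T = PiE {..<J} (\<lambda>_. polys_below H :: 'p mod_ring poly set)"
  obtain h where h: "Q = 2 * h + 1" using \<open>odd Q\<close> by (elim oddE)
  have Q0: "Q > 0" using h by simp
  \<comment> \<open>2JH is the number of free coefficients in (u, s) and equals QH + (2D + 3)H. The
    second summand beats J + D(Q+1)/2 once Q is at least 2D + 6.\<close>
  have count: "2 * J * H > N"
  proof -
    obtain e where e: "Q = 2 * D + 6 + e" using large by (metis le_iff_add)
    have J2: "2 * J = Q + 1 + 2 * (D + 1)" unfolding J_def h by simp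
    have H2: "2 * H \<ge> Q - D - 1" unfolding H_def by linarith
    have "(D + 1) * (Q + 1) + 2 * (D + 1) < (2 * D + 3) * (Q - D - 1)"
      unfolding e by (simp add: algebra_simps)
    also have "\<dots> \<le> (2 * D + 3) * (2 * H)" using H2 by (intro mult_left_mono) auto
    finally have "(D + 1) * (Q + 1) + 2 * (D + 1) < (2 * D + 3) * (2 * H)" .
    moreover have "2 * (2 * J * H) = 2 * (Q * H) + (2 * D + 3) * (2 * H)"
      unfolding J2 by (simp add: algebra_simps)
    moreover have "2 * N = 2 * (Q * H) + (Q + 1) + 2 * (D + 1) + D * (Q + 1)"
      unfolding N_def J_def h by (simp add: algebra_simps)
    ultimately show ?thesis by (simp add: algebra_simps)
  qed
  have degG: "degree G = D * ((Q + 1) div 2)"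
    using g0 by (simp add: G_def D_def degree_power_eq)
  have G0: "G \<noteq> 0" using g0 by (simp add: G_def)
  have pc: "degree (pcompose f (xp Q)) = Q * degree f" for f
    by (simp add: xp_def degree_pcompose Polynomial.degree_monom_eq)
  have "V us \<in> polys_below N" if "us \<in> T \<times> T" for us
  proof -
    obtain u s where us: "us = (u, s)" by fastforce
    have uH: "u j \<in> polys_below H" "s j \<in> polys_below H" if "j < J" for j
      using that \<open>us \<in> T \<times> T\<close> unfolding us T_def by auto
    have comp: "pcompose f (xp Q) \<in> polys_below (Q * H)" if "f \<in> polys_below H" for f
    proof (cases "f = 0")
      case False
      hence "Q * degree f < Q * H" using that Q0 by (simp add: polys_below_iff)
      thus ?thesis unfolding polys_below_iff pc by blast
    qed (simp add: polys_below_iff)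
    have "(pcompose (u j) (xp Q) + [:\<epsilon>:] * pcompose (s j) (xp Q) * G) * xp j \<in> polys_below N" if j: "j < J" for j
    proof -
      have "pcompose (u j) (xp Q) \<in> polys_below (Q * H + D * ((Q + 1) div 2))"
        by (rule polys_below_mono[OF comp[OF uH(1)[OF j]]]) simp
      moreover have "[:\<epsilon>:] * pcompose (s j) (xp Q) \<in> polys_below (Q * H)"
        by (rule polys_below_mult[OF _ comp[OF uH(2)[OF j]], of _ 1]) (auto simp: polys_below_iff)
      hence "[:\<epsilon>:] * pcompose (s j) (xp Q) * G \<in> polys_below (Q * H + D * ((Q + 1) div 2))"
        by (rule polys_below_mult[of _ _ _ "Suc (D * ((Q + 1) div 2))"]) (auto simp: polys_below_iff degG)
      ultimately have "pcompose (u j) (xp Q) + [:\<epsilon>:] * pcompose (s j) (xp Q) * G \<in> polys_below (Q * H + D * ((Q + 1) div 2))"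
        by (rule polys_below_add)
      thus ?thesis
        by (rule polys_below_mult[of _ _ _ J]) (use j in \<open>auto simp: polys_below_iff xp_def Polynomial.degree_monom_eq N_def\<close>)
    qed
    thus ?thesis unfolding us V_def prod.case by (intro polys_below_sum) auto
  qed
  hence sub: "V ` (T \<times> T) \<subseteq> polys_below N" by blast
  have finT: "finite T" unfolding T_def by (intro finite_PiE card_polys_below) auto
  have cardT: "card (T \<times> T) = CARD('p) ^ (2 * J * H)"
  proof -
    have "card T = CARD('p) ^ (H * J)"
      by (simp add: T_def card_PiE card_polys_below power_mult)
    moreover have "2 * J * H = H * J + H * J" by simp
    ultimately show ?thesis by (simp only: card_cartesian_product power_add)
  qed
  have p1: "CARD('p) > 1" using prime_card prime_gt_1_nat by blast
  have "\<not> inj_on V (T \<times> T)"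
  proof
    assume "inj_on V (T \<times> T)"
    hence "card (T \<times> T) \<le> card (polys_below N :: 'p mod_ring poly set)"
      using sub by (metis card_inj_on_le card_polys_below(1))
    hence "CARD('p) ^ (2 * J * H) \<le> CARD('p) ^ N"
      unfolding cardT by (simp add: card_polys_below)
    thus False using count p1 by (simp add: power_increasing_iff)
  qed
  then obtain x y where xy: "x \<in> T \<times> T" "y \<in> T \<times> T" "x \<noteq> y" "V x = V y"
    unfolding inj_on_def by blast
  have xyT: "fst x \<in> T" "snd x \<in> T" "fst y \<in> T" "snd y \<in> T"
    using xy by (simp_all add: mem_Times_iff)
  define u where "u = (\<lambda>j. fst x j - fst y j)"
  define s where "s = (\<lambda>j. snd x j - snd y j)"
  have TH: "v j \<in> polys_below H" if "v \<in> T" "j < J" for v j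
    using that unfolding T_def by (blast intro: PiE_mem)
  have usH: "u j \<in> polys_below H" "s j \<in> polys_below H" if "j < J" for j
    unfolding u_def s_def by (intro polys_below_diff TH xyT that)+
  have nz: "\<exists>j<J. u j \<noteq> 0 \<or> s j \<noteq> 0"
  proof (rule ccontr)
    assume "\<not> (\<exists>j<J. u j \<noteq> 0 \<or> s j \<noteq> 0)"
    hence *: "fst x j = fst y j" "snd x j = snd y j" if "j < J" for j
      using that by (force simp: u_def s_def)+
    have "fst x = fst y"
      by (rule PiE_ext[OF xyT(1,3)[unfolded T_def]]) (use * in blast)
    moreover have "snd x = snd y"
      by (rule PiE_ext[OF xyT(2,4)[unfolded T_def]]) (use * in blast)
    ultimately show False using xy(3) by (simp add: prod_eq_iff)
  qed
  have V0: "V (u, s) = 0"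
  proof -
    have "V (u, s) = V x - V y"
      unfolding V_def case_prod_beta sum_subtractf[symmetric]
      by (rule sum.cong[OF refl]) (simp add: u_def s_def pcompose_diff algebra_simps smult_diff_right)
    thus ?thesis using xy by simp
  qed
  define W where "W = (\<Sum>j<J. (u j + s j * G) * xp (j * Q))"
  have W0: "W \<noteq> 0"
    unfolding W_def xp_def G_def Q_def
    by (rule stepanov_nonzero[OF simple g0, of _ H]) (use \<open>odd Q\<close> usH nz large in \<open>auto simp: Q_def[symmetric] H_def D_def[symmetric]\<close>)
  have degW: "degree W \<le> (H - 1) + D * ((Q + 1) div 2) + (J - 1) * Q"
    unfolding W_def
  proof (rule degree_sum_le)
    fix j assume j: "j \<in> {..<J}"
    have "degree (u j) \<le> H - 1" "degree (s j) \<le> H - 1" using usH[of j] j by (auto simp: polys_below_iff)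
    hence "degree (u j + s j * G) \<le> (H - 1) + D * ((Q + 1) div 2)"
      by (intro degree_add_le order.trans[OF degree_mult_le]) (auto simp: degG)
    moreover have "degree (xp (j * Q)) \<le> (J - 1) * Q" using j by (auto simp: xp_def Polynomial.degree_monom_eq)
    ultimately show "degree ((u j + s j * G) * xp (j * Q)) \<le> (H - 1) + D * ((Q + 1) div 2) + (J - 1) * Q"
      by (intro order.trans[OF degree_mult_le] add_mono)
  qed simp
  have root: "poly_ac W z = 0" if z: "frob (2 * m) z = z" "poly_ac g z ^ ((Q ^ 2 - 1) div 2) = to_ac \<epsilon>" for z
  proof -
    have zQ: "frob m z = z ^ Q" by (simp add: frob_def Q_def)
    have zQQ: "(z ^ Q) ^ Q = z" using z(1) frob_frob[of m m z] by (simp add: frob_def Q_def mult_2)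
    \<comment> \<open>Since Q(Q+1)/2 = (Q^2-1)/2 + (Q+1)/2, the prescribed character value of g(z)
      comes out as the factor \<epsilon>.\<close>
    have gz: "frob m (poly_ac G z) = to_ac \<epsilon> * poly_ac G z"
    proof -
      have "frob m (poly_ac G z) = poly_ac g z ^ (Q * ((Q + 1) div 2))"
        by (simp add: G_def map_poly_to_ac.hom_power frob_def Q_def[symmetric] power_mult[symmetric] mult.commute)
      also have "Q * ((Q + 1) div 2) = (Q ^ 2 - 1) div 2 + (Q + 1) div 2"
        unfolding h by (simp add: power2_eq_square algebra_simps)
      also have "poly_ac g z ^ \<dots> = to_ac \<epsilon> * poly_ac G z"
        by (simp only: power_add z(2) G_def map_poly_to_ac.hom_power poly_power)
      finally show ?thesis .
    qed
    have "frob m (poly_ac W z) = (\<Sum>j<J. (poly_ac (u j) (z ^ Q) + poly_ac (s j) (z ^ Q) * (to_ac \<epsilon> * poly_ac G z)) * z ^ j)"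
    proof -
      \<comment> \<open>The high powers x^(jQ) collapse here: their Q-th power at \<open>z\<close>
        is z^(jQ^2) = z^j. This is why \<open>V\<close> has far fewer coefficients than the degree
        of \<open>W\<close> suggests.\<close>
      have Xz: "frob m (poly_ac (xp (j * Q)) z) = z ^ j" for j
      proof -
        have "frob m (poly_ac (xp (j * Q)) z) = frob m (z ^ (j * Q))" by (simp add: xp_def Polynomial.poly_monom)
        also have "\<dots> = ((z ^ Q) ^ Q) ^ j"
          by (simp only: frob.hom_power zQ power_mult[symmetric] ac_simps)
        finally show ?thesis by (simp only: zQQ)
      qed
      have "frob m (poly_ac W z) = (\<Sum>j<J. frob m (poly_ac ((u j + s j * G) * xp (j * Q)) z))"
        unfolding W_def map_poly_to_ac.hom_sum poly_sum frob.hom_sum ..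
      also have "\<dots> = (\<Sum>j<J. (frob m (poly_ac (u j) z) + frob m (poly_ac (s j) z) * frob m (poly_ac G z)) * frob m (poly_ac (xp (j * Q)) z))"
        by (simp only: map_poly_to_ac.hom_add map_poly_to_ac.hom_mult poly_add poly_mult frob.hom_add frob.hom_mult)
      finally show ?thesis unfolding Xz gz unfolding frob_poly_ac zQ .
    qed
    also have "\<dots> = poly_ac (V (u, s)) z"
    proof -
      have comp: "poly_ac (pcompose f (xp Q)) z = poly_ac f (z ^ Q)" for f
        by (simp add: to_ac.map_poly_pcompose poly_pcompose xp_def Polynomial.poly_monom)
      have xpj: "poly_ac (xp j) z = z ^ j" for j by (simp add: xp_def Polynomial.poly_monom)
      have const: "poly_ac [:\<epsilon>:] z = to_ac \<epsilon>" by (simp add: to_ac.map_poly_pCons_hom)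
      have hom: "poly_ac ((a + [:\<epsilon>:] * b * G) * x) z
         = (poly_ac a z + poly_ac b z * (to_ac \<epsilon> * poly_ac G z)) * poly_ac x z" for a b x
        unfolding map_poly_to_ac.hom_add map_poly_to_ac.hom_mult poly_add poly_mult const
        by (simp only: mult_ac)
      have "poly_ac (V (u, s)) z = (\<Sum>j<J. poly_ac ((pcompose (u j) (xp Q) + [:\<epsilon>:] * pcompose (s j) (xp Q) * G) * xp j) z)"
        unfolding V_def prod.case map_poly_to_ac.hom_sum poly_sum ..
      also have "\<dots> = (\<Sum>j<J. (poly_ac (u j) (z ^ Q) + poly_ac (s j) (z ^ Q) * (to_ac \<epsilon> * poly_ac G z)) * z ^ j)"
        unfolding hom comp xpj ..
      finally show ?thesis ..
    qed
    finally show ?thesis using V0 by simp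
  qed
  have "card {z. frob (2 * m) z = z \<and> poly_ac g z ^ ((Q ^ 2 - 1) div 2) = to_ac \<epsilon>} \<le> card {z. poly_ac W z = 0}"
  proof (rule card_mono)
    show "finite {z. poly_ac W z = 0}" by (rule poly_roots_finite) (simp add: W0)
  qed (use root in blast)
  also have "\<dots> \<le> degree W"
    using card_poly_roots_bound[of "map_poly to_ac W"] W0 by simp
  finally have "2 * card {z. frob (2 * m) z = z \<and> poly_ac g z ^ ((Q ^ 2 - 1) div 2) = to_ac \<epsilon>}
     \<le> 2 * (H - 1) + 2 * (D * ((Q + 1) div 2)) + 2 * (J - 1) * Q" using degW by linarith
  also have "\<dots> \<le> Q ^ 2 + 2 * (2 * D + 1) * Q"
  proof -
    have "2 * (H - 1) \<le> Q" unfolding H_def by linarith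
    moreover have "2 * (D * ((Q + 1) div 2)) = D * (Q + 1)" unfolding h by (simp add: algebra_simps)
    moreover have "2 * (J - 1) * Q = Q * Q + Q + 2 * D * Q" unfolding J_def by (simp add: h algebra_simps)
    moreover have "D * 1 \<le> D * Q" using Q0 by (intro mult_left_mono) auto
    moreover have "D * (Q + 1) = D * Q + D" "2 * (2 * D + 1) * Q = 4 * (D * Q) + 2 * Q" "2 * D * Q = 2 * (D * Q)"
      by (simp_all add: algebra_simps)
    ultimately show ?thesis unfolding power2_eq_square by linarith
  qed
  finally show ?thesis .
qed

section \<open>The quadratic character on finite extensions\<close>

text \<open>For \<open>CARD('p) = 2\<close> the exponent is \<open>0\<close> and \<open>qchar\<close> is constantly \<open>1\<close>.\<close>

definition qchar :: "'p::prime_card mod_ring \<Rightarrow> real" where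
  "qchar b = (if b ^ ((CARD('p) - 1) div 2) = 1 then 1 else if b ^ ((CARD('p) - 1) div 2) = -1 then -1 else 0)"

text \<open>For odd characteristic and positive \<open>n\<close>, this is the quadratic character of
  the field with p^n elements, by Euler's criterion; it is used at elements of that field.\<close>

definition qchar_ext :: "nat \<Rightarrow> 'p::prime_card mod_ring alg_closure \<Rightarrow> real" where
  "qchar_ext n y = (if y ^ ((CARD('p) ^ n - 1) div 2) = 1 then 1
     else if y ^ ((CARD('p) ^ n - 1) div 2) = -1 then -1 else 0)"

lemma one_neq_neg_one_mod_ring:
  assumes "odd CARD('p::prime_card)"
  shows "(1 :: 'p mod_ring) \<noteq> -1" "(-1 :: 'p mod_ring) \<noteq> 1"
    "(1 :: 'p mod_ring alg_closure) \<noteq> -1" "(-1 :: 'p mod_ring alg_closure) \<noteq> 1"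
proof -
  have "\<not> CARD('p) dvd 2"
    using assms prime_card[where ?'a = 'p] by (metis dvd_refl primes_dvd_imp_eq two_is_prime_nat)
  hence 2: "(2 :: 'p mod_ring) \<noteq> 0"
    using of_nat_eq_0_iff_char_dvd[of 2, where ?'a = "'p mod_ring"] by simp
  show "(1 :: 'p mod_ring) \<noteq> -1"
  proof
    assume "(1 :: 'p mod_ring) = -1"
    hence "(1 :: 'p mod_ring) + 1 = 0" by simp
    thus False using 2 by (simp only: one_add_one)
  qed
  thus "(-1 :: 'p mod_ring) \<noteq> 1" by metis
  show "(1 :: 'p mod_ring alg_closure) \<noteq> -1"
  proof
    assume "(1 :: 'p mod_ring alg_closure) = -1"
    hence "to_ac (1 :: 'p mod_ring) = to_ac (-1)" by simp
    thus False using \<open>(1 :: 'p mod_ring) \<noteq> -1\<close> by (simp only: to_ac_eq_iff)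
  qed
  thus "(-1 :: 'p mod_ring alg_closure) \<noteq> 1" by metis
qed

lemma euler_power_cases:
  fixes y :: "'a::idom"
  assumes "y ^ q = y" "odd q" "q > 1"
  shows "y = 0 \<or> y ^ ((q - 1) div 2) = 1 \<or> y ^ ((q - 1) div 2) = -1"
proof (cases "y = 0")
  case False
  obtain h where h: "q = 2 * h + 1" using assms by (elim oddE)
  have "y * y ^ (2 * h) = y * 1" using assms(1) h by simp
  hence "y ^ (2 * h) = 1" using False by simp
  hence "(y ^ h - 1) * (y ^ h + 1) = 0" by (simp add: algebra_simps mult_2[symmetric] flip: power_add)
  hence "y ^ h - 1 = 0 \<or> y ^ h + 1 = 0" by simp
  thus ?thesis using h by (simp add: eq_neg_iff_add_eq_0)
qed simp

lemma prime_card_gt_1: "CARD('p::prime_card) > 1"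
  using prime_card prime_gt_1_nat by blast

lemma qchar_cases:
  fixes b :: "'p::prime_card mod_ring"
  assumes "odd CARD('p)"
  shows "b = 0 \<and> qchar b = 0 \<or> b ^ ((CARD('p) - 1) div 2) = 1 \<and> qchar b = 1 \<and> b \<noteq> 0
    \<or> b ^ ((CARD('p) - 1) div 2) = -1 \<and> qchar b = -1 \<and> b \<noteq> 0"
proof -
  obtain h where h: "CARD('p) = 2 * h + 1" using assms by (elim oddE)
  have h0: "h > 0" using h prime_card_gt_1[where ?'p = 'p] by simp
  have "b ^ CARD('p) = b" using finite_field_power_card_eq_same[of b] by simp
  from euler_power_cases[OF this assms prime_card_gt_1] show ?thesis
    using one_neq_neg_one_mod_ring[OF assms] h h0 by (auto simp: qchar_def power_0_left)
qed

lemma qchar_0 [simp]: "odd CARD('p) \<Longrightarrow> qchar (0 :: 'p::prime_card mod_ring) = 0"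
  using qchar_cases[of "0 :: 'p mod_ring"] by (auto simp: power_0_left split: if_splits)

lemma qchar_1 [simp]: "qchar 1 = 1"
  by (simp add: qchar_def)

lemma qchar_mult:
  fixes a b :: "'p::prime_card mod_ring"
  assumes "odd CARD('p)"
  shows "qchar (a * b) = qchar a * qchar b"
proof (cases "a = 0 \<or> b = 0")
  case False
  thus ?thesis
    using qchar_cases[OF assms, of a] qchar_cases[OF assms, of b] one_neq_neg_one_mod_ring[OF assms]
    by (auto simp: qchar_def power_mult_distrib)
qed (use assms in auto)

lemma qchar_power: "odd CARD('p) \<Longrightarrow> qchar (a ^ k) = qchar a ^ k" for a :: "'p::prime_card mod_ring"
  by (induction k) (auto simp: qchar_mult)

lemma qchar_prod: "odd CARD('p) \<Longrightarrow> qchar (\<Prod>i\<in>A. f i) = (\<Prod>i\<in>A. qchar (f i))"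
  for f :: "'b \<Rightarrow> 'p::prime_card mod_ring"
  by (induction A rule: infinite_finite_induct) (auto simp: qchar_mult)

lemma abs_qchar_le_1: "\<bar>qchar a\<bar> \<le> 1"
  by (simp add: qchar_def)

lemma frob_norm_power: "(\<Prod>i<n. frob i y) = y ^ (\<Sum>i<n. CARD('p) ^ i)"
  for y :: "'p::prime_card mod_ring alg_closure"
  by (simp add: frob_def power_sum)

lemma geometric_sum_half:
  fixes p :: nat
  assumes "odd p"
  shows "(\<Sum>i<n. p ^ i) * ((p - 1) div 2) = (p ^ n - 1) div 2"
proof -
  obtain h where h: "p = 2 * h + 1" using assms by (elim oddE)
  have "2 * ((\<Sum>i<n. p ^ i) * h) + 1 = p ^ n"
  proof (induction n)
    case (Suc n)
    have "2 * ((\<Sum>i<Suc n. p ^ i) * h) + 1 = (2 * ((\<Sum>i<n. p ^ i) * h) + 1) + 2 * h * p ^ n"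
      by (simp add: algebra_simps)
    also have "\<dots> = p ^ Suc n" unfolding Suc by (simp add: h algebra_simps)
    finally show ?case .
  qed simp
  thus ?thesis using h by (simp add: h)
qed

text \<open>The norm is the power with exponent 1 + p + ... + p^(n-1), and multiplying this exponent
  by (p-1)/2 gives (p^n-1)/2.\<close>

lemma qchar_ext_norm:
  fixes y :: "'p::prime_card mod_ring alg_closure"
  assumes "odd CARD('p)" "(\<Prod>i<n. frob i y) = to_ac b"
  shows "qchar_ext n y = qchar b"
proof -
  have "y ^ ((CARD('p) ^ n - 1) div 2) = (\<Prod>i<n. frob i y) ^ ((CARD('p) - 1) div 2)"
    unfolding frob_norm_power power_mult[symmetric] geometric_sum_half[OF assms(1)] ..
  also have "\<dots> = to_ac (b ^ ((CARD('p) - 1) div 2))" by (simp add: assms(2))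
  finally have y: "y ^ ((CARD('p) ^ n - 1) div 2) = to_ac (b ^ ((CARD('p) - 1) div 2))" .
  have "to_ac c = -1 \<longleftrightarrow> c = -1" for c :: "'p mod_ring"
    by (metis to_ac_1 to_ac_eq_iff to_ac_minus)
  thus ?thesis unfolding qchar_ext_def qchar_def y to_ac_eq_1_iff by (simp only:)
qed

text \<open>This is f(x^p - x) for f(y) the product of the a - y, a in \<open>R\<close>; the linear
  polynomial \<open>[:a, 1:]\<close> already contains the summand x.\<close>

definition artin_schreier_prod :: "'p::prime_card mod_ring set \<Rightarrow> 'p mod_ring poly" where
  "artin_schreier_prod R = (\<Prod>a\<in>R. [:a, 1:] - monom 1 CARD('p))"

lemma poly_ac_artin_schreier_prod:
  "poly_ac (artin_schreier_prod R) z = (\<Prod>a\<in>R. to_ac a - (frob 1 z - z))"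
  unfolding artin_schreier_prod_def map_poly_to_ac.hom_prod poly_prod
  by (intro prod.cong refl)
     (simp add: map_poly_to_ac.hom_minus to_ac.map_poly_pCons_hom to_ac.map_poly_hom_monom Polynomial.poly_monom frob_def)

lemma artin_schreier_factor_nonzero:
  "[:a, 1:] - monom 1 CARD('p) \<noteq> (0 :: 'p::prime_card mod_ring poly)"
proof
  assume "[:a, 1:] - monom 1 CARD('p) = (0 :: 'p mod_ring poly)"
  hence "poly.coeff ([:a, 1:] - monom 1 CARD('p)) CARD('p) = (0 :: 'p mod_ring)" by simp
  thus False using prime_card_gt_1[where ?'p = 'p] by (auto simp: coeff_pCons split: nat.splits)
qed

lemma artin_schreier_prod_nonzero: "artin_schreier_prod R \<noteq> 0"
  unfolding artin_schreier_prod_def prod_zero_iff[OF finite] using artin_schreier_factor_nonzero by blast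

text \<open>Each factor a + x - x^p has derivative 1, and different factors share no root because
  x^p - x would have to take two values.\<close>

lemma artin_schreier_prod_simple_root:
  fixes R :: "'p::prime_card mod_ring set"
  assumes "R \<noteq> {}"
  obtains z where "order z (map_poly to_ac (artin_schreier_prod R)) = 1"
proof -
  obtain a where a: "a \<in> R" using assms by blast
  let ?f = "\<lambda>a :: 'p mod_ring. [:a, 1:] - monom 1 CARD('p)"
  obtain z where z: "frob 1 z - z = to_ac a"
    using card_frob_diff_fibre[of "to_ac a"] prime_card_gt_1[where ?'p = 'p]
    by (metis (mono_tags, lifting) Collect_empty_eq card.empty not_one_less_zero)
  have ev: "poly_ac (?f b) y = to_ac b - (frob 1 y - y)" for b y
    by (simp add: map_poly_to_ac.hom_minus to_ac.map_poly_pCons_hom to_ac.map_poly_hom_monom Polynomial.poly_monom frob_def)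
  have "artin_schreier_prod R = ?f a * (\<Prod>b\<in>R - {a}. ?f b)"
    unfolding artin_schreier_prod_def by (rule prod.remove) (use a in auto)
  hence eq: "map_poly to_ac (artin_schreier_prod R) = map_poly to_ac (?f a) * map_poly to_ac (\<Prod>b\<in>R - {a}. ?f b)"
    by (simp only: map_poly_to_ac.hom_mult)
  have "poly_ac (\<Prod>b\<in>R - {a}. ?f b) z \<noteq> 0"
    unfolding map_poly_to_ac.hom_prod poly_prod ev z by simp
  hence o0: "order z (map_poly to_ac (\<Prod>b\<in>R - {a}. ?f b)) = 0" by (rule order_0I)
  have "pderiv (?f a) = 1"
    by (simp add: pderiv_diff pderiv_monom pderiv_pCons of_nat_eq_0_iff_char_dvd one_pCons)
  hence "pderiv (map_poly to_ac (?f a)) = 1"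
    by (metis to_ac.map_poly_pderiv map_poly_to_ac.hom_one)
  moreover have "poly_ac (?f a) z = 0" unfolding ev z by simp
  ultimately have oa: "order z (map_poly to_ac (?f a)) = 1"
    by (intro order_eq_1) simp_all
  have "map_poly to_ac (artin_schreier_prod R) \<noteq> 0" using artin_schreier_prod_nonzero by simp
  from order_mult[OF this[unfolded eq], of z]
  have "order z (map_poly to_ac (artin_schreier_prod R)) = 1"
    unfolding eq oa o0 by (rule trans) (rule add_0_right)
  thus ?thesis by (rule that)
qed

lemma qchar_ext_sum_bound:
  fixes R :: "'p::prime_card mod_ring set"
  assumes "odd CARD('p)" "R \<noteq> {}"
  shows "\<exists>C. \<forall>m>0. \<bar>\<Sum>z | frob (2 * m) z = z. qchar_ext (2 * m) (poly_ac (artin_schreier_prod R) z)\<bar> \<le> C * real CARD('p) ^ m"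
proof -
  define p where "p = CARD('p)"
  define g where "g = artin_schreier_prod R"
  define D where "D = degree g"
  obtain z0 where z0: "order z0 (map_poly to_ac g) = 1"
    using artin_schreier_prod_simple_root[OF assms(2)] unfolding g_def by blast
  have g0: "g \<noteq> 0" unfolding g_def by (rule artin_schreier_prod_nonzero)
  \<comment> \<open>Three contributions are added: 2D + 6 covers \<open>Q\<close> too small for
    Stepanov's method, 2(2D + 1) is its error term, and \<open>D\<close> bounds the zeros of
    \<open>g\<close>.\<close>
  define C where "C = real (2 * D + 6 + 2 * (2 * D + 1) + D)"
  have "\<bar>\<Sum>z | frob (2 * m) z = z. qchar_ext (2 * m) (poly_ac g z)\<bar> \<le> C * real p ^ m" if m: "m > 0" for m
  proof -
    define Q where "Q = p ^ m"
    define Z where "Z = {z :: 'p mod_ring alg_closure. frob (2 * m) z = z}"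
    define E where "E = (\<lambda>z. poly_ac g z ^ ((Q ^ 2 - 1) div 2))"
    have p1: "p > 1" using prime_card_gt_1[where ?'p = 'p] by (simp add: p_def)
    have Q1: "Q > 1" unfolding Q_def using p1 m by (rule one_less_power)
    have oddQ: "odd Q" using assms(1) by (simp add: Q_def p_def)
    have qQ: "CARD('p) ^ (2 * m) = Q ^ 2" by (simp add: Q_def p_def power_mult[symmetric] mult.commute)
    have cardZ: "card Z = Q ^ 2" unfolding Z_def using card_frob_fixed[of "2 * m", where ?'p = 'p] m qQ by simp
    have finZ: "finite Z" using cardZ Q1 by (intro card_ge_0_finite) simp
    define Zp where "Zp = {z \<in> Z. E z = 1}"
    define Zm where "Zm = {z \<in> Z. E z = -1}"
    define Z0 where "Z0 = {z \<in> Z. poly_ac g z = 0}"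
    have E0: "E z = 0" if "poly_ac g z = 0" for z
    proof -
      have "(Q ^ 2 - 1) div 2 > 0"
      proof -
        have "3 * 3 \<le> Q * Q" using Q1 oddQ by (intro mult_mono) (auto elim!: oddE)
        thus ?thesis by (simp add: power2_eq_square)
      qed
      thus ?thesis using that by (simp add: E_def power_0_left)
    qed
    have "E z = 1 \<or> E z = -1 \<or> poly_ac g z = 0" if "z \<in> Z" for z
    proof -
      have "poly_ac g z ^ (Q ^ 2) = poly_ac g z"
        using that frob_poly_ac[of "2 * m" g z] unfolding Z_def frob_def qQ by simp
      moreover have "Q ^ 2 > 1" using Q1 by (rule one_less_power) simp
      ultimately show ?thesis using euler_power_cases[of "poly_ac g z" "Q ^ 2"] oddQ unfolding E_def by auto
    qed
    hence ZU: "Z = Zp \<union> Zm \<union> Z0" unfolding Zp_def Zm_def Z0_def by blast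
    note ne = one_neq_neg_one_mod_ring[OF assms(1)]
    have disj: "Zp \<inter> Zm = {}" "Zp \<inter> Z0 = {}" "Zm \<inter> Z0 = {}"
      using E0 ne unfolding Zp_def Zm_def Z0_def by auto
    have fin: "finite Zp" "finite Zm" "finite Z0" using finZ unfolding Zp_def Zm_def Z0_def by auto
    have "card Z = card (Zp \<union> Zm) + card Z0"
      unfolding ZU by (rule card_Un_disjoint) (use fin disj in auto)
    also have "card (Zp \<union> Zm) = card Zp + card Zm"
      by (rule card_Un_disjoint) (use fin disj in auto)
    finally have total: "card Zp + card Zm + card Z0 = Q ^ 2" by (simp add: cardZ)
    have Z0D: "card Z0 \<le> D"
    proof -
      have "card Z0 \<le> card {z. poly_ac g z = 0}"
        unfolding Z0_def using g0 by (intro card_mono poly_roots_finite) auto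
      also have "\<dots> \<le> D" using card_poly_roots_bound[of "map_poly to_ac g"] g0 by (simp add: D_def)
      finally show ?thesis .
    qed
    have sum: "(\<Sum>z\<in>Z. qchar_ext (2 * m) (poly_ac g z)) = real (card Zp) - real (card Zm)"
    proof -
      have "(\<Sum>z\<in>Z. qchar_ext (2 * m) (poly_ac g z)) = (\<Sum>z\<in>Z. of_bool (z \<in> Zp) - of_bool (z \<in> Zm))"
        by (rule sum.cong) (use ne in \<open>auto simp: qchar_ext_def Zp_def Zm_def E_def qQ\<close>)
      also have "\<dots> = real (card (Z \<inter> Zp)) - real (card (Z \<inter> Zm))"
        using finZ by (simp add: sum_subtractf sum.inter_restrict[symmetric] of_bool_def sum.If_cases)
      also have "Z \<inter> Zp = Zp" unfolding ZU by blast
      also have "Z \<inter> Zm = Zm" unfolding ZU by blast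
      finally show ?thesis .
    qed
    have "\<bar>real (card Zp) - real (card Zm)\<bar> \<le> C * real Q"
    proof (cases "Q \<ge> 2 * D + 6")
      case True
      have "Zp = {z. frob (2 * m) z = z \<and> poly_ac g z ^ ((Q ^ 2 - 1) div 2) = to_ac 1}"
        unfolding Zp_def Z_def E_def by simp
      hence "2 * card Zp \<le> Q ^ 2 + 2 * (2 * D + 1) * Q"
        using stepanov_bound[OF z0 g0, of m 1, folded p_def, folded Q_def D_def, OF oddQ True] by (simp only:)
      moreover have "Zm = {z. frob (2 * m) z = z \<and> poly_ac g z ^ ((Q ^ 2 - 1) div 2) = to_ac (-1)}"
        unfolding Zm_def Z_def E_def by simp
      hence "2 * card Zm \<le> Q ^ 2 + 2 * (2 * D + 1) * Q"
        using stepanov_bound[OF z0 g0, of m "-1", folded p_def, folded Q_def D_def, OF oddQ True] by (simp only:)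
      moreover define T where "T = 2 * (2 * D + 1) * Q"
      \<comment> \<open>Replacing Q^2 in each upper bound by the total of the three counts turns it
        into a bound for the difference of the counts.\<close>
      ultimately have "card Zp \<le> card Zm + card Z0 + T" "card Zm \<le> card Zp + card Z0 + T"
        using total by linarith+
      hence "\<bar>real (card Zp) - real (card Zm)\<bar> \<le> real (D + T)" using Z0D by linarith
      also have "D + T \<le> (2 * D + 6 + 2 * (2 * D + 1) + D) * Q"
      proof -
        have "D * 1 \<le> D * Q" using Q1 by (intro mult_left_mono) auto
        moreover have "(2 * D + 6 + 2 * (2 * D + 1) + D) * Q = 7 * (D * Q) + 8 * Q" "T = 4 * (D * Q) + 2 * Q"
          unfolding T_def by (simp_all add: algebra_simps)
        ultimately show ?thesis by linarith
      qed
      finally show ?thesis by (simp add: C_def)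
    next
      case False
      have "card Zp \<le> Q * Q" "card Zm \<le> Q * Q" using total unfolding power2_eq_square by linarith+
      hence "\<bar>real (card Zp) - real (card Zm)\<bar> \<le> real (Q * Q)" by linarith
      also have "Q * Q \<le> (2 * D + 6 + 2 * (2 * D + 1) + D) * Q" using False by (intro mult_right_mono) auto
      finally show ?thesis by (simp add: C_def)
    qed
    thus ?thesis using sum by (simp add: Z_def Q_def)
  qed
  thus ?thesis unfolding g_def p_def by blast
qed

section \<open>Additive characters and power sums\<close>

definition psi :: "'p::prime_card mod_ring \<Rightarrow> complex" where
  "psi x = cis (2 * pi * real_of_int (to_int_mod_ring x) / real CARD('p))"

lemma cis_int_mod:
  assumes "q > 0"
  shows "cis (2 * pi * real_of_int (i mod int q) / real q) = cis (2 * pi * real_of_int i / real q)"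
proof -
  have "real_of_int i = real_of_int (i mod int q) + real q * real_of_int (i div int q)"
    by (metis mod_mult_div_eq of_int_add of_int_mult of_int_of_nat_eq)
  hence "2 * pi * real_of_int i / real q = 2 * pi * real_of_int (i mod int q) / real q + 2 * pi * real_of_int (i div int q)"
    using assms by (simp add: field_simps)
  hence "cis (2 * pi * real_of_int i / real q) = cis (2 * pi * real_of_int (i mod int q) / real q) * cis (2 * pi * real_of_int (i div int q))"
    by (simp only: cis_mult)
  also have "cis (2 * pi * real_of_int (i div int q)) = 1" by simp
  finally show ?thesis by simp
qed

lemma psi_of_int: "psi (of_int i :: 'p::prime_card mod_ring) = cis (2 * pi * real_of_int i / real CARD('p))"
proof -
  have "to_int_mod_ring (of_int i :: 'p mod_ring) = i mod int CARD('p)"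
    unfolding of_int_of_int_mod_ring by transfer simp
  thus ?thesis unfolding psi_def using cis_int_mod[of "CARD('p)" i] by simp
qed

lemma psi_0 [simp]: "psi 0 = 1"
  using psi_of_int[of 0] by simp

lemma psi_add: "psi (x + y) = psi x * psi y" for x y :: "'p::prime_card mod_ring"
proof -
  obtain i j where "x = of_int i" "y = of_int j"
    by (metis of_int_mod_ring_to_int_mod_ring of_int_of_int_mod_ring)
  moreover have "psi (of_int (i + j) :: 'p mod_ring) = psi (of_int i :: 'p mod_ring) * psi (of_int j :: 'p mod_ring)"
    unfolding psi_of_int cis_mult by (simp add: add_divide_distrib distrib_left)
  ultimately show ?thesis by simp
qed

lemma norm_psi [simp]: "cmod (psi x) = 1"
  by (simp add: psi_def)

lemma psi_uminus: "psi (- x) = cnj (psi x)"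
proof -
  have "psi (- x) * psi x = 1" by (simp flip: psi_add)
  moreover have "cnj (psi x) * psi x = 1"
    using complex_norm_square[of "psi x"] by (simp add: mult.commute)
  ultimately show ?thesis
    by (metis mult_right_cancel norm_psi norm_zero zero_neq_one)
qed

lemma psi_power: "psi x ^ k = psi (of_nat k * x)"
  by (induction k) (auto simp: psi_add algebra_simps)

lemma psi_nontrivial:
  fixes x :: "'p::prime_card mod_ring"
  assumes "x \<noteq> 0"
  shows "\<exists>t. psi (t * x) \<noteq> 1"
proof -
  have p1: "CARD('p) > 1" by (rule prime_card_gt_1)
  have "psi (1 :: 'p mod_ring) \<noteq> 1"
  proof
    assume "psi (1 :: 'p mod_ring) = 1"
    hence "cis (2 * pi / real CARD('p)) = 1" using psi_of_int[of 1, where ?'p = 'p] by simp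
    then obtain n :: int where "2 * pi / real CARD('p) = of_int n * (2 * pi)"
      by (auto simp: cis_conv_exp exp_eq_1)
    hence "1 = of_int n * real CARD('p)" using p1 by (simp add: field_simps)
    hence "1 = n * int CARD('p)" by (metis of_int_1 of_int_eq_iff of_int_mult of_int_of_nat_eq)
    hence "int CARD('p) dvd 1" by (metis dvd_triv_right)
    thus False using p1 by simp
  qed
  thus ?thesis using assms by (intro exI[of _ "inverse x"]) simp
qed

lemma sum_psi: "(\<Sum>t\<in>UNIV. psi (t * x)) = (if x = 0 then of_nat CARD('p) else 0)"
  for x :: "'p::prime_card mod_ring"
proof (cases "x = 0")
  case False
  then obtain s where s: "psi (s * x) \<noteq> 1" using psi_nontrivial by blast
  have "(\<Sum>t\<in>UNIV. psi (t * x)) = (\<Sum>t\<in>UNIV. psi ((s + t) * x))"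
    by (rule sum.reindex_bij_witness[of _ "\<lambda>t. s + t" "\<lambda>t. t - s"]) auto
  also have "\<dots> = psi (s * x) * (\<Sum>t\<in>UNIV. psi (t * x))"
    by (simp add: psi_add distrib_right sum_distrib_left)
  finally have "(1 - psi (s * x)) * (\<Sum>t\<in>UNIV. psi (t * x)) = 0" by (simp add: algebra_simps)
  thus ?thesis using s False by simp
qed simp

section \<open>Irreducible polynomials, Artin-Schreier fibres and character sums\<close>

definition irred_dvd :: "nat \<Rightarrow> 'p::prime_card mod_ring poly set" where
  "irred_dvd n = {P. irreducible P \<and> monic P \<and> degree P dvd n}"

lemma finite_irred_dvd: "n > 0 \<Longrightarrow> finite (irred_dvd n)"
proof (rule finite_subset)
  assume "n > 0"
  thus "irred_dvd n \<subseteq> polys_below (Suc n)"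
    by (auto simp: irred_dvd_def polys_below_iff dest: dvd_imp_le)
qed (rule card_polys_below)

definition root_fibre :: "'p::prime_card mod_ring poly \<Rightarrow> 'p mod_ring alg_closure set" where
  "root_fibre P = {z. poly_ac P (frob 1 z - z) = 0}"

lemma card_root_fibre:
  fixes P :: "'p::prime_card mod_ring poly"
  assumes "irreducible P" "monic P"
  shows "card (root_fibre P) = CARD('p) * degree P"
proof -
  have P0: "P \<noteq> 0" using assms by auto
  have fin: "finite {x. poly_ac P x = 0}" using P0 by (intro poly_roots_finite) auto
  have finf: "finite {z :: 'p mod_ring alg_closure. frob 1 z - z = x}" for x
    using card_frob_diff_fibre[of x] prime_card_gt_1[where ?'p = 'p] by (intro card_ge_0_finite) simp
  have "root_fibre P = (\<Union>x\<in>{x. poly_ac P x = 0}. {z. frob 1 z - z = x})"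
    by (auto simp: root_fibre_def)
  also have "card \<dots> = (\<Sum>x\<in>{x. poly_ac P x = 0}. card {z. frob 1 z - z = x})"
    by (rule card_UN_disjoint) (use fin finf in auto)
  also have "\<dots> = CARD('p) * degree P"
    using card_roots_irreducible[OF assms] card_frob_diff_fibre[where ?'p = 'p] by simp
  finally show ?thesis .
qed

lemma frob_diff_telescope: "(\<Sum>i<n. frob i (frob 1 z - z)) = frob n z - z"
  by (induction n) (simp_all add: frob.hom_minus frob_frob)

text \<open>The Frobenius sum of z^p - z telescopes to \<open>frob n z - z\<close>; it is also the
  trace of a root of \<open>P\<close>. So \<open>z\<close> lies in the field with p^n elements
  exactly when this trace vanishes.\<close>

lemma root_fibre_frob_fixed_iff:
  fixes P :: "'p::prime_card mod_ring poly"
  assumes "P \<in> irred_dvd n" "z \<in> root_fibre P"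
  shows "frob n z = z \<longleftrightarrow> of_nat (n div degree P) * monic_trace P = 0"
proof -
  have P: "irreducible P" "monic P" "poly_ac P (frob 1 z - z) = 0"
    and n: "n = degree P * (n div degree P)"
    using assms by (auto simp: irred_dvd_def root_fibre_def)
  have "frob n z - z = - to_ac (of_nat (n div degree P) * monic_trace P)"
    using frob_trace[OF P, of "n div degree P"] n frob_diff_telescope[of z n] by simp
  hence "frob n z - z = 0 \<longleftrightarrow> of_nat (n div degree P) * monic_trace P = 0"
    by (metis add.inverse_neutral neg_equal_iff_equal to_ac_0 to_ac_eq_iff)
  thus ?thesis by simp
qed

text \<open>Take the norm factor by factor. Only z^p - z has to lie in the field with p^n elements;
  \<open>z\<close> itself may lie outside.\<close>

lemma qchar_ext_root_fibre:
  fixes P :: "'p::prime_card mod_ring poly"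
  assumes "odd CARD('p)" "P \<in> irred_dvd n" "z \<in> root_fibre P"
  shows "qchar_ext n (poly_ac (artin_schreier_prod R) z) = qchar (\<Prod>a\<in>R. poly P a) ^ (n div degree P)"
proof -
  define k where "k = n div degree P"
  have P: "irreducible P" "monic P" "poly_ac P (frob 1 z - z) = 0"
    and n: "n = degree P * k"
    using assms by (auto simp: irred_dvd_def root_fibre_def k_def)
  have "(\<Prod>i<n. frob i (\<Prod>a\<in>R. to_ac a - (frob 1 z - z))) = (\<Prod>a\<in>R. \<Prod>i<n. frob i (to_ac a - (frob 1 z - z)))"
    unfolding frob.hom_prod by (rule prod.swap)
  also have "\<dots> = to_ac ((\<Prod>a\<in>R. poly P a) ^ k)"
    unfolding n frob_norm[OF P] by (simp add: prod_power_distrib to_ac_prod)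
  finally have "(\<Prod>i<n. frob i (poly_ac (artin_schreier_prod R) z)) = to_ac ((\<Prod>a\<in>R. poly P a) ^ k)"
    unfolding poly_ac_artin_schreier_prod .
  from qchar_ext_norm[OF assms(1) this] show ?thesis
    by (simp only: qchar_power[OF assms(1)] k_def)
qed

text \<open>Made to be completely multiplicative on monic polynomials and to equal, at x - b, the
  term of the Weil sum belonging to b.\<close>

definition lfun_char :: "'p::prime_card mod_ring set \<Rightarrow> 'p mod_ring \<Rightarrow> 'p mod_ring poly \<Rightarrow> complex" where
  "lfun_char R t F = of_real (qchar (\<Prod>a\<in>R. poly F a)) * psi (t * monic_trace F)"

text \<open>The n-th coefficient of T L'(T)/L(T) read off the Euler product: the character sum over
  the field with p^n elements, grouped by Frobenius orbits.\<close>

definition lfun_power_sum :: "'p::prime_card mod_ring set \<Rightarrow> 'p mod_ring \<Rightarrow> nat \<Rightarrow> complex" where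
  "lfun_power_sum R t n = (\<Sum>P\<in>irred_dvd n. of_nat (degree P) * lfun_char R t P ^ (n div degree P))"

text \<open>Orthogonality in \<open>t\<close> keeps the \<open>P\<close> of vanishing trace, each
  with weight p * degree P. This is the size of \<open>root_fibre P\<close>, and precisely these
  fibres lie in the field with p^n elements, so the sum regroups into one over that field.\<close>

lemma sum_lfun_power_sum:
  fixes R :: "'p::prime_card mod_ring set"
  assumes "odd CARD('p)" "n > 0"
  shows "(\<Sum>t\<in>UNIV. lfun_power_sum R t n) =
    of_real (\<Sum>z | frob n z = z. qchar_ext n (poly_ac (artin_schreier_prod R) z))"
proof -
  define k where "k = (\<lambda>P :: 'p mod_ring poly. n div degree P)"
  define ch where "ch = (\<lambda>P :: 'p mod_ring poly. qchar (\<Prod>a\<in>R. poly P a))"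
  define tr0 where "tr0 = (\<lambda>P :: 'p mod_ring poly. of_nat (k P) * monic_trace P = 0)"
  let ?Z = "{z :: 'p mod_ring alg_closure. frob n z = z}"
  let ?\<sigma> = "\<lambda>z. qchar_ext n (poly_ac (artin_schreier_prod R) z)"
  have finZ: "finite ?Z" using card_frob_fixed[OF assms(2), where ?'p = 'p] by (intro card_ge_0_finite) simp
  have "(\<Sum>t\<in>UNIV. lfun_power_sum R t n) = (\<Sum>P\<in>irred_dvd n. \<Sum>t\<in>UNIV. of_nat (degree P) * lfun_char R t P ^ k P)"
    unfolding lfun_power_sum_def k_def by (rule sum.swap)
  also have "\<dots> = (\<Sum>P\<in>irred_dvd n. of_real (if tr0 P then real (CARD('p) * degree P) * ch P ^ k P else 0))"
  proof (rule sum.cong[OF refl])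
    fix P :: "'p mod_ring poly"
    have "lfun_char R t P ^ k P = of_real (ch P ^ k P) * psi (t * (of_nat (k P) * monic_trace P))" for t
      by (simp add: lfun_char_def ch_def power_mult_distrib psi_power mult_ac)
    hence "(\<Sum>t\<in>UNIV. of_nat (degree P) * lfun_char R t P ^ k P) =
      of_nat (degree P) * (of_real (ch P ^ k P) * (\<Sum>t\<in>UNIV. psi (t * (of_nat (k P) * monic_trace P))))"
      by (simp add: sum_distrib_left)
    thus "(\<Sum>t\<in>UNIV. of_nat (degree P) * lfun_char R t P ^ k P) =
      of_real (if tr0 P then real (CARD('p) * degree P) * ch P ^ k P else 0)"
      unfolding sum_psi tr0_def by simp
  qed
  also have "\<dots> = of_real (\<Sum>P\<in>irred_dvd n. if tr0 P then real (CARD('p) * degree P) * ch P ^ k P else 0)"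
    by simp
  also have "(\<Sum>P\<in>irred_dvd n. if tr0 P then real (CARD('p) * degree P) * ch P ^ k P else 0)
      = (\<Sum>P\<in>irred_dvd n. \<Sum>z\<in>root_fibre P \<inter> ?Z. ?\<sigma> z)"
  proof (rule sum.cong[OF refl])
    fix P :: "'p mod_ring poly" assume P: "P \<in> irred_dvd n"
    have "root_fibre P \<inter> ?Z = (if tr0 P then root_fibre P else {})"
      using root_fibre_frob_fixed_iff[OF P] unfolding tr0_def k_def by auto
    moreover have "(\<Sum>z\<in>root_fibre P. ?\<sigma> z) = (\<Sum>z\<in>root_fibre P. ch P ^ k P)"
      by (rule sum.cong[OF refl]) (simp add: qchar_ext_root_fibre[OF assms(1) P] ch_def k_def)
    moreover have "card (root_fibre P) = CARD('p) * degree P"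
      using P by (intro card_root_fibre) (auto simp: irred_dvd_def)
    ultimately show "(if tr0 P then real (CARD('p) * degree P) * ch P ^ k P else 0) = (\<Sum>z\<in>root_fibre P \<inter> ?Z. ?\<sigma> z)"
      by simp
  qed
  also have "\<dots> = (\<Sum>z\<in>(\<Union>P\<in>irred_dvd n. root_fibre P \<inter> ?Z). ?\<sigma> z)"
  proof (rule sum.UNION_disjoint[symmetric])
    show "finite (irred_dvd n :: 'p mod_ring poly set)" by (rule finite_irred_dvd[OF assms(2)])
    show "\<forall>P\<in>irred_dvd n. finite (root_fibre P \<inter> ?Z)" using finZ by auto
    show "\<forall>P\<in>irred_dvd n. \<forall>Q\<in>irred_dvd n. P \<noteq> Q \<longrightarrow> (root_fibre P \<inter> ?Z) \<inter> (root_fibre Q \<inter> ?Z) = {}"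
      using irreducible_common_root unfolding irred_dvd_def root_fibre_def by blast
  qed
  also have "(\<Union>P\<in>irred_dvd n. root_fibre P \<inter> ?Z) = ?Z"
  proof (intro equalityI subsetI)
    fix z assume z: "z \<in> ?Z"
    define x where "x = frob 1 z - z"
    obtain P where P: "irreducible P" "monic P" "poly_ac P x = 0"
      using ex_irreducible_monic_root by blast
    have "frob n (frob 1 z) = frob 1 (frob n z)" by (simp only: frob_frob add.commute)
    hence "frob n x = x" using z unfolding x_def frob.hom_minus by (simp only: mem_Collect_eq)
    hence "degree P dvd n"
      using irreducible_monic_eq_conj_poly(2)[OF P] frob_fixed_iff_period_dvd[of n x] by simp
    thus "z \<in> (\<Union>P\<in>irred_dvd n. root_fibre P \<inter> ?Z)"
      using P z by (auto simp: irred_dvd_def root_fibre_def x_def)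
  qed auto
  finally show ?thesis .
qed

section \<open>The L-function\<close>

lemma lfun_char_mult:
  fixes F G :: "'p::prime_card mod_ring poly"
  assumes "odd CARD('p)" "monic F" "monic G"
  shows "lfun_char R t (F * G) = lfun_char R t F * lfun_char R t G"
  unfolding lfun_char_def monic_trace_mult[OF assms(2,3)] poly_mult prod.distrib qchar_mult[OF assms(1)]
  by (simp add: distrib_left psi_add)

lemma lfun_char_1 [simp]: "lfun_char R t 1 = 1"
  by (simp add: lfun_char_def monic_trace_def)

lemma lfun_char_power:
  fixes F :: "'p::prime_card mod_ring poly"
  assumes "odd CARD('p)" "monic F"
  shows "lfun_char R t (F ^ k) = lfun_char R t F ^ k"
  using assms by (induction k) (simp_all add: lfun_char_mult monic_power)

definition monics :: "nat \<Rightarrow> 'a::comm_ring_1 poly set" where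
  "monics n = {F. monic F \<and> degree F = n}"

lemma monics_0: "monics 0 = {1 :: 'a::comm_ring_1 poly}"
proof (intro equalityI subsetI)
  fix F :: "'a poly" assume "F \<in> monics 0"
  hence "monic F" "degree F = 0" by (auto simp: monics_def)
  thus "F \<in> {1}" by (metis degree_eq_zeroE lead_coeff_pCons(2) one_pCons singletonI)
qed (auto simp: monics_def)

lemma finite_monics: "finite (monics n :: 'a::{finite,comm_ring_1} poly set)"
proof (rule finite_subset)
  show "monics n \<subseteq> (polys_below (Suc n) :: 'a poly set)" by (auto simp: monics_def polys_below_iff)
qed (rule card_polys_below)

lemma monics_iff_coeff: "F \<in> monics n \<longleftrightarrow> poly.coeff F n = 1 \<and> (\<forall>i>n. poly.coeff F i = 0)"
  for F :: "'a::comm_ring_1 poly"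
proof
  assume r: "poly.coeff F n = 1 \<and> (\<forall>i>n. poly.coeff F i = 0)"
  have "degree F \<le> n" using r by (intro degree_le) auto
  moreover have "n \<le> degree F" using r by (intro le_degree) auto
  ultimately show "F \<in> monics n" using r by (auto simp: monics_def)
qed (auto simp: monics_def coeff_eq_0)

lemma monics_add_below:
  fixes F H :: "'a::comm_ring_1 poly"
  assumes "F \<in> monics n" "H \<in> polys_below n"
  shows "F + H \<in> monics n"
  using assms by (auto simp: monics_iff_coeff polys_below_def)

lemma sum_monics_shift:
  fixes H :: "'a::{finite,comm_ring_1} poly"
  assumes "H \<in> polys_below n"
  shows "(\<Sum>F\<in>monics n. f F) = (\<Sum>F\<in>monics n. f (F + H))"
proof (rule sum.reindex_bij_witness[of _ "\<lambda>F. F + H" "\<lambda>F. F + (- H)"])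
  have H': "- H \<in> polys_below n" using assms by (simp add: polys_below_def)
  show "F + H \<in> monics n" if "F \<in> monics n" for F by (rule monics_add_below[OF that assms])
  show "F + (- H) \<in> monics n" if "F \<in> monics n" for F by (rule monics_add_below[OF that H'])
qed simp_all

text \<open>The coefficient of T^n in the L-function, as a Dirichlet series over monic
  polynomials.\<close>

definition lfun_coeff :: "'p::prime_card mod_ring set \<Rightarrow> 'p mod_ring \<Rightarrow> nat \<Rightarrow> complex" where
  "lfun_coeff R t n = (\<Sum>F\<in>monics n. lfun_char R t F)"

lemma lfun_coeff_0: "lfun_coeff R t 0 = 1"
  by (simp add: lfun_coeff_def monics_0)

text \<open>Otherwise all p - 1 nonzero elements would be roots of x^((p-1)/2) - 1.\<close>

lemma qchar_nonresidue:
  assumes "odd CARD('p::prime_card)"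
  shows "\<exists>x :: 'p mod_ring. qchar x = -1"
proof (rule ccontr)
  assume no: "\<not> (\<exists>x :: 'p mod_ring. qchar x = -1)"
  define h where "h = (CARD('p) - 1) div 2"
  have h: "CARD('p) = 2 * h + 1" using assms unfolding h_def by presburger
  have h0: "h > 0" using h prime_card_gt_1[where ?'p = 'p] by simp
  let ?f = "monom 1 h - 1 :: 'p mod_ring poly"
  have c: "poly.coeff ?f h = 1" using h0 by simp
  have f0: "?f \<noteq> 0"
  proof
    assume "?f = 0"
    hence "poly.coeff ?f h = 0" by simp
    thus False using c by simp
  qed
  have sub: "UNIV - {0} \<subseteq> {x. poly ?f x = 0}"
  proof
    fix x :: "'p mod_ring" assume "x \<in> UNIV - {0}"
    hence "x ^ h = 1" using no qchar_cases[OF assms, of x] unfolding h_def by blast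
    thus "x \<in> {x. poly ?f x = 0}" by (simp add: Polynomial.poly_monom)
  qed
  have "card (UNIV - {0 :: 'p mod_ring}) \<le> card {x. poly ?f x = 0}"
    by (rule card_mono[OF poly_roots_finite[OF f0] sub])
  also have "\<dots> \<le> degree ?f" by (rule card_poly_roots_bound[OF f0])
  also have "\<dots> \<le> h" by (rule degree_diff_le) (simp_all add: degree_monom_le)
  finally show False using h h0 by (simp add: card_Diff_singleton)
qed

lemma sum_qchar_affine:
  fixes b c :: "'p::prime_card mod_ring"
  assumes "odd CARD('p)" "c \<noteq> 0"
  shows "(\<Sum>s\<in>UNIV. qchar (b + s * c)) = 0"
proof -
  obtain y :: "'p mod_ring" where y: "qchar y = -1" using qchar_nonresidue[OF assms(1)] by blast
  have y0: "y \<noteq> 0" using y assms(1) by auto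
  have "(\<Sum>s::'p mod_ring\<in>UNIV. qchar s) = (\<Sum>s\<in>UNIV. qchar (y * s))"
    by (rule sum.reindex_bij_witness[of _ "\<lambda>s. y * s" "\<lambda>s. s / y"]) (use y0 in auto)
  also have "\<dots> = - (\<Sum>s::'p mod_ring\<in>UNIV. qchar s)"
    by (simp add: qchar_mult[OF assms(1)] y sum_negf)
  finally have "(\<Sum>s\<in>UNIV. qchar (s :: 'p mod_ring)) = 0" by simp
  moreover have "(\<Sum>s\<in>UNIV. qchar (b + s * c)) = (\<Sum>s::'p mod_ring\<in>UNIV. qchar s)"
    by (rule sum.reindex_bij_witness[of _ "\<lambda>s. (s - b) / c" "\<lambda>s. b + s * c"]) (use assms in auto)
  ultimately show ?thesis by simp
qed

lemma monic_linear_prod: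
  fixes R :: "'a::idom set"
  shows "monic (\<Prod>a\<in>R. [:- a, 1:])" "finite R \<Longrightarrow> degree (\<Prod>a\<in>R. [:- a, 1:]) = card R"
proof -
  show "monic (\<Prod>a\<in>R. [:- a, 1:])" unfolding lead_coeff_prod by simp
  show "degree (\<Prod>a\<in>R. [:- a, 1:]) = card R" if "finite R"
    using that by (subst degree_prod_sum_eq) auto
qed

text \<open>Shifting \<open>F\<close> by a multiple of a polynomial vanishing on \<open>R\<close> (on all but one point of \<open>R\<close> when
  \<open>t = 0\<close>) changes only the additive character (only one factor of the argument of \<open>qchar\<close>).\<close>

lemma lfun_coeff_eq_0:
  fixes R :: "'p::prime_card mod_ring set"
  assumes odd: "odd CARD('p)" and R: "R \<noteq> {}" and n: "n > card R"
  shows "lfun_coeff R t n = 0"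
proof (cases "t = 0")
  case False
  then obtain s' where s': "psi (s' * t) \<noteq> 1" using psi_nontrivial by blast
  define d where "d = card R"
  define Z where "Z = (\<Prod>a\<in>R. [:- a, 1:])"
  \<comment> \<open>The power of x raises the degree to exactly n - 1, so adding \<open>H\<close>
    moves \<open>monic_trace\<close> by \<open>s'\<close> while the values on \<open>R\<close> stay
    the same; this needs n > card R.\<close>
  define H where "H = Polynomial.smult s' (Z * monom 1 (n - 1 - d))"
  have Z: "monic Z" "degree Z = d"
    unfolding Z_def d_def by (rule monic_linear_prod, rule monic_linear_prod) simp
  have "degree (Z * monom 1 (n - 1 - d)) = n - 1"
    using n Z by (subst degree_mult_eq) (auto simp: Polynomial.degree_monom_eq d_def)
  hence Hn: "H \<in> polys_below n" unfolding polys_below_iff H_def using n by (auto simp: degree_smult_eq)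
  have cH: "poly.coeff H (n - 1) = s'"
  proof -
    have "poly.coeff (monom 1 (n - 1 - d) * Z) ((n - 1 - d) + d) = 1"
      using Z by (simp only: coeff_monom_mult) simp
    moreover have "(n - 1 - d) + d = n - 1" using n by (simp add: d_def)
    ultimately show ?thesis by (simp add: H_def mult.commute)
  qed
  have ev: "poly H a = 0" if "a \<in> R" for a
  proof -
    have "poly Z a = 0" unfolding Z_def poly_prod using that by (subst prod_zero_iff) auto
    thus ?thesis by (simp add: H_def)
  qed
  have "lfun_char R t (F + H) = psi (s' * t) * lfun_char R t F" if F: "F \<in> monics n" for F
  proof -
    have "F + H \<in> monics n" by (rule monics_add_below[OF F Hn])
    hence "monic_trace (F + H) = monic_trace F + s'" using F n cH by (auto simp: monics_def monic_trace_def)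
    moreover have "(\<Prod>a\<in>R. poly (F + H) a) = (\<Prod>a\<in>R. poly F a)" by (rule prod.cong) (use ev in auto)
    ultimately show ?thesis unfolding lfun_char_def by (simp add: distrib_left psi_add mult.commute)
  qed
  hence "lfun_coeff R t n = psi (s' * t) * lfun_coeff R t n"
    unfolding lfun_coeff_def sum_distrib_left
    by (subst sum_monics_shift[OF Hn]) (rule sum.cong, auto)
  hence "(1 - psi (s' * t)) * lfun_coeff R t n = 0" by (simp add: algebra_simps)
  thus ?thesis using s' by simp
next
  case True
  obtain a0 where a0: "a0 \<in> R" using R by blast
  define Z where "Z = (\<Prod>a\<in>R - {a0}. [:- a, 1:])"
  define c where "c = poly Z a0"
  have c0: "c \<noteq> 0" unfolding c_def Z_def poly_prod by (subst prod_zero_iff) auto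
  have "degree Z = card (R - {a0})" unfolding Z_def by (rule monic_linear_prod) simp
  also have "\<dots> < n" using n a0 by (simp add: card_Diff_singleton)
  finally have Zn: "Polynomial.smult s Z \<in> polys_below n" for s
    unfolding polys_below_iff by (auto intro: le_less_trans[OF degree_smult_le])
  define W where "W = (\<lambda>F. \<Prod>a\<in>R - {a0}. poly F a)"
  have "lfun_char R t (F + Polynomial.smult s Z) = of_real (qchar (W F) * qchar (poly F a0 + s * c))" for F s
  proof -
    have "(\<Prod>a\<in>R. poly (F + Polynomial.smult s Z) a) = poly (F + Polynomial.smult s Z) a0 * W (F + Polynomial.smult s Z)"
      unfolding W_def by (rule prod.remove) (use a0 in auto)
    also have "W (F + Polynomial.smult s Z) = W F"
      unfolding W_def
    proof (rule prod.cong[OF refl])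
      fix a assume "a \<in> R - {a0}"
      hence "poly Z a = 0" unfolding Z_def poly_prod by (subst prod_zero_iff) auto
      thus "poly (F + Polynomial.smult s Z) a = poly F a" by simp
    qed
    finally show ?thesis unfolding lfun_char_def True by (simp add: qchar_mult[OF odd] c_def)
  qed
  hence "lfun_coeff R t n = (\<Sum>F\<in>monics n. of_real (qchar (W F) * qchar (poly F a0 + s * c)))" for s
    unfolding lfun_coeff_def by (subst sum_monics_shift[OF Zn[of s]]) simp
  \<comment> \<open>The left summand does not depend on \<open>s\<close>; averaging over
    \<open>s\<close> leaves a complete sum of \<open>qchar\<close> along a nonconstant affine map,
    which is zero.\<close>
  hence "(\<Sum>s::'p mod_ring\<in>UNIV. lfun_coeff R t n) = (\<Sum>s\<in>UNIV. \<Sum>F\<in>monics n. of_real (qchar (W F) * qchar (poly F a0 + s * c)))"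
    by (rule sum.cong[OF refl])
  also have "\<dots> = of_real (\<Sum>F\<in>monics n. qchar (W F) * (\<Sum>s\<in>UNIV. qchar (poly F a0 + s * c)))"
    by (subst sum.swap) (simp add: sum_distrib_left)
  also have "\<dots> = 0" by (simp add: sum_qchar_affine[OF odd c0])
  finally show ?thesis by simp
qed

section \<open>Prime powers dividing a polynomial and the Newton recursion\<close>

lemma prime_poly_iff:
  fixes P :: "'p::prime_card mod_ring poly"
  shows "prime P \<longleftrightarrow> irreducible P \<and> monic P"
proof -
  have "normalize P = P \<longleftrightarrow> monic P" if "P \<noteq> 0"
  proof -
    have "poly.coeff (normalize P) (degree P) = 1"
      using that by (simp add: unit_factor_mod_ring_def)
    thus ?thesis using normalize_monic[of P] by metis
  qed
  thus ?thesis unfolding Factorial_Ring.prime_def using irreducible_imp_prime_elem prime_elem_imp_irreducible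
    by (metis not_irreducible_zero prime_elem_not_zeroI)
qed

text \<open>The analogue of summing the von Mangoldt function over divisors: (m, P) stands for the
  power of \<open>P\<close> of degree \<open>m\<close>, and each prime factor counts its degree once
  per power dividing \<open>F\<close>.\<close>

lemma degree_eq_sum_prime_powers:
  fixes F :: "'p::prime_card mod_ring poly"
  assumes F: "F \<in> monics n"
  shows "(\<Sum>m\<in>{1..n}. \<Sum>P\<in>irred_dvd m. if P ^ (m div degree P) dvd F then degree P else 0) = n"
proof -
  have mF: "monic F" and dF: "degree F = n" using F by (auto simp: monics_def)
  have F0: "F \<noteq> 0" using mF by auto
  have pf: "irreducible P" "monic P" "P dvd F" "degree P > 0" if "P \<in> prime_factors F" for P
  proof -
    have "prime P" "P dvd F" using that by (auto simp: in_prime_factors_iff)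
    thus "irreducible P" "monic P" "P dvd F" by (simp_all add: prime_poly_iff)
    thus "degree P > 0"
      by (metis bot_nat_0.not_eq_extremum irreducible_not_unit is_unit_iff_degree not_irreducible_zero)
  qed
  have fin: "finite (irred_dvd m :: 'p mod_ring poly set)" if "m \<in> {1..n}" for m using that by (intro finite_irred_dvd) auto
  have "n = degree (normalize F)" using mF dF by (simp add: normalize_monic)
  also have "normalize F = (\<Prod>P\<in>prime_factors F. P ^ multiplicity P F)"
    using prod_prime_factors[OF F0] by simp
  also have "degree \<dots> = (\<Sum>P\<in>prime_factors F. multiplicity P F * degree P)"
  proof (subst degree_prod_sum_eq)
    show "P ^ multiplicity P F \<noteq> 0" if "P \<in> prime_factors F" for P using pf(2)[OF that] by auto
    show "(\<Sum>P\<in>prime_factors F. degree (P ^ multiplicity P F)) = (\<Sum>P\<in>prime_factors F. multiplicity P F * degree P)"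
      by (rule sum.cong[OF refl]) (use pf(2) in \<open>auto intro!: Polynomial.degree_power_eq\<close>)
  qed
  also have "\<dots> = (\<Sum>P\<in>prime_factors F. \<Sum>k\<in>{1..multiplicity P F}. degree P)" by simp
  also have "\<dots> = (\<Sum>(P, k)\<in>(SIGMA P:prime_factors F. {1..multiplicity P F}). degree P)"
    by (rule sum.Sigma) auto
  also have "\<dots> = (\<Sum>(m, P)\<in>(SIGMA m:{1..n}. {P \<in> irred_dvd m. P ^ (m div degree P) dvd F}). degree P)"
  \<comment> \<open>A prime power is labelled on one side by its exponent k, on the other by its
    total degree m = k * degree P.\<close>
  proof (rule sum.reindex_bij_witness[of _ "\<lambda>(m, P). (P, m div degree P)" "\<lambda>(P, k). (k * degree P, P)"], goal_cases)
    case (1 x)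
    obtain P k where x: "x = (P, k)" by fastforce
    from 1 have "degree P > 0" using pf(4) by (auto simp: x)
    thus ?case by (simp add: x)
  next
    case (2 x)
    obtain P k where x: "x = (P, k)" by fastforce
    have P: "P \<in> prime_factors F" and k: "1 \<le> k" "k \<le> multiplicity P F" using 2 by (auto simp: x)
    have dvd: "P ^ k dvd F" using k by (metis multiplicity_dvd')
    have "degree (P ^ k) = k * degree P" using pf(2)[OF P] by (intro Polynomial.degree_power_eq) auto
    hence "k * degree P \<le> n" using dvd_imp_degree_le[OF dvd F0] dF by simp
    moreover have "k * degree P \<ge> 1" using k pf(4)[OF P] by (simp add: Suc_le_eq)
    ultimately show ?case using dvd pf[OF P] by (auto simp: x irred_dvd_def)
  next
    case (3 x)
    obtain m P where x: "x = (m, P)" by fastforce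
    thus ?case using 3 by (auto simp: irred_dvd_def)
  next
    case (4 x)
    obtain m P where x: "x = (m, P)" by fastforce
    have P: "irreducible P" "monic P" "degree P dvd m" "P ^ (m div degree P) dvd F"
      and m: "m \<in> {1..n}" using 4 by (auto simp: x irred_dvd_def)
    have d0: "degree P > 0"
      using P(1) by (metis bot_nat_0.not_eq_extremum irreducible_not_unit is_unit_iff_degree not_irreducible_zero)
    have k1: "m div degree P \<ge> 1" using m P(3) d0 by (auto simp: Suc_le_eq div_greater_zero_iff dest: dvd_imp_le)
    hence "P dvd F" using P(4) by (metis dvd_power dvd_trans less_le_trans zero_less_one)
    hence "P \<in> prime_factors F" using P F0 by (simp add: in_prime_factors_iff prime_poly_iff)
    moreover have "m div degree P \<le> multiplicity P F"
      using P(4) F0 irreducible_not_unit[OF P(1)] by (intro multiplicity_geI) auto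
    ultimately show ?case using k1 by (auto simp: x)
  qed auto
  also have "\<dots> = (\<Sum>m\<in>{1..n}. \<Sum>P\<in>{P \<in> irred_dvd m. P ^ (m div degree P) dvd F}. degree P)"
    by (rule sum.Sigma[symmetric]) (use fin in auto)
  also have "\<dots> = (\<Sum>m\<in>{1..n}. \<Sum>P\<in>irred_dvd m. if P ^ (m div degree P) dvd F then degree P else 0)"
    by (rule sum.cong[OF refl], rule sum.inter_filter) (use fin in auto)
  finally show ?thesis by simp
qed

lemma sum_monics_multiples:
  fixes G :: "'p::prime_card mod_ring poly"
  assumes "odd CARD('p)" "G \<in> monics m" "m \<le> n"
  shows "(\<Sum>F\<in>{F \<in> monics n. G dvd F}. lfun_char R t F) = lfun_char R t G * lfun_coeff R t (n - m)"
proof -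
  have mG: "monic G" and dG: "degree G = m" using assms by (auto simp: monics_def)
  have G0: "G \<noteq> 0" using mG by auto
  have "(\<Sum>F\<in>{F \<in> monics n. G dvd F}. lfun_char R t F) = (\<Sum>H\<in>monics (n - m). lfun_char R t (G * H))"
  proof (rule sum.reindex_bij_witness[of _ "\<lambda>H. G * H" "\<lambda>F. F div G"], goal_cases)
    case (1 F) thus ?case by auto
  next
    case (2 F)
    hence "G dvd F" by simp
    then obtain H where H: "F = G * H" by (rule dvdE)
    have F: "monic F" "degree F = n" using 2 by (auto simp: monics_def)
    have "monic H" using F(1) mG by (simp add: H lead_coeff_mult)
    moreover have "H \<noteq> 0" using F(1) H by auto
    hence "degree F = m + degree H" unfolding H using G0 dG by (simp add: degree_mult_eq)
    ultimately show ?case using F H G0 by (simp add: monics_def)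
  next
    case (3 H) thus ?case using G0 by simp
  next
    case (4 H)
    hence H: "monic H" "degree H = n - m" by (auto simp: monics_def)
    hence "H \<noteq> 0" by auto
    hence "degree (G * H) = n" using G0 dG H assms(3) by (simp add: degree_mult_eq)
    thus ?case using H mG by (simp add: monics_def lead_coeff_mult[symmetric] del: lead_coeff_mult) (metis lead_coeff_mult mult_1)
  next
    case (5 F) thus ?case by auto
  qed
  also have "\<dots> = (\<Sum>H\<in>monics (n - m). lfun_char R t G * lfun_char R t H)"
    by (rule sum.cong[OF refl]) (use assms(1) mG in \<open>auto simp: monics_def lfun_char_mult\<close>)
  finally show ?thesis by (simp add: lfun_coeff_def sum_distrib_left)
qed

text \<open>The identity T L' = (T L'/L) L, coefficient by coefficient. Write n as the sum over
  prime powers dividing \<open>F\<close> and interchange: the monic multiples of a prime power of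
  degree m contribute its character value times \<open>lfun_coeff R t (n - m)\<close>.\<close>

lemma lfun_newton:
  fixes R :: "'p::prime_card mod_ring set"
  assumes odd: "odd CARD('p)"
  shows "of_nat n * lfun_coeff R t n = (\<Sum>m\<in>{1..n}. lfun_power_sum R t m * lfun_coeff R t (n - m))"
proof -
  let ?k = "\<lambda>m P :: 'p mod_ring poly. m div degree P"
  have "of_nat n * lfun_coeff R t n = (\<Sum>F\<in>monics n. of_nat n * lfun_char R t F)"
    by (simp add: lfun_coeff_def sum_distrib_left)
  also have "\<dots> = (\<Sum>F\<in>monics n. \<Sum>m\<in>{1..n}. \<Sum>P\<in>irred_dvd m.
      if P ^ ?k m P dvd F then of_nat (degree P) * lfun_char R t F else 0)"
  proof (rule sum.cong[OF refl])
    fix F :: "'p mod_ring poly" assume F: "F \<in> monics n"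
    have "of_nat n * lfun_char R t F = of_nat (\<Sum>m\<in>{1..n}. \<Sum>P\<in>irred_dvd m. if P ^ ?k m P dvd F then degree P else 0) * lfun_char R t F"
      unfolding degree_eq_sum_prime_powers[OF F] ..
    also have "\<dots> = (\<Sum>m\<in>{1..n}. \<Sum>P\<in>irred_dvd m. of_nat (if P ^ ?k m P dvd F then degree P else 0) * lfun_char R t F)"
      by (simp add: sum_distrib_right)
    also have "\<dots> = (\<Sum>m\<in>{1..n}. \<Sum>P\<in>irred_dvd m. if P ^ ?k m P dvd F then of_nat (degree P) * lfun_char R t F else 0)"
      by (intro sum.cong refl) simp
    finally show "of_nat n * lfun_char R t F = (\<Sum>m\<in>{1..n}. \<Sum>P\<in>irred_dvd m. if P ^ ?k m P dvd F then of_nat (degree P) * lfun_char R t F else 0)" .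
  qed
  also have "\<dots> = (\<Sum>m\<in>{1..n}. \<Sum>P\<in>irred_dvd m. \<Sum>F\<in>monics n. if P ^ ?k m P dvd F then of_nat (degree P) * lfun_char R t F else 0)"
    by (subst sum.swap) (intro sum.cong refl sum.swap)
  also have "\<dots> = (\<Sum>m\<in>{1..n}. lfun_power_sum R t m * lfun_coeff R t (n - m))"
    unfolding lfun_power_sum_def sum_distrib_right
  proof (intro sum.cong refl)
    fix m and P :: "'p mod_ring poly" assume m: "m \<in> {1..n}" and P: "P \<in> irred_dvd m"
    have mP: "monic P" and dP: "degree P dvd m" using P by (auto simp: irred_dvd_def)
    have "degree (P ^ ?k m P) = ?k m P * degree P" using mP by (intro Polynomial.degree_power_eq) auto
    hence G: "P ^ ?k m P \<in> monics m" using dP mP by (simp add: monics_def) (metis lead_coeff_power power_one)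
    have "(\<Sum>F\<in>monics n. if P ^ ?k m P dvd F then of_nat (degree P) * lfun_char R t F else 0)
       = of_nat (degree P) * (\<Sum>F\<in>{F \<in> monics n. P ^ ?k m P dvd F}. lfun_char R t F)"
      by (simp add: sum.inter_filter[OF finite_monics, symmetric] sum_distrib_left)
    also have "\<dots> = of_nat (degree P) * (lfun_char R t P ^ ?k m P * lfun_coeff R t (n - m))"
      using sum_monics_multiples[OF odd G, of n R t] m by (simp add: lfun_char_power[OF odd mP])
    finally show "(\<Sum>F\<in>monics n. if P ^ ?k m P dvd F then of_nat (degree P) * lfun_char R t F else 0)
       = of_nat (degree P) * lfun_char R t P ^ ?k m P * lfun_coeff R t (n - m)" by (simp only: mult.assoc)
  qed
  finally show ?thesis .
qed

section \<open>The Weil bound\<close>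

definition linear_prod :: "complex multiset \<Rightarrow> complex poly" where
  "linear_prod M = (\<Prod>\<omega>\<in>#M. [:1, - \<omega>:])"

text \<open>The reversed polynomial is monic; its roots are the inverse roots sought, and reversing
  each linear factor gives the product.\<close>

lemma poly_splits_at_0:
  fixes f :: "complex poly"
  assumes "poly.coeff f 0 = 1"
  obtains M where "size M \<le> degree f" "f = linear_prod M"
proof -
  have f0: "f \<noteq> 0" using assms by auto
  have r0: "reflect_poly f \<noteq> 0" using f0 by simp
  obtain M where M: "size M = degree (reflect_poly f)"
     "reflect_poly f = Polynomial.smult (lead_coeff (reflect_poly f)) (\<Prod>x\<in>#M. [:- x, 1:])"
    using alg_closed_imp_factorization[OF r0] by blast
  have dr: "degree (reflect_poly f) = degree f"
    using assms by (intro degree_reflect_poly_eq) simp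
  have "lead_coeff (reflect_poly f) = 1" using assms dr by (simp add: coeff_reflect_poly)
  hence rf: "reflect_poly f = (\<Prod>x\<in>#M. [:- x, 1:])" using M(2) by simp
  have "reflect_poly (\<Prod>x\<in>#M. [:- x, 1:]) = linear_prod M"
  proof (induction M)
    case (add x M)
    have "reflect_poly [:- x, 1:] = [:1, - x:]"
      by (simp add: reflect_poly_def cCons_def)
    thus ?case using add
      unfolding image_mset_add_mset prod_mset.add_mset reflect_poly_mult linear_prod_def by (simp only:)
  qed (simp add: linear_prod_def)
  moreover have "reflect_poly (reflect_poly f) = f" using assms by (intro reflect_poly_reflect_poly) simp
  ultimately have "f = linear_prod M" using rf by simp
  thus ?thesis using that[of M] M(1) dr by simp
qed

text \<open>Logarithmic differentiation of formal power series: each factor 1 - \<omega> T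
  contributes -\<omega> T/(1 - \<omega> T), the negative of the series \<open>G\<close>
  below.\<close>

lemma newton_linear_prod:
  "of_nat n * poly.coeff (linear_prod M) n =
    (\<Sum>m\<in>{1..n}. (- (\<Sum>\<omega>\<in>#M. \<omega> ^ m)) * poly.coeff (linear_prod M) (n - m))"
proof -
  define G where "G = (\<lambda>\<omega> :: complex. Abs_fps (\<lambda>m. if m = 0 then 0 else \<omega> ^ m))"
  define A where "A = (\<lambda>M. fps_of_poly (linear_prod M))"
  have G: "(1 - fps_const \<omega> * fps_X) * G \<omega> = fps_const \<omega> * fps_X" for \<omega>
  proof (rule fps_ext)
    fix n
    show "fps_nth ((1 - fps_const \<omega> * fps_X) * G \<omega>) n = fps_nth (fps_const \<omega> * fps_X) n"
      by (cases n) (auto simp: G_def left_diff_distrib mult.assoc)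
  qed
  have lin: "fps_of_poly [:1, - \<omega>:] = 1 - fps_const \<omega> * fps_X" for \<omega> :: complex
    by (simp add: fps_of_poly_pCons mult.commute fps_const_neg[symmetric] del: fps_const_neg)
  have A_add: "A (add_mset \<omega> M) = (1 - fps_const \<omega> * fps_X) * A M" for \<omega> M
    by (simp add: A_def linear_prod_def fps_of_poly_mult lin)
  have ring: "e * (- a * s) - (e * g) * a = - (e * a) * (g + s)" for e a s g :: "complex fps"
    by (simp add: algebra_simps)
  have der: "fps_X * fps_deriv (A M) = - A M * (\<Sum>\<omega>\<in>#M. G \<omega>)"
  proof (induction M)
    case empty thus ?case by (simp add: A_def linear_prod_def)
  next
    case (add \<omega> M)
    have "fps_X * fps_deriv (A (add_mset \<omega> M)) = (1 - fps_const \<omega> * fps_X) * (fps_X * fps_deriv (A M)) - (fps_const \<omega> * fps_X) * A M"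
      unfolding A_add by (simp add: algebra_simps)
    also have "\<dots> = (1 - fps_const \<omega> * fps_X) * (- A M * (\<Sum>\<omega>\<in>#M. G \<omega>)) - ((1 - fps_const \<omega> * fps_X) * G \<omega>) * A M"
      unfolding add G ..
    also have "\<dots> = - A (add_mset \<omega> M) * (\<Sum>\<omega>\<in>#add_mset \<omega> M. G \<omega>)"
      unfolding A_add image_mset_add_mset sum_mset.add_mset by (rule ring)
    finally show ?case .
  qed
  have Gsum: "fps_nth (\<Sum>\<omega>\<in>#M. G \<omega>) m = (if m = 0 then 0 else (\<Sum>\<omega>\<in>#M. \<omega> ^ m))" for m
    by (induction M) (auto simp: G_def)
  have "of_nat n * poly.coeff (linear_prod M) n = fps_nth (fps_X * fps_deriv (A M)) n"
    by (cases n) (auto simp: A_def)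
  also have "\<dots> = fps_nth (- ((\<Sum>\<omega>\<in>#M. G \<omega>) * A M)) n" unfolding der by (simp only: mult_minus_left mult.commute[of "A M"])
  also have "\<dots> = - (\<Sum>m\<in>{0..n}. fps_nth (\<Sum>\<omega>\<in>#M. G \<omega>) m * poly.coeff (linear_prod M) (n - m))"
    by (simp only: fps_neg_nth fps_mult_nth A_def fps_of_poly_nth)
  also have "{0..n} = insert 0 {1..n}" by auto
  also have "- (\<Sum>m\<in>insert 0 {1..n}. fps_nth (\<Sum>\<omega>\<in>#M. G \<omega>) m * poly.coeff (linear_prod M) (n - m)) =
     (\<Sum>m\<in>{1..n}. (- (\<Sum>\<omega>\<in>#M. \<omega> ^ m)) * poly.coeff (linear_prod M) (n - m))"
    by (subst sum.insert) (auto simp: Gsum sum_negf)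
  finally show ?thesis .
qed

text \<open>As the term m = n has coefficient a 0 = 1, the recursion determines each power sum from
  the earlier ones.\<close>

lemma newton_unique:
  fixes a s s' :: "nat \<Rightarrow> complex"
  assumes "a 0 = 1"
    and "\<And>n. of_nat n * a n = (\<Sum>m\<in>{1..n}. s m * a (n - m))"
    and "\<And>n. of_nat n * a n = (\<Sum>m\<in>{1..n}. s' m * a (n - m))"
  shows "n > 0 \<Longrightarrow> s n = s' n"
proof (induction n rule: less_induct)
  case (less n)
  have split: "{1..n} = insert n {1..<n}" using less.prems by auto
  have "(\<Sum>m\<in>{1..n}. s m * a (n - m)) = (\<Sum>m\<in>{1..n}. s' m * a (n - m))" using assms(2,3) by metis
  hence "s n * a 0 + (\<Sum>m\<in>{1..<n}. s m * a (n - m)) = s' n * a 0 + (\<Sum>m\<in>{1..<n}. s' m * a (n - m))"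
    unfolding split by (subst (asm) (1 2) sum.insert) auto
  moreover have "(\<Sum>m\<in>{1..<n}. s m * a (n - m)) = (\<Sum>m\<in>{1..<n}. s' m * a (n - m))"
    by (rule sum.cong[OF refl]) (use less.IH in auto)
  ultimately show ?case using assms(1) by simp
qed

lemma lfun_power_sum_roots:
  fixes R :: "'p::prime_card mod_ring set"
  assumes odd: "odd CARD('p)" and R: "R \<noteq> {}"
  obtains M where "size M \<le> card R" "\<And>n. n > 0 \<Longrightarrow> lfun_power_sum R t n = - (\<Sum>\<omega>\<in>#M. \<omega> ^ n)"
proof -
  define f where "f = Abs_poly (lfun_coeff R t)"
  have ev: "\<forall>\<^sub>\<infinity>n. lfun_coeff R t n = 0"
    using lfun_coeff_eq_0[OF odd R] by (auto simp: MOST_nat)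
  have cf: "poly.coeff f n = lfun_coeff R t n" for n
    unfolding f_def using ev by (subst Abs_poly_inverse) auto
  have "degree f \<le> card R" by (rule degree_le) (simp add: cf lfun_coeff_eq_0[OF odd R])
  moreover obtain M where M: "size M \<le> degree f" "f = linear_prod M"
    using poly_splits_at_0[of f] cf[of 0] lfun_coeff_0[of R t] by auto
  moreover have "lfun_power_sum R t n = - (\<Sum>\<omega>\<in>#M. \<omega> ^ n)" if "n > 0" for n
  proof (rule newton_unique[of "lfun_coeff R t" "lfun_power_sum R t", OF lfun_coeff_0 lfun_newton[OF odd] _ that])
    show "of_nat n * lfun_coeff R t n = (\<Sum>m = 1..n. - (\<Sum>\<omega>\<in>#M. \<omega> ^ m) * lfun_coeff R t (n - m))" for n
      using newton_linear_prod[of n M] unfolding M(2)[symmetric] cf .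
  qed
  ultimately show ?thesis using that[of M] by (meson order_trans)
qed

lemma sum_mset_single:
  fixes h :: "'a \<Rightarrow> 'b::comm_semiring_1"
  assumes "\<And>x. x \<in># M \<Longrightarrow> x \<noteq> a \<Longrightarrow> h x = 0"
  shows "(\<Sum>x\<in>#M. h x) = of_nat (count M a) * h a"
  using assms by (induction M) (auto simp: algebra_simps)

lemma power_sum_growth:
  fixes M :: "complex multiset"
  assumes "\<And>m. m > 0 \<Longrightarrow> cmod (\<Sum>\<omega>\<in>#M. \<omega> ^ m) \<le> C * B ^ m" "B > 0" "\<nu> \<in># M"
  shows "cmod \<nu> \<le> B"
proof (cases "\<nu> = 0")
  case False
  \<comment> \<open>\<open>f\<close> annihilates every entry other than \<nu>. The extra factor x
    removes the constant term, so only power sums of positive exponent occur, where the hypothesis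
    applies.\<close>
  define f where "f = [:0, 1:] * (\<Prod>\<omega>\<in>set_mset M - {\<nu>}. [:- \<omega>, 1:])"
  have fnu: "poly f \<nu> \<noteq> 0" using False by (simp add: f_def poly_prod)
  have f0: "poly.coeff f 0 = 0" by (simp add: f_def)
  have froot: "poly f \<omega> = 0" if "\<omega> \<in># M" "\<omega> \<noteq> \<nu>" for \<omega>
    unfolding f_def poly_mult poly_prod using that by (auto intro!: prod_zero)
  define K where "K = (\<Sum>i\<le>degree f. cmod (poly.coeff f i) * (\<bar>C\<bar> * B ^ i))"
  have bound: "cmod \<nu> ^ m * cmod (poly f \<nu>) \<le> K * B ^ m" for m
  proof -
    have 1: "(\<Sum>\<omega>\<in>#M. \<omega> ^ m * poly f \<omega>) = of_nat (count M \<nu>) * (\<nu> ^ m * poly f \<nu>)"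
      by (rule sum_mset_single) (use froot in simp)
    have "(\<Sum>\<omega>\<in>#M. \<omega> ^ m * poly f \<omega>) = (\<Sum>i\<le>degree f. poly.coeff f i * (\<Sum>\<omega>\<in>#M. \<omega> ^ (m + i)))"
      by (induction M) (auto simp: poly_altdef sum_distrib_left power_add sum.distrib algebra_simps)
    hence "cmod (\<Sum>\<omega>\<in>#M. \<omega> ^ m * poly f \<omega>) \<le> (\<Sum>i\<le>degree f. cmod (poly.coeff f i) * cmod (\<Sum>\<omega>\<in>#M. \<omega> ^ (m + i)))"
      by (simp add: norm_mult[symmetric] sum_norm_le)
    also have "\<dots> \<le> (\<Sum>i\<le>degree f. cmod (poly.coeff f i) * (\<bar>C\<bar> * B ^ i) * B ^ m)"
    proof (rule sum_mono)
      fix i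
      show "cmod (poly.coeff f i) * cmod (\<Sum>\<omega>\<in>#M. \<omega> ^ (m + i)) \<le> cmod (poly.coeff f i) * (\<bar>C\<bar> * B ^ i) * B ^ m"
      proof (cases "i = 0")
        case False
        have "cmod (\<Sum>\<omega>\<in>#M. \<omega> ^ (m + i)) \<le> C * B ^ (m + i)" using assms(1)[of "m + i"] False by simp
        also have "\<dots> \<le> \<bar>C\<bar> * B ^ (m + i)" using assms(2) by (intro mult_right_mono) auto
        finally have "cmod (poly.coeff f i) * cmod (\<Sum>\<omega>\<in>#M. \<omega> ^ (m + i)) \<le> cmod (poly.coeff f i) * (\<bar>C\<bar> * B ^ (m + i))"
          by (intro mult_left_mono) auto
        thus ?thesis by (simp add: power_add mult_ac)
      qed (simp add: f0)
    qed
    also have "\<dots> = K * B ^ m" unfolding K_def sum_distrib_right ..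
    finally have 2: "cmod (of_nat (count M \<nu>) * (\<nu> ^ m * poly f \<nu>)) \<le> K * B ^ m" unfolding 1 .
    have "1 * cmod (\<nu> ^ m * poly f \<nu>) \<le> real (count M \<nu>) * cmod (\<nu> ^ m * poly f \<nu>)"
      using assms(3) by (intro mult_right_mono) (auto simp: Suc_le_eq)
    thus ?thesis using 2 by (simp add: norm_mult norm_power)
  qed
  show ?thesis
  proof (rule ccontr)
    assume "\<not> cmod \<nu> \<le> B"
    hence r: "cmod \<nu> / B > 1" using assms(2) by simp
    obtain m where "K / cmod (poly f \<nu>) < (cmod \<nu> / B) ^ m" using real_arch_pow[OF r] by blast
    hence "K * B ^ m < cmod \<nu> ^ m * cmod (poly f \<nu>)"
      using assms(2) fnu by (simp add: power_divide field_simps)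
    thus False using bound[of m] by simp
  qed
qed (use assms in auto)

lemma irred_dvd_1: "irred_dvd 1 = range (\<lambda>x :: 'p::prime_card mod_ring. [:- x, 1:])"
proof (intro equalityI subsetI)
  fix P :: "'p mod_ring poly" assume "P \<in> irred_dvd 1"
  hence P: "monic P" "degree P = 1" by (auto simp: irred_dvd_def)
  then obtain a b where "P = [:b, a:]" by (metis degree1_coeffs One_nat_def)
  hence "P = [:- (- b), 1:]" using P by auto
  thus "P \<in> range (\<lambda>x. [:- x, 1:])" by blast
next
  fix P :: "'p mod_ring poly" assume "P \<in> range (\<lambda>x. [:- x, 1:])"
  thus "P \<in> irred_dvd 1" by (auto simp: irred_dvd_def intro!: irreducible_linear_field_poly)
qed

lemma norm_sum_mset_le: "norm (\<Sum>x\<in>#A. f x) \<le> (\<Sum>x\<in>#A. norm (f x))"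
  for f :: "'b \<Rightarrow> 'a::real_normed_vector"
  by (induction A) (auto intro: norm_triangle_le)

theorem weil_bound:
  fixes R :: "'p::prime_card mod_ring set"
  assumes odd: "odd CARD('p)" and R: "R \<noteq> {}"
  shows "cmod (\<Sum>x\<in>UNIV. of_real (qchar (\<Prod>a\<in>R. a - x)) * psi (- (t * x))) \<le> real (card R) * sqrt (real CARD('p))"
proof -
  have "\<forall>t. \<exists>M. size M \<le> card R \<and> (\<forall>n>0. lfun_power_sum R t n = - (\<Sum>\<omega>\<in>#M. \<omega> ^ n))"
    using lfun_power_sum_roots[OF odd R] by metis
  then obtain M where M: "\<And>t. size (M t) \<le> card R" "\<And>t n. n > 0 \<Longrightarrow> lfun_power_sum R t n = - (\<Sum>\<omega>\<in>#M t. \<omega> ^ n)"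
    by metis
  \<comment> \<open>Squares, because only extensions of even degree are controlled; all
    \<open>t\<close> together, because only the total over \<open>t\<close> is bounded. Since
    \<open>power_sum_growth\<close> bounds every entry, each single \<open>t\<close> is
    recovered.\<close>
  define N where "N = (\<Sum>t\<in>UNIV. image_mset (\<lambda>\<omega>. \<omega> ^ 2) (M t))"
  from qchar_ext_sum_bound[OF odd R] obtain C where
    "\<forall>m>0. \<bar>\<Sum>z | frob (2 * m) z = z. qchar_ext (2 * m) (poly_ac (artin_schreier_prod R) z)\<bar> \<le> C * real CARD('p) ^ m"
    by (elim exE)
  note C = this[rule_format]
  have growth: "cmod (\<Sum>\<omega>\<in>#N. \<omega> ^ m) \<le> C * real CARD('p) ^ m" if m: "m > 0" for m
  proof -
    have "(\<Sum>\<omega>\<in>#(\<Sum>t\<in>T. image_mset (\<lambda>\<omega>. \<omega> ^ 2) (M t)). \<omega> ^ m) = (\<Sum>t\<in>T. \<Sum>\<omega>\<in>#M t. \<omega> ^ (2 * m))" if "finite T" for T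
      using that by induction (auto simp: image_mset.compositionality o_def power_mult)
    hence "(\<Sum>\<omega>\<in>#N. \<omega> ^ m) = (\<Sum>t\<in>UNIV. \<Sum>\<omega>\<in>#M t. \<omega> ^ (2 * m))" unfolding N_def by simp
    also have "\<dots> = - (\<Sum>t\<in>UNIV. lfun_power_sum R t (2 * m))" using M(2) m by (simp add: sum_negf)
    also have "\<dots> = - of_real (\<Sum>z | frob (2 * m) z = z. qchar_ext (2 * m) (poly_ac (artin_schreier_prod R) z))"
      using m by (subst sum_lfun_power_sum[OF odd]) auto
    finally have "cmod (\<Sum>\<omega>\<in>#N. \<omega> ^ m) = \<bar>\<Sum>z | frob (2 * m) z = z. qchar_ext (2 * m) (poly_ac (artin_schreier_prod R) z)\<bar>"
      by (simp only: norm_minus_cancel norm_of_real)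
    thus ?thesis using C[OF m] by simp
  qed
  have root: "cmod \<omega> \<le> sqrt (real CARD('p))" if "\<omega> \<in># M t" for \<omega>
  proof -
    have "\<omega> ^ 2 \<in># N" unfolding N_def using that by (auto simp: set_mset_sum)
    hence "cmod (\<omega> ^ 2) \<le> real CARD('p)" by (rule power_sum_growth[OF growth, rotated 2]) auto
    thus ?thesis by (intro real_le_rsqrt) (simp add: norm_power)
  qed
  have "(\<Sum>x\<in>UNIV. of_real (qchar (\<Prod>a\<in>R. a - x)) * psi (- (t * x))) = (\<Sum>x\<in>UNIV. lfun_char R t [:- x, 1:])"
    by (simp add: lfun_char_def monic_trace_def)
  also have "\<dots> = lfun_power_sum R t 1"
    unfolding lfun_power_sum_def irred_dvd_1 by (subst sum.reindex) (auto simp: inj_on_def)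
  also have "\<dots> = - (\<Sum>\<omega>\<in>#M t. \<omega>)" using M(2)[of 1 t] by simp
  finally have "cmod (\<Sum>x\<in>UNIV. of_real (qchar (\<Prod>a\<in>R. a - x)) * psi (- (t * x))) = cmod (\<Sum>\<omega>\<in>#M t. \<omega>)" by simp
  also have "\<dots> \<le> (\<Sum>\<omega>\<in>#M t. cmod \<omega>)"
    using norm_sum_mset_le[of "\<lambda>\<omega>. \<omega>" "M t"] by simp
  also have "\<dots> \<le> (\<Sum>\<omega>\<in>#M t. sqrt (real CARD('p)))" by (rule sum_mset_mono) (rule root)
  also have "\<dots> = real (size (M t)) * sqrt (real CARD('p))" by simp
  also have "\<dots> \<le> real (card R) * sqrt (real CARD('p))" using M(1)[of t] by (intro mult_right_mono) auto
  finally show ?thesis .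
qed

section \<open>Multilinear sums\<close>

lemma parseval_psi:
  fixes u :: "'p::prime_card mod_ring \<Rightarrow> real"
  assumes "\<And>y. \<bar>u y\<bar> \<le> 1"
  shows "(\<Sum>t\<in>UNIV. (cmod (\<Sum>y\<in>UNIV. of_real (u y) * psi (- (t * y)))) ^ 2) \<le> (real CARD('p)) ^ 2"
proof -
  have "complex_of_real (\<Sum>t\<in>UNIV. (cmod (\<Sum>y\<in>UNIV. of_real (u y) * psi (- (t * y)))) ^ 2)
    = (\<Sum>t\<in>UNIV. (\<Sum>y\<in>UNIV. of_real (u y) * psi (- (t * y))) * cnj (\<Sum>z\<in>UNIV. of_real (u z) * psi (- (t * z))))"
    by (simp only: of_real_sum of_real_power complex_norm_square[symmetric])
  also have "\<dots> = (\<Sum>t\<in>UNIV. \<Sum>y\<in>UNIV. \<Sum>z\<in>UNIV. of_real (u y * u z) * psi (t * (z - y)))"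
  proof (rule sum.cong[OF refl])
    fix t :: "'p mod_ring"
    have "psi (- (t * y)) * cnj (psi (- (t * z))) = psi (t * (z - y))" for y z
      by (simp add: psi_uminus[symmetric] psi_add[symmetric] algebra_simps)
    hence pr: "(of_real (u y) * psi (- (t * y))) * cnj (of_real (u z) * psi (- (t * z))) = of_real (u y * u z) * psi (t * (z - y))" for y z
    proof -
      have "(of_real (u y) * psi (- (t * y))) * cnj (of_real (u z) * psi (- (t * z)))
          = of_real (u y * u z) * (psi (- (t * y)) * cnj (psi (- (t * z))))"
        by (simp only: complex_cnj_mult complex_cnj_complex_of_real of_real_mult mult_ac)
      thus ?thesis by (simp only: \<open>\<And>y z. psi (- (t * y)) * cnj (psi (- (t * z))) = psi (t * (z - y))\<close>)
    qed
    show "(\<Sum>y\<in>UNIV. of_real (u y) * psi (- (t * y))) * cnj (\<Sum>z\<in>UNIV. of_real (u z) * psi (- (t * z)))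
       = (\<Sum>y\<in>UNIV. \<Sum>z\<in>UNIV. of_real (u y * u z) * psi (t * (z - y)))"
      unfolding cnj_sum sum_product pr ..
  qed
  also have "\<dots> = (\<Sum>y\<in>UNIV. \<Sum>z\<in>UNIV. \<Sum>t\<in>UNIV. of_real (u y * u z) * psi (t * (z - y)))"
    by (subst sum.swap) (intro sum.cong refl sum.swap)
  also have "\<dots> = (\<Sum>y\<in>UNIV. \<Sum>z\<in>UNIV. if z = y then of_real (real CARD('p) * (u y) ^ 2) else 0)"
    unfolding sum_distrib_left[symmetric] sum_psi by (intro sum.cong refl) (auto simp: power2_eq_square)
  also have "\<dots> = of_real (\<Sum>y\<in>UNIV. real CARD('p) * (u y) ^ 2)"
    by simp
  finally have "(\<Sum>t\<in>UNIV. (cmod (\<Sum>y\<in>UNIV. of_real (u y) * psi (- (t * y)))) ^ 2) = (\<Sum>y\<in>UNIV. real CARD('p) * (u y) ^ 2)"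
    by (simp only: of_real_eq_iff)
  also have "\<dots> \<le> (\<Sum>y::'p mod_ring\<in>UNIV. real CARD('p) * 1)"
    using assms by (intro sum_mono mult_left_mono) (auto simp: abs_square_le_1)
  finally show ?thesis by (simp add: power2_eq_square)
qed

text \<open>Fourier inversion of \<open>f\<close> separates the two variables at the cost of a
  factor 1/p. The transforms of \<open>u\<close> and \<open>v\<close> have square sums at most p^2
  by Parseval, so the total is at most K * p.\<close>

lemma bilinear_bound:
  fixes f u v :: "'p::prime_card mod_ring \<Rightarrow> real"
  assumes u: "\<And>y. \<bar>u y\<bar> \<le> 1" and v: "\<And>x. \<bar>v x\<bar> \<le> 1"
    and f: "\<And>t. cmod (\<Sum>s\<in>UNIV. of_real (f s) * psi (t * s)) \<le> K"
  shows "\<bar>\<Sum>y\<in>UNIV. \<Sum>x\<in>UNIV. f (x + y) * (u y * v x)\<bar> \<le> K * real CARD('p)"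
proof -
  define F where "F = (\<lambda>t. \<Sum>s\<in>UNIV. of_real (f s) * psi (t * s))"
  define U where "U = (\<lambda>t. \<Sum>y\<in>UNIV. of_real (u y) * psi (- (t * y)))"
  define V where "V = (\<lambda>t. \<Sum>x\<in>UNIV. of_real (v x) * psi (- (t * x)))"
  have inv: "(\<Sum>t\<in>UNIV. F t * psi (- (t * z))) = of_real (real CARD('p) * f z)" for z
  proof -
    have "(\<Sum>t\<in>UNIV. F t * psi (- (t * z))) = (\<Sum>t\<in>UNIV. \<Sum>s\<in>UNIV. of_real (f s) * psi (t * (s - z)))"
      unfolding F_def sum_distrib_right by (intro sum.cong refl) (simp add: mult.assoc psi_add[symmetric] algebra_simps)
    also have "\<dots> = (\<Sum>s\<in>UNIV. of_real (f s) * (\<Sum>t\<in>UNIV. psi (t * (s - z))))"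
      by (subst sum.swap) (simp add: sum_distrib_left)
    also have "\<dots> = (\<Sum>s\<in>UNIV. if s = z then of_real (real CARD('p) * f z) else 0)"
      unfolding sum_psi by (intro sum.cong refl) auto
    finally show ?thesis by simp
  qed
  have "complex_of_real (real CARD('p) * (\<Sum>y\<in>UNIV. \<Sum>x\<in>UNIV. f (x + y) * (u y * v x)))
    = (\<Sum>y\<in>UNIV. \<Sum>x\<in>UNIV. of_real (real CARD('p) * f (x + y)) * of_real (u y * v x))"
    by (simp add: sum_distrib_left mult.assoc)
  also have "\<dots> = (\<Sum>y\<in>UNIV. \<Sum>x\<in>UNIV. \<Sum>t\<in>UNIV. F t * psi (- (t * (x + y))) * of_real (u y * v x))"
    unfolding inv[symmetric] sum_distrib_right ..
  also have "\<dots> = (\<Sum>y\<in>UNIV. \<Sum>t\<in>UNIV. \<Sum>x\<in>UNIV. F t * psi (- (t * (x + y))) * of_real (u y * v x))"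
    by (intro sum.cong refl sum.swap)
  also have "\<dots> = (\<Sum>t\<in>UNIV. \<Sum>y\<in>UNIV. \<Sum>x\<in>UNIV. F t * psi (- (t * (x + y))) * of_real (u y * v x))"
    by (rule sum.swap)
  also have "\<dots> = (\<Sum>t\<in>UNIV. F t * (U t * V t))"
  proof (rule sum.cong[OF refl])
    fix t :: "'p mod_ring"
    have "F t * psi (- (t * (x + y))) * of_real (u y * v x) = F t * ((of_real (u y) * psi (- (t * y))) * (of_real (v x) * psi (- (t * x))))" for x y
    proof -
      have "psi (- (t * (x + y))) = psi (- (t * y)) * psi (- (t * x))" by (simp add: psi_add[symmetric] algebra_simps)
      thus ?thesis by (simp only: of_real_mult mult_ac)
    qed
    note fa = this
    show "(\<Sum>y\<in>UNIV. \<Sum>x\<in>UNIV. F t * psi (- (t * (x + y))) * of_real (u y * v x)) = F t * (U t * V t)"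
      unfolding fa U_def V_def sum_product by (simp only: sum_distrib_left)
  qed
  finally have eq: "complex_of_real (real CARD('p) * (\<Sum>y\<in>UNIV. \<Sum>x\<in>UNIV. f (x + y) * (u y * v x))) = (\<Sum>t\<in>UNIV. F t * (U t * V t))" .
  have K0: "K \<ge> 0" using f[of 0] norm_ge_zero order_trans by blast
  have "real CARD('p) * \<bar>\<Sum>y\<in>UNIV. \<Sum>x\<in>UNIV. f (x + y) * (u y * v x)\<bar> = cmod (\<Sum>t\<in>UNIV. F t * (U t * V t))"
    unfolding eq[symmetric] norm_of_real by (simp add: abs_mult)
  also have "\<dots> \<le> (\<Sum>t\<in>UNIV. K * ((cmod (U t)) ^ 2 / 2 + (cmod (V t)) ^ 2 / 2))"
  proof (rule sum_norm_le)
    fix t :: "'p mod_ring"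
    have "cmod (U t) * cmod (V t) \<le> (cmod (U t)) ^ 2 / 2 + (cmod (V t)) ^ 2 / 2"
      using sum_squares_bound[of "cmod (U t)" "cmod (V t)"] by (simp add: field_simps)
    thus "cmod (F t * (U t * V t)) \<le> K * ((cmod (U t)) ^ 2 / 2 + (cmod (V t)) ^ 2 / 2)"
      unfolding norm_mult using f[of t] K0 by (intro mult_mono) (auto simp: F_def)
  qed
  also have "\<dots> = K * ((\<Sum>t\<in>UNIV. (cmod (U t)) ^ 2) / 2 + (\<Sum>t\<in>UNIV. (cmod (V t)) ^ 2) / 2)"
    by (simp add: sum_distrib_left[symmetric] sum.distrib sum_divide_distrib)
  also have "\<dots> \<le> K * ((real CARD('p)) ^ 2 / 2 + (real CARD('p)) ^ 2 / 2)"
    using parseval_psi[of u, OF u] parseval_psi[of v, OF v] K0 unfolding U_def V_def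
    by (intro mult_left_mono add_mono divide_right_mono) auto
  finally have "real CARD('p) * \<bar>\<Sum>y\<in>UNIV. \<Sum>x\<in>UNIV. f (x + y) * (u y * v x)\<bar> \<le> real CARD('p) * (K * real CARD('p))"
    by (simp add: power2_eq_square mult_ac)
  thus ?thesis by (rule mult_left_le_imp_le) simp
qed

text \<open>This family is stable under Cauchy-Schwarz: the product of two translates of a kernel is
  again a kernel when the translated sets are disjoint.\<close>

definition shift_kernel :: "'p::prime_card mod_ring set \<Rightarrow> 'p mod_ring \<Rightarrow> real" where
  "shift_kernel A s = (\<Prod>a\<in>A. qchar (a + s))"

lemma abs_shift_kernel_le_1: "\<bar>shift_kernel A s\<bar> \<le> 1"
  unfolding shift_kernel_def abs_prod by (rule prod_le_1) (simp add: abs_qchar_le_1)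

lemma shift_kernel_fourier:
  fixes A :: "'p::prime_card mod_ring set"
  assumes "odd CARD('p)" "A \<noteq> {}"
  shows "cmod (\<Sum>s\<in>UNIV. of_real (shift_kernel A s) * psi (t * s)) \<le> real (card A) * sqrt (real CARD('p))"
proof -
  have "(\<Sum>s\<in>UNIV. of_real (shift_kernel A s) * psi (t * s)) = (\<Sum>x\<in>UNIV. of_real (qchar (\<Prod>a\<in>A. a - x)) * psi (- (t * x)))"
    by (rule sum.reindex_bij_witness[of _ uminus uminus]) (auto simp: shift_kernel_def qchar_prod[OF assms(1)])
  thus ?thesis using weil_bound[OF assms, of t] by simp
qed

section \<open>Sums over tuples and the Cauchy-Schwarz induction\<close>

definition tuples :: "nat \<Rightarrow> 'a list set" where
  "tuples n = {xs. length xs = n}"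

lemma finite_tuples: "finite (tuples n :: 'a::finite list set)"
  using finite_lists_length_eq[of "UNIV :: 'a set" n] by (simp add: tuples_def)

lemma card_tuples: "card (tuples n :: 'a::finite list set) = CARD('a) ^ n"
  using card_lists_length_eq[of "UNIV :: 'a set" n] by (simp add: tuples_def)

lemma sum_tuples_Suc:
  fixes f :: "'a::finite list \<Rightarrow> 'b::comm_monoid_add"
  shows "(\<Sum>xs\<in>tuples (Suc n). f xs) = (\<Sum>xs\<in>tuples n. \<Sum>x\<in>UNIV. f (x # xs))"
proof -
  have "(\<Sum>xs\<in>tuples n. \<Sum>x\<in>UNIV. f (x # xs)) = (\<Sum>(xs, x)\<in>tuples n \<times> UNIV. f (x # xs))"
    by (simp add: sum.cartesian_product)
  also have "\<dots> = (\<Sum>xs\<in>tuples (Suc n). f xs)"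
    by (rule sum.reindex_bij_witness[of _ "\<lambda>xs. (tl xs, hd xs)" "\<lambda>(xs, x). x # xs"])
       (auto simp: tuples_def length_Suc_conv)
  finally show ?thesis by simp
qed

lemma tuples_0: "tuples 0 = {[]}"
  by (auto simp: tuples_def)

text \<open>Updating beyond the end of a list changes nothing, so this restricts \<open>g\<close>
  only on lists longer than \<open>j\<close>.\<close>

definition ignores :: "nat \<Rightarrow> ('a list \<Rightarrow> real) \<Rightarrow> bool" where
  "ignores j g \<longleftrightarrow> (\<forall>xs y. g (xs[j := y]) = g xs)"

text \<open>The recursion copies one Cauchy-Schwarz step: disjoint pairs of translates lead to 2 * r
  shifts, overlapping pairs contribute r^2, and the square root is taken at the end. The prime does
  not enter.\<close>

fun box_const :: "nat \<Rightarrow> nat \<Rightarrow> real" where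
  "box_const 0 r = real r"
| "box_const (Suc n) r = sqrt (box_const n (2 * r) + real r ^ 2)"

lemma box_const_nonneg: "box_const n r \<ge> 0"
  by (induction n arbitrary: r) (auto intro!: add_nonneg_nonneg)

text \<open>An overlap forces y = x + a - b. Such \<open>y\<close> are set apart because the two
  kernels then share a factor, whose square spoils the cancellation.\<close>

lemma card_overlapping_shifts:
  fixes A :: "'a::{finite,ab_group_add} set"
  shows "card {y. (\<lambda>a. x + a) ` A \<inter> (\<lambda>a. y + a) ` A \<noteq> {}} \<le> card A ^ 2"
proof -
  have "{y. (\<lambda>a. x + a) ` A \<inter> (\<lambda>a. y + a) ` A \<noteq> {}} \<subseteq> (\<lambda>(a, b). x + a - b) ` (A \<times> A)"
  proof
    fix y assume "y \<in> {y. (\<lambda>a. x + a) ` A \<inter> (\<lambda>a. y + a) ` A \<noteq> {}}"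
    then obtain a b where "a \<in> A" "b \<in> A" "x + a = y + b" by blast
    hence "y = x + a - b" by simp
    thus "y \<in> (\<lambda>(a, b). x + a - b) ` (A \<times> A)" using \<open>a \<in> A\<close> \<open>b \<in> A\<close> by auto
  qed
  hence "card {y. (\<lambda>a. x + a) ` A \<inter> (\<lambda>a. y + a) ` A \<noteq> {}} \<le> card ((\<lambda>(a, b). x + a - b) ` (A \<times> A))"
    by (intro card_mono) auto
  also have "\<dots> \<le> card (A \<times> A)" by (rule card_image_le) simp
  finally show ?thesis by (simp add: card_cartesian_product power2_eq_square)
qed

lemma shift_kernel_add:
  fixes A :: "'p::prime_card mod_ring set"
  shows "shift_kernel A (x + s) = shift_kernel ((\<lambda>a. x + a) ` A) s"
  unfolding shift_kernel_def by (subst prod.reindex) (auto simp: inj_on_def ac_simps)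

lemma shift_kernel_Un:
  fixes A B :: "'p::prime_card mod_ring set"
  shows "A \<inter> B = {} \<Longrightarrow> shift_kernel (A \<union> B) s = shift_kernel A s * shift_kernel B s"
  unfolding shift_kernel_def by (rule prod.union_disjoint) auto

lemma abs_prod_le_1:
  fixes g :: "'b \<Rightarrow> real"
  assumes "\<And>j. j \<in> I \<Longrightarrow> \<bar>g j\<bar> \<le> 1"
  shows "\<bar>\<Prod>j\<in>I. g j\<bar> \<le> 1"
  unfolding abs_prod using assms by (intro prod_le_1) auto

text \<open>The arity is \<open>n + 2\<close>, so \<open>n = 0\<close> is the bilinear case; the induction step
  removes the first variable by Cauchy--Schwarz and doubles the set of shifts.\<close>

lemma box_bound:
  fixes A :: "'p::prime_card mod_ring set" and g :: "nat \<Rightarrow> 'p mod_ring list \<Rightarrow> real"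
  assumes odd: "odd CARD('p)" and A: "A \<noteq> {}"
    and g: "\<And>j xs. \<bar>g j xs\<bar> \<le> 1" "\<And>j. ignores j (g j)"
  shows "\<bar>\<Sum>xs\<in>tuples (n + 2). shift_kernel A (sum_list xs) * (\<Prod>j<n + 2. g j xs)\<bar>
    \<le> box_const n (card A) * real CARD('p) powr (real n + 2 - 2 powr (- real (n + 1)))"
  using A g
proof (induction n arbitrary: A g)
  case 0
  \<comment> \<open>With two variables, ignoring one means depending on the other alone.\<close>
  have ig: "g 0 [x, y] = g 0 [0, y]" "g 1 [x, y] = g 1 [x, 0]" for x y
  proof -
    have "g 0 ([x, y][0 := 0]) = g 0 [x, y]" "g 1 ([x, y][1 := 0]) = g 1 [x, y]"
      using 0(3)[of 0] 0(3)[of 1] unfolding ignores_def by blast+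
    thus "g 0 [x, y] = g 0 [0, y]" "g 1 [x, y] = g 1 [x, 0]" by simp_all
  qed
  have "(\<Sum>xs\<in>tuples (0 + 2). shift_kernel A (sum_list xs) * (\<Prod>j<0 + 2. g j xs))
     = (\<Sum>y\<in>UNIV. \<Sum>x\<in>UNIV. shift_kernel A (x + y) * (g 0 [0, y] * g 1 [x, 0]))"
  proof -
    have pr2: "(\<Prod>j<2. h j) = h 0 * h 1" for h :: "nat \<Rightarrow> real" by (simp add: numeral_2_eq_2)
    have "(\<Sum>xs\<in>tuples (0 + 2). f xs) = (\<Sum>y\<in>UNIV. \<Sum>x\<in>UNIV. f [x, y])" for f :: "'p mod_ring list \<Rightarrow> real"
      by (simp add: numeral_2_eq_2 sum_tuples_Suc tuples_0)
    moreover have "shift_kernel A (sum_list [x, y]) * (\<Prod>j<0 + 2. g j [x, y]) = shift_kernel A (x + y) * (g 0 [0, y] * g 1 [x, 0])" for x y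
      unfolding add_0 pr2 ig(1)[of x y] ig(2)[of x y] by simp
    ultimately show ?thesis by (simp only:)
  qed
  also have "\<bar>\<dots>\<bar> \<le> (real (card A) * sqrt (real CARD('p))) * real CARD('p)"
    by (rule bilinear_bound) (use 0(2) shift_kernel_fourier[OF odd 0(1)] in auto)
  also have "\<dots> = box_const 0 (card A) * real CARD('p) powr (real 0 + 2 - 2 powr (- real (0 + 1)))"
  proof -
    have "real CARD('p) powr (2 - 1 / 2) = real CARD('p) powr (1 / 2 + 1)" by simp
    also have "\<dots> = sqrt (real CARD('p)) * real CARD('p)" by (subst powr_add) (simp add: powr_half_sqrt)
    finally show ?thesis by (simp add: powr_minus)
  qed
  finally show ?case .
next
  case (Suc n)
  define p where "p = real CARD('p)"
  have p1: "p > 1" using prime_card_gt_1[where ?'p = 'p] by (simp add: p_def)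
  define N where "N = n + 2"
  define e where "e = 2 powr (- real (n + 1))"
  have e01: "0 \<le> e" "e \<le> 1" unfolding e_def using powr_mono[of "- real (n + 1)" 0 "2::real"] by auto
  define c where "c = box_const n (2 * card A)"
  define h where "h = (\<lambda>x xs. shift_kernel A (x + sum_list xs) * (\<Prod>j<N. g (Suc j) (x # xs)))"
  define T where "T = (\<lambda>xs. \<Sum>x\<in>UNIV. h x xs)"
  define S where "S = (\<Sum>xs\<in>tuples (Suc n + 2). shift_kernel A (sum_list xs) * (\<Prod>j<Suc n + 2. g j xs))"
  have g0: "g 0 (x # xs) = g 0 (0 # xs)" for x xs
  proof -
    have "g 0 ((x # xs)[0 := 0]) = g 0 (x # xs)" using Suc.prems(3)[of 0] unfolding ignores_def by blast
    thus ?thesis by simp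
  qed
  \<comment> \<open>\<open>g 0\<close> does not see the first variable, so it leaves the inner sum
    and Cauchy-Schwarz can discard it through its bound 1.\<close>
  have S: "S = (\<Sum>xs\<in>tuples N. g 0 (0 # xs) * T xs)"
  proof -
    have "S = (\<Sum>xs\<in>tuples N. \<Sum>x\<in>UNIV. shift_kernel A (x + sum_list xs) * (\<Prod>j<Suc N. g j (x # xs)))"
      unfolding S_def N_def by (simp only: add_Suc sum_tuples_Suc sum_list.Cons)
    also have "\<dots> = (\<Sum>xs\<in>tuples N. \<Sum>x\<in>UNIV. g 0 (0 # xs) * h x xs)"
    proof (intro sum.cong refl)
      fix xs x
      show "shift_kernel A (x + sum_list xs) * (\<Prod>j<Suc N. g j (x # xs)) = g 0 (0 # xs) * h x xs"
        unfolding prod.lessThan_Suc_shift g0[of x xs] h_def by (simp only: mult_ac)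
    qed
    finally show ?thesis unfolding T_def by (simp only: sum_distrib_left)
  qed
  have pair: "\<bar>\<Sum>xs\<in>tuples N. h x xs * h y xs\<bar> \<le> (if (\<lambda>a. x + a) ` A \<inter> (\<lambda>a. y + a) ` A = {} then c * p powr (real N - e) else p ^ N)" for x y
  proof (cases "(\<lambda>a. x + a) ` A \<inter> (\<lambda>a. y + a) ` A = {}")
    case True
    define B where "B = (\<lambda>a. x + a) ` A \<union> (\<lambda>a. y + a) ` A"
    have cB: "card B = 2 * card A"
      unfolding B_def by (subst card_Un_disjoint) (auto simp: True card_image)
    \<comment> \<open>With \<open>x\<close> and \<open>y\<close> frozen, the paired factors again
      ignore one of the \<open>N\<close> remaining variables each, with the index lowered by one; so
      the induction hypothesis applies.\<close>
    define g' where "g' = (\<lambda>j xs. g (Suc j) (x # xs) * g (Suc j) (y # xs))"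
    have "h x xs * h y xs = shift_kernel B (sum_list xs) * (\<Prod>j<N. g' j xs)" for xs
      unfolding h_def g'_def B_def shift_kernel_Un[OF True] shift_kernel_add prod.distrib by (simp only: mult_ac)
    moreover have "\<bar>\<Sum>xs\<in>tuples (n + 2). shift_kernel B (sum_list xs) * (\<Prod>j<n + 2. g' j xs)\<bar>
        \<le> box_const n (card B) * real CARD('p) powr (real n + 2 - 2 powr (- real (n + 1)))"
    proof (rule Suc.IH)
      show "B \<noteq> {}" using Suc.prems(1) by (simp add: B_def)
      show "\<bar>g' j xs\<bar> \<le> 1" for j xs
        unfolding g'_def abs_mult using Suc.prems(2) by (intro mult_le_one) auto
      show "ignores j (g' j)" for j
        unfolding ignores_def
      proof (intro allI)
        fix xs y'
        have "g (Suc j) ((z # xs)[Suc j := y']) = g (Suc j) (z # xs)" for z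
          using Suc.prems(3)[of "Suc j"] unfolding ignores_def by blast
        thus "g' j (xs[j := y']) = g' j xs" unfolding g'_def by simp
      qed
    qed
    moreover have "real n + 2 - 2 powr (- real (n + 1)) = real N - e" by (simp add: N_def e_def)
    ultimately show ?thesis unfolding if_P[OF True] by (simp only: N_def cB c_def p_def)
  next
    case False
    have "\<bar>h x xs\<bar> \<le> 1" for x xs
      unfolding h_def abs_mult using abs_shift_kernel_le_1 Suc.prems(2) by (intro mult_le_one abs_prod_le_1) auto
    hence "\<bar>h x xs * h y xs\<bar> \<le> 1" for xs unfolding abs_mult by (intro mult_le_one) auto
    hence "\<bar>\<Sum>xs\<in>tuples N. h x xs * h y xs\<bar> \<le> (\<Sum>xs::'p mod_ring list\<in>tuples N. 1)"
      by (intro order_trans[OF sum_abs] sum_mono)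
    thus ?thesis using False by (simp add: card_tuples p_def)
  qed
  have row: "(\<Sum>y\<in>UNIV. (if (\<lambda>a. x + a) ` A \<inter> (\<lambda>a. y + a) ` A = {} then c * p powr (real N - e) else p ^ N))
     \<le> p * (c * p powr (real N - e)) + real (card A) ^ 2 * p ^ N" for x
  proof -
    have "(\<Sum>y\<in>UNIV. (if (\<lambda>a. x + a) ` A \<inter> (\<lambda>a. y + a) ` A = {} then c * p powr (real N - e) else p ^ N))
      \<le> (\<Sum>y\<in>UNIV. c * p powr (real N - e) + (if (\<lambda>a. x + a) ` A \<inter> (\<lambda>a. y + a) ` A \<noteq> {} then p ^ N else 0))"
      using p1 by (intro sum_mono) (auto simp: c_def box_const_nonneg)
    also have "\<dots> = p * (c * p powr (real N - e)) + real (card {y. (\<lambda>a. x + a) ` A \<inter> (\<lambda>a. y + a) ` A \<noteq> {}}) * p ^ N"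
      by (simp add: sum.distrib p_def sum.If_cases)
    also have "\<dots> \<le> p * (c * p powr (real N - e)) + real (card A ^ 2) * p ^ N"
      using p1 card_overlapping_shifts[of x A] by (intro add_left_mono mult_right_mono) (auto simp del: of_nat_power)
    finally show ?thesis by simp
  qed
  have powN: "p ^ N = p powr real N" using p1 by (simp add: powr_realpow)
  have T2: "(\<Sum>xs\<in>tuples N. (T xs) ^ 2) \<le> (c + real (card A) ^ 2) * p powr (real N + 2 - e)"
  proof -
    have "(\<Sum>xs\<in>tuples N. (T xs) ^ 2) = (\<Sum>xs\<in>tuples N. \<Sum>x\<in>UNIV. \<Sum>y\<in>UNIV. h x xs * h y xs)"
      unfolding T_def power2_eq_square sum_product ..
    also have "\<dots> = (\<Sum>x\<in>UNIV. \<Sum>y\<in>UNIV. \<Sum>xs\<in>tuples N. h x xs * h y xs)"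
      by (subst sum.swap) (intro sum.cong refl sum.swap)
    also have "\<dots> \<le> (\<Sum>x::'p mod_ring\<in>UNIV. p * (c * p powr (real N - e)) + real (card A) ^ 2 * p ^ N)"
    proof (rule sum_mono)
      fix x
      have "(\<Sum>y\<in>UNIV. \<Sum>xs\<in>tuples N. h x xs * h y xs) \<le>
        (\<Sum>y\<in>UNIV. (if (\<lambda>a. x + a) ` A \<inter> (\<lambda>a. y + a) ` A = {} then c * p powr (real N - e) else p ^ N))"
        by (rule sum_mono) (rule abs_le_D1[OF pair])
      also note row
      finally show "(\<Sum>y\<in>UNIV. \<Sum>xs\<in>tuples N. h x xs * h y xs) \<le> p * (c * p powr (real N - e)) + real (card A) ^ 2 * p ^ N" .
    qed
    also have "\<dots> = c * (p * p * p powr (real N - e)) + real (card A) ^ 2 * (p * p ^ N)"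
      by (simp add: p_def algebra_simps)
    also have "p * p * p powr (real N - e) = p powr (real N + 2 - e)"
    proof -
      have "real N + 2 - e = 2 + (real N - e)" by simp
      thus ?thesis using p1 by (simp only: powr_add) (simp add: power2_eq_square)
    qed
    also have "p * p ^ N = p powr (real N + 1)" using p1 by (simp add: powN powr_add)
    also have "c * p powr (real N + 2 - e) + real (card A) ^ 2 * p powr (real N + 1)
       \<le> c * p powr (real N + 2 - e) + real (card A) ^ 2 * p powr (real N + 2 - e)"
      using p1 e01 by (intro add_left_mono mult_left_mono powr_mono) auto
    finally show ?thesis by (simp add: algebra_simps)
  qed
  have "S ^ 2 \<le> (\<Sum>xs\<in>tuples N. (g 0 (0 # xs)) ^ 2) * (\<Sum>xs\<in>tuples N. (T xs) ^ 2)"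
    unfolding S by (rule Cauchy_Schwarz_ineq_sum)
  also have "\<dots> \<le> p ^ N * ((c + real (card A) ^ 2) * p powr (real N + 2 - e))"
  proof (rule mult_mono[OF _ T2])
    have "(\<Sum>xs\<in>tuples N. (g 0 (0 # xs)) ^ 2) \<le> (\<Sum>xs::'p mod_ring list\<in>tuples N. 1)"
      using Suc.prems(2) by (intro sum_mono) (auto simp: abs_square_le_1)
    thus "(\<Sum>xs\<in>tuples N. (g 0 (0 # xs)) ^ 2) \<le> p ^ N" by (simp add: card_tuples p_def)
  qed (use p1 in \<open>auto intro!: sum_nonneg\<close>)
  \<comment> \<open>N + (N + 2 - e) = 2(N + 1 - e/2): taking the square root halves the saving
    \<open>e\<close>.\<close>
  also have "\<dots> = (box_const (Suc n) (card A) * p powr (real N + 1 - e / 2)) ^ 2"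
  proof -
    have "(p powr (real N + 1 - e / 2)) ^ 2 = p powr (real N + (real N + 2 - e))"
      by (simp add: power2_eq_square powr_add[symmetric])
    also have "\<dots> = p ^ N * p powr (real N + 2 - e)" unfolding powN by (rule powr_add)
    finally show ?thesis using box_const_nonneg[of n "2 * card A"] by (simp add: power_mult_distrib c_def mult_ac)
  qed
  finally have sq: "S ^ 2 \<le> (box_const (Suc n) (card A) * p powr (real N + 1 - e / 2)) ^ 2" .
  have "\<bar>S\<bar> \<le> box_const (Suc n) (card A) * p powr (real N + 1 - e / 2)"
  proof (rule power2_le_imp_le)
    show "\<bar>S\<bar> ^ 2 \<le> (box_const (Suc n) (card A) * p powr (real N + 1 - e / 2)) ^ 2"
      using sq by (simp only: power2_abs)
    show "0 \<le> box_const (Suc n) (card A) * p powr (real N + 1 - e / 2)"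
      by (rule mult_nonneg_nonneg[OF box_const_nonneg powr_ge_zero])
  qed
  moreover have "real N + 1 - e / 2 = real (Suc n) + 2 - 2 powr (- real (Suc n + 1))"
  proof -
    have "2 powr (- real (Suc n + 1)) = (2::real) powr (- real (n + 1) + -1)" by simp
    also have "\<dots> = e / 2" unfolding powr_add e_def by (simp add: powr_minus)
    finally show ?thesis by (simp add: N_def)
  qed
  ultimately show ?case unfolding S_def p_def by simp
qed

section \<open>The Paley cochain\<close>

definition bit_sign :: "bit \<Rightarrow> real" where
  "bit_sign b = (if b = 0 then 1 else -1)"

lemma bit_sign_simps [simp]: "bit_sign 0 = 1" "bit_sign 1 = -1"
  by (simp_all add: bit_sign_def)

lemma bit_sign_add: "bit_sign (a + b) = bit_sign a * bit_sign b"
  by (cases a; cases b) simp_all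

lemma bit_sign_sum: "bit_sign (\<Sum>i\<in>I. f i) = (\<Prod>i\<in>I. bit_sign (f i))"
proof (induction I rule: infinite_finite_induct)
  case (insert i I)
  show ?case
    unfolding sum.insert[OF insert.hyps] prod.insert[OF insert.hyps] bit_sign_add insert.IH ..
qed simp_all

lemma abs_bit_sign [simp]: "\<bar>bit_sign b\<bar> = 1"
  by (simp add: bit_sign_def)

text \<open>Euler's criterion on both sides; it links the cochain, defined by integer sums, to the
  character on the finite field type.\<close>

lemma Legendre_eq_1_iff_qchar:
  fixes m :: int
  assumes "odd CARD('p::prime_card)"
  shows "Legendre m (int CARD('p)) = 1 \<longleftrightarrow> qchar (of_int m :: 'p mod_ring) = 1"
proof -
  have "CARD('p) > 2" using assms prime_card_gt_1[where ?'p = 'p] by (cases "CARD('p) = 2") auto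
  hence eul: "[Legendre m (int CARD('p)) = m ^ ((CARD('p) - 1) div 2)] (mod int CARD('p))"
    using euler_criterion[of "CARD('p)" m] prime_card[where ?'a = 'p] by simp
  have of_int_eq: "(of_int a :: 'p mod_ring) = of_int b \<longleftrightarrow> [a = b] (mod int CARD('p))" for a b
    unfolding of_int_of_int_mod_ring Cong.cong_def by transfer simp
  have "(of_int m :: 'p mod_ring) ^ ((CARD('p) - 1) div 2) = of_int (Legendre m (int CARD('p)))"
    using eul of_int_eq[of "Legendre m (int CARD('p))" "m ^ ((CARD('p) - 1) div 2)"] by simp
  moreover have "Legendre m (int CARD('p)) \<in> {0, 1, -1}" by (simp add: Legendre_def)
  ultimately show ?thesis
    using one_neq_neg_one_mod_ring[OF assms] by (auto simp: qchar_def)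
qed

text \<open>Lists the face opposite the j-th vertex. Removal by position never inspects the entry,
  so the resulting factors satisfy \<open>ignores\<close> even on lists with repetitions.\<close>

definition remove_nth :: "nat \<Rightarrow> 'a list \<Rightarrow> 'a list" where
  "remove_nth j xs = take j xs @ drop (Suc j) xs"

lemma remove_nth_update: "remove_nth j (xs[j := y]) = remove_nth j xs"
  by (simp add: remove_nth_def)

lemma set_remove_nth:
  assumes "distinct xs" "j < length xs"
  shows "set (remove_nth j xs) = set xs - {xs ! j}"
proof -
  have xs: "xs = take j xs @ xs ! j # drop (Suc j) xs" using assms(2) by (rule id_take_nth_drop)
  have "distinct (take j xs @ xs ! j # drop (Suc j) xs)" using assms(1) xs by simp
  hence "xs ! j \<notin> set (take j xs)" "xs ! j \<notin> set (drop (Suc j) xs)" by auto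
  moreover have "set xs = set (take j xs) \<union> {xs ! j} \<union> set (drop (Suc j) xs)" by (subst xs) auto
  ultimately show ?thesis unfolding remove_nth_def by auto
qed

text \<open>A new head can repeat at most n earlier values. The factor \<open>CARD('a)\<close> on
  the left avoids the exponent n - 1.\<close>

lemma card_nondistinct_tuples:
  "CARD('a) * card {xs \<in> tuples n. \<not> distinct (xs :: 'a::finite list)} \<le> n ^ 2 * CARD('a) ^ n"
proof (induction n)
  case (Suc n)
  let ?N = "\<lambda>n. card {xs \<in> tuples n. \<not> distinct (xs :: 'a list)}"
  have ind: "?N m = (\<Sum>xs::'a list\<in>tuples m. if distinct xs then 0 else 1)" for m
  proof -
    have "{xs \<in> tuples m. \<not> distinct (xs :: 'a list)} = tuples m \<inter> - {xs. distinct xs}" by blast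
    thus ?thesis by (simp only: sum.If_cases[OF finite_tuples]) simp
  qed
  have "?N (Suc n) = (\<Sum>xs::'a list\<in>tuples n. \<Sum>x\<in>UNIV. if distinct (x # xs) then 0 else 1)"
    unfolding ind sum_tuples_Suc ..
  also have "\<dots> \<le> (\<Sum>xs::'a list\<in>tuples n. CARD('a) * (if distinct xs then 0 else 1) + n)"
  proof (rule sum_mono)
    fix xs :: "'a list" assume xs: "xs \<in> tuples n"
    have "(\<Sum>x\<in>UNIV. if distinct (x # xs) then 0 else 1) \<le> (\<Sum>x\<in>UNIV. (if distinct xs then 0 else 1) + (if x \<in> set xs then 1 else (0::nat)))"
      by (rule sum_mono) auto
    also have "\<dots> = CARD('a) * (if distinct xs then 0 else 1) + card (set xs)"
      by (simp add: sum.distrib sum.If_cases)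
    also have "card (set xs) \<le> n" using xs card_length[of xs] by (simp add: tuples_def)
    finally show "(\<Sum>x\<in>UNIV. if distinct (x # xs) then 0 else 1) \<le> CARD('a) * (if distinct xs then 0 else 1) + n" by simp
  qed
  also have "\<dots> = CARD('a) * ?N n + n * CARD('a) ^ n"
    unfolding ind by (simp add: sum.distrib sum_distrib_left card_tuples)
  also have "\<dots> \<le> n ^ 2 * CARD('a) ^ n + n * CARD('a) ^ n" using Suc by simp
  finally have "CARD('a) * ?N (Suc n) \<le> CARD('a) * (n ^ 2 * CARD('a) ^ n + n * CARD('a) ^ n)" by (rule mult_left_mono) simp
  also have "\<dots> = (n ^ 2 + n) * CARD('a) ^ Suc n" by (simp add: algebra_simps)
  also have "\<dots> \<le> (Suc n) ^ 2 * CARD('a) ^ Suc n" by (rule mult_right_mono) (simp_all add: power2_eq_square)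
  finally show ?case .
qed (simp add: tuples_0)

lemma card_zero_sum_tuples:
  "card {xs \<in> tuples (Suc n). sum_list xs = (0 :: 'a::{finite,ab_group_add})} = CARD('a) ^ n"
proof -
  have "card {xs \<in> tuples (Suc n). sum_list xs = (0 :: 'a)} = (\<Sum>xs::'a list\<in>tuples (Suc n). if sum_list xs = 0 then 1 else 0)"
    by (simp add: finite_tuples sum.If_cases Int_def)
  also have "\<dots> = (\<Sum>xs::'a list\<in>tuples n. \<Sum>x\<in>UNIV. if x = - sum_list xs then 1 else 0)"
    unfolding sum_tuples_Suc by (simp add: eq_neg_iff_add_eq_0)
  also have "\<dots> = CARD('a) ^ n" by (simp add: card_tuples)
  finally show ?thesis .
qed

text \<open>Each n-element set is listed by exactly n! distinct tuples.\<close>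

lemma sum_distinct_tuples:
  fixes h :: "'a::finite set \<Rightarrow> real"
  shows "(\<Sum>xs\<in>{xs \<in> tuples n. distinct xs}. h (set xs)) = fact n * (\<Sum>\<tau>\<in>{\<tau>. card \<tau> = n}. h \<tau>)"
proof -
  have "{xs \<in> tuples n. distinct xs} = (\<Union>\<tau>\<in>{\<tau> :: 'a set. card \<tau> = n}. permutations_of_set \<tau>)"
    by (auto simp: tuples_def permutations_of_set_def distinct_card)
  also have "(\<Sum>xs\<in>\<dots>. h (set xs)) = (\<Sum>\<tau>\<in>{\<tau>. card \<tau> = n}. \<Sum>xs\<in>permutations_of_set \<tau>. h (set xs))"
  proof (rule sum.UNION_disjoint)
    show "\<forall>\<tau>\<in>{\<tau> :: 'a set. card \<tau> = n}. finite (permutations_of_set \<tau>)" by simp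
  qed (auto simp: permutations_of_set_def)
  also have "\<dots> = (\<Sum>\<tau>\<in>{\<tau>. card \<tau> = n}. fact n * h \<tau>)"
  proof (rule sum.cong[OF refl])
    fix \<tau> :: "'a set" assume "\<tau> \<in> {\<tau>. card \<tau> = n}"
    hence "card (permutations_of_set \<tau>) = fact n" by simp
    moreover have "(\<Sum>xs\<in>permutations_of_set \<tau>. h (set xs)) = (\<Sum>xs\<in>permutations_of_set \<tau>. h \<tau>)"
      by (rule sum.cong) (auto simp: permutations_of_set_def)
    ultimately show "(\<Sum>xs\<in>permutations_of_set \<tau>. h (set xs)) = fact n * h \<tau>" by simp
  qed
  finally show ?thesis by (simp add: sum_distrib_left)
qed

text \<open>The summands account for the multilinear sum, the tuples with a repetition, and those of
  sum zero. The last factor comes from bounding p^(k+1) by a multiple of the binomial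
  coefficient.\<close>

definition paley_const :: "nat \<Rightarrow> real" where
  "paley_const k = (box_const (k - 1) 1 + real (k + 1) ^ 2 + 1) * real (k + 1) ^ (k + 1)"

lemma sum_simplices_mod_ring:
  fixes h :: "int set \<Rightarrow> real"
  shows "(\<Sum>\<sigma>\<in>simplices (paley_simplex CARD('p::prime_card)) k. h \<sigma>)
    = (\<Sum>\<tau>\<in>{\<tau> :: 'p mod_ring set. card \<tau> = Suc k}. h (to_int_mod_ring ` \<tau>))"
proof -
  let ?f = "to_int_mod_ring :: 'p mod_ring \<Rightarrow> int"
  have inj: "inj ?f" by (rule to_int_mod_ring_hom.inj_f)
  have bij: "bij_betw ?f UNIV {0..<int CARD('p)}"
    unfolding bij_betw_def using inj range_to_int_mod_ring[where ?'a = 'p] by simp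
  have S: "simplices (paley_simplex CARD('p)) k = {\<sigma>. \<sigma> \<subseteq> {0..<int CARD('p)} \<and> card \<sigma> = Suc k}"
    unfolding simplices_def paley_simplex_def full_simplex_def
    by (auto intro: finite_subset)
  have "bij_betw ((`) ?f) {\<tau>. card \<tau> = Suc k} (simplices (paley_simplex CARD('p)) k)"
  proof (rule bij_betw_imageI)
    show "inj_on ((`) ?f) {\<tau>. card \<tau> = Suc k}" using inj by (meson inj_image_eq_iff inj_onI)
    show "(`) ?f ` {\<tau>. card \<tau> = Suc k} = simplices (paley_simplex CARD('p)) k"
    proof (intro equalityI subsetI)
      fix \<sigma> assume "\<sigma> \<in> (`) ?f ` {\<tau>. card \<tau> = Suc k}"
      then obtain \<tau> where \<tau>: "card \<tau> = Suc k" "\<sigma> = ?f ` \<tau>" by auto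
      have "card \<sigma> = Suc k" unfolding \<tau>(2) using \<tau>(1) inj by (simp add: card_image inj_on_subset[OF inj])
      moreover have "\<sigma> \<subseteq> {0..<int CARD('p)}" unfolding \<tau>(2) using range_to_int_mod_ring[where ?'a = 'p] by blast
      ultimately show "\<sigma> \<in> simplices (paley_simplex CARD('p)) k" unfolding S by simp
    next
      fix \<sigma> assume "\<sigma> \<in> simplices (paley_simplex CARD('p)) k"
      hence \<sigma>: "\<sigma> \<subseteq> range ?f" "card \<sigma> = Suc k" unfolding S range_to_int_mod_ring by auto
      hence eq: "?f ` (?f -` \<sigma>) = \<sigma>" by (simp add: image_vimage_eq Int_absorb2)
      have "card (?f -` \<sigma>) = card (?f ` (?f -` \<sigma>))" by (rule card_image[symmetric]) (rule inj_on_subset[OF inj], simp)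
      hence "card (?f -` \<sigma>) = Suc k" unfolding eq using \<sigma>(2) by simp
      thus "\<sigma> \<in> (`) ?f ` {\<tau>. card \<tau> = Suc k}" using eq by (metis (mono_tags, lifting) image_eqI mem_Collect_eq)
    qed
  qed
  from sum.reindex_bij_betw[OF this, of h] show ?thesis by simp
qed

lemma paley_sign_sum_bound:
  fixes \<psi> :: "int set \<Rightarrow> bit" and k :: nat
  defines "K \<equiv> paley_simplex CARD('p::prime_card)"
  assumes odd: "odd CARD('p)" and k: "k \<ge> 1" "k < CARD('p)"
  shows "(\<Sum>\<sigma>\<in>simplices K k. bit_sign (paley_cochain CARD('p) k \<sigma> + coboundary K (k - 1) \<psi> \<sigma>))
    \<le> paley_const k * real (CARD('p) choose (k + 1)) * real CARD('p) powr (- (2 powr (- real k)))"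
proof -
  define p where "p = real CARD('p)"
  have p1: "p > 1" using prime_card_gt_1[where ?'p = 'p] by (simp add: p_def)
  define e where "e = 2 powr (- real k)"
  have e1: "e \<le> 1" unfolding e_def using powr_mono[of "- real k" 0 "2::real"] by auto
  let ?f = "to_int_mod_ring :: 'p mod_ring \<Rightarrow> int"
  have inj: "inj ?f" by (rule to_int_mod_ring_hom.inj_f)
  define H where "H = (\<lambda>\<sigma>. bit_sign (paley_cochain CARD('p) k \<sigma> + coboundary K (k - 1) \<psi> \<sigma>))"
  define g where "g = (\<lambda>j (xs :: 'p mod_ring list). bit_sign (\<psi> (?f ` set (remove_nth j xs))))"
  define G where "G = (\<lambda>xs. \<Prod>j<Suc k. g j xs)"
  define D where "D = {xs \<in> tuples (Suc k). distinct (xs :: 'p mod_ring list)}"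
  define Z where "Z = {xs \<in> tuples (Suc k). sum_list xs = (0 :: 'p mod_ring)}"
  have Gabs: "\<bar>G xs\<bar> \<le> 1" for xs unfolding G_def by (rule abs_prod_le_1) (simp add: g_def)
  \<comment> \<open>The sign of the Paley bit is minus the character, except at sum 0: there the bit
    is 0, so the sign is 1 although the character vanishes. The coboundary supplies one factor per
    face.\<close>
  have HD: "H (?f ` set xs) = - (qchar (sum_list xs) * G xs) + (if sum_list xs = 0 then G xs else 0)" if xs: "xs \<in> D" for xs
  proof -
    have dist: "distinct xs" and len: "length xs = Suc k" using xs by (auto simp: D_def tuples_def)
    define \<sigma> where "\<sigma> = ?f ` set xs"
    have c\<sigma>: "card \<sigma> = Suc k" unfolding \<sigma>_def using dist len by (simp add: card_image inj_on_subset[OF inj] distinct_card)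
    have "\<sigma> \<subseteq> {0..<int CARD('p)}" unfolding \<sigma>_def using range_to_int_mod_ring[where ?'a = 'p] by blast
    hence S: "\<sigma> \<in> simplices K k" using c\<sigma> unfolding simplices_def K_def paley_simplex_def full_simplex_def
      by (auto intro: finite_subset)
    have "(\<Sum>x\<in>\<sigma>. x) = (\<Sum>x\<in>set xs. ?f x)" unfolding \<sigma>_def by (rule sum.reindex[OF inj_on_subset[OF inj], simplified]) 
    hence "of_int (\<Sum>x\<in>\<sigma>. x) = (\<Sum>x\<in>set xs. of_int (?f x) :: 'p mod_ring)"
      by (simp only: of_int_sum)
    also have "\<dots> = (\<Sum>x\<in>set xs. x)"
      by (simp only: of_int_of_int_mod_ring of_int_mod_ring_to_int_mod_ring)
    also have "\<dots> = sum_list xs" using sum_list_distinct_conv_sum_set[OF dist, of "\<lambda>x. x"] by simp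
    finally have sum: "of_int (\<Sum>x\<in>\<sigma>. x) = sum_list xs" .
    have "paley_cochain CARD('p) k \<sigma> = (if qchar (sum_list xs) = 1 then 1 else 0)"
      unfolding paley_cochain_def using S Legendre_eq_1_iff_qchar[OF odd, of "\<Sum>x\<in>\<sigma>. x"] unfolding sum K_def by simp
    hence sgn1: "bit_sign (paley_cochain CARD('p) k \<sigma>) = - qchar (sum_list xs) + (if sum_list xs = 0 then 1 else 0)"
      using qchar_cases[OF odd, of "sum_list xs"] by auto
    have "bit_sign (coboundary K (k - 1) \<psi> \<sigma>) = (\<Prod>v\<in>\<sigma>. bit_sign (\<psi> (\<sigma> - {v})))"
      using S k(1) by (simp add: coboundary_def bit_sign_sum)
    also have "\<dots> = (\<Prod>x\<in>set xs. bit_sign (\<psi> (\<sigma> - {?f x})))"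
      unfolding \<sigma>_def by (rule prod.reindex[OF inj_on_subset[OF inj], unfolded o_def]) simp
    also have "\<dots> = (\<Prod>j<Suc k. bit_sign (\<psi> (\<sigma> - {?f (xs ! j)})))"
    proof (rule prod.reindex_bij_betw[symmetric])
      show "bij_betw ((!) xs) {..<Suc k} (set xs)" using bij_betw_nth[OF dist] len by simp
    qed
    also have "\<dots> = G xs" unfolding G_def
    proof (rule prod.cong[OF refl])
      fix j assume j: "j \<in> {..<Suc k}"
      have "?f ` set (remove_nth j xs) = \<sigma> - {?f (xs ! j)}"
        using set_remove_nth[OF dist, of j] j len inj unfolding \<sigma>_def by (simp add: image_set_diff)
      thus "bit_sign (\<psi> (\<sigma> - {?f (xs ! j)})) = g j xs" by (simp add: g_def)
    qed
    finally show ?thesis unfolding H_def \<sigma>_def[symmetric] bit_sign_add sgn1 by (simp add: algebra_simps)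
  qed
  \<comment> \<open>There are k + 1 variables, so \<open>box_bound\<close> is used with n = k - 1,
    starting from the single shift 0; this is where the exponent 2^(-k) appears.\<close>
  have box: "\<bar>\<Sum>xs\<in>tuples (Suc k). qchar (sum_list xs) * G xs\<bar> \<le> box_const (k - 1) 1 * p powr (real k + 1 - e)"
  proof -
    obtain n where n: "k = Suc n" using k(1) by (cases k) auto
    have sk: "shift_kernel {0} s = qchar s" for s :: "'p mod_ring" by (simp add: shift_kernel_def)
    have eqs: "n + 2 = Suc k" "real n + 2 - 2 powr (- real (n + 1)) = real k + 1 - e"
      "card {0 :: 'p mod_ring} = 1" "k - 1 = n"
      by (simp_all add: n e_def)
    have "\<bar>\<Sum>xs\<in>tuples (n + 2). shift_kernel {0} (sum_list xs) * (\<Prod>j<n + 2. g j xs)\<bar>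
        \<le> box_const n (card {0 :: 'p mod_ring}) * real CARD('p) powr (real n + 2 - 2 powr (- real (n + 1)))"
    proof (rule box_bound[OF odd])
      show "ignores j (g j)" for j unfolding ignores_def g_def remove_nth_update by blast
      show "\<bar>g j xs\<bar> \<le> 1" for j xs by (simp add: g_def)
    qed simp
    thus ?thesis unfolding sk eqs G_def p_def .
  qed
  have powk: "real (CARD('p) ^ k) \<le> p powr (real k + 1 - e)"
  proof -
    have "real (CARD('p) ^ k) = p powr (real k)" using p1 by (simp add: powr_realpow p_def)
    also have "\<dots> \<le> p powr (real k + 1 - e)" using p1 e1 by (intro powr_mono) auto
    finally show ?thesis .
  qed
  have nond: "real (card (tuples (Suc k) - D)) \<le> real (k + 1) ^ 2 * real (CARD('p) ^ k)"
  proof -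
    have "tuples (Suc k) - D = {xs \<in> tuples (Suc k). \<not> distinct (xs :: 'p mod_ring list)}" by (auto simp: D_def)
    hence "CARD('p) * card (tuples (Suc k) - D) \<le> CARD('p) * ((Suc k) ^ 2 * CARD('p) ^ k)"
      using card_nondistinct_tuples[of "Suc k", where ?'a = "'p mod_ring"] by (simp add: mult_ac)
    hence "card (tuples (Suc k) - D) \<le> (Suc k) ^ 2 * CARD('p) ^ k"
      using prime_card_gt_1[where ?'p = 'p] by (simp del: power_Suc)
    hence "real (card (tuples (Suc k) - D)) \<le> real ((Suc k) ^ 2 * CARD('p) ^ k)" by (simp only: of_nat_le_iff)
    thus ?thesis by simp
  qed
  have finD: "finite (tuples (Suc k) :: 'p mod_ring list set)" by (rule finite_tuples)
  have "fact (Suc k) * (\<Sum>\<sigma>\<in>simplices K k. H \<sigma>) = (\<Sum>xs\<in>D. H (?f ` set xs))"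
    unfolding K_def sum_simplices_mod_ring D_def by (rule sum_distinct_tuples[symmetric])
  also have "\<dots> = - (\<Sum>xs\<in>D. qchar (sum_list xs) * G xs) + (\<Sum>xs\<in>D. if sum_list xs = 0 then G xs else 0)"
    unfolding sum_negf[symmetric] sum.distrib[symmetric] by (rule sum.cong[OF refl]) (rule HD)
  also have "\<dots> \<le> (box_const (k - 1) 1 * p powr (real k + 1 - e) + real (k + 1) ^ 2 * real (CARD('p) ^ k)) + real (CARD('p) ^ k)"
  proof (rule add_mono)
    have "(\<Sum>xs\<in>tuples (Suc k). qchar (sum_list xs) * G xs) =
        (\<Sum>xs\<in>tuples (Suc k) - D. qchar (sum_list xs) * G xs) + (\<Sum>xs\<in>D. qchar (sum_list xs) * G xs)"
      by (rule sum.subset_diff[OF _ finD]) (auto simp: D_def)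
    moreover have "\<bar>\<Sum>xs\<in>tuples (Suc k) - D. qchar (sum_list xs) * G xs\<bar> \<le> (\<Sum>xs\<in>tuples (Suc k) - D. 1)"
    proof (rule order_trans[OF sum_abs sum_mono])
      show "\<bar>qchar (sum_list xs) * G xs\<bar> \<le> 1" for xs :: "'p mod_ring list"
        unfolding abs_mult using Gabs abs_qchar_le_1 by (intro mult_le_one) auto
    qed
    ultimately show "- (\<Sum>xs\<in>D. qchar (sum_list xs) * G xs) \<le> box_const (k - 1) 1 * p powr (real k + 1 - e) + real (k + 1) ^ 2 * real (CARD('p) ^ k)"
      using box nond by simp
    have "(\<Sum>xs\<in>D. if sum_list xs = 0 then G xs else 0) \<le> (\<Sum>xs\<in>D. if sum_list xs = 0 then 1 else 0)"
      by (rule sum_mono) (use Gabs in \<open>auto simp: abs_le_iff\<close>)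
    also have "\<dots> \<le> (\<Sum>xs::'p mod_ring list\<in>tuples (Suc k). if sum_list xs = 0 then 1 else 0)"
      by (rule sum_mono2[OF finD]) (auto simp: D_def)
    also have "\<dots> = real (card Z)" by (simp add: finD Z_def sum.If_cases Int_def)
    also have "card Z = CARD('p) ^ k" unfolding Z_def by (subst card_zero_sum_tuples) simp
    finally show "(\<Sum>xs\<in>D. if sum_list xs = 0 then G xs else 0) \<le> real (CARD('p) ^ k)" .
  qed
  also have "\<dots> \<le> (box_const (k - 1) 1 + real (k + 1) ^ 2 + 1) * p powr (real k + 1 - e)"
  proof -
    have "real (k + 1) ^ 2 * real (CARD('p) ^ k) \<le> real (k + 1) ^ 2 * p powr (real k + 1 - e)"
      by (rule mult_left_mono[OF powk]) simp
    thus ?thesis using powk unfolding distrib_right mult_1 by linarith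
  qed
  also have "p powr (real k + 1 - e) = p ^ (k + 1) * p powr (- e)"
  proof -
    have "real k + 1 - e = real (k + 1) + - e" by simp
    hence "p powr (real k + 1 - e) = p powr real (k + 1) * p powr (- e)" by (simp only: powr_add)
    also have "p powr real (k + 1) = p ^ (k + 1)" using p1 by (intro powr_realpow) simp
    finally show ?thesis .
  qed
  also have "(box_const (k - 1) 1 + real (k + 1) ^ 2 + 1) * (p ^ (k + 1) * p powr (- e))
      \<le> (box_const (k - 1) 1 + real (k + 1) ^ 2 + 1) * ((real (k + 1) ^ (k + 1) * real (CARD('p) choose (k + 1))) * p powr (- e))"
  proof (intro mult_left_mono mult_right_mono)
    \<comment> \<open>The hypothesis k < p is used here: the lower bound for the binomial
      coefficient requires k + 1 to be at most p.\<close>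
    have "(p / real (k + 1)) ^ (k + 1) \<le> real (CARD('p) choose (k + 1))"
      unfolding p_def using k(2) by (intro binomial_ge_n_over_k_pow_k) simp
    thus "p ^ (k + 1) \<le> real (k + 1) ^ (k + 1) * real (CARD('p) choose (k + 1))"
      by (simp add: power_divide divide_le_eq mult.commute del: of_nat_Suc of_nat_add)
  qed (use box_const_nonneg[of "k - 1" 1] in auto)
  finally have fin: "fact (Suc k) * (\<Sum>\<sigma>\<in>simplices K k. H \<sigma>) \<le> paley_const k * real (CARD('p) choose (k + 1)) * p powr (- e)"
    by (simp only: paley_const_def mult_ac)
  have nonneg: "paley_const k * real (CARD('p) choose (k + 1)) * p powr (- e) \<ge> 0"
    unfolding paley_const_def using box_const_nonneg[of "k - 1" 1] by (intro mult_nonneg_nonneg add_nonneg_nonneg) auto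
  have "(\<Sum>\<sigma>\<in>simplices K k. H \<sigma>) \<le> paley_const k * real (CARD('p) choose (k + 1)) * p powr (- e)"
  \<comment> \<open>Dropping the factor (k+1)! enlarges the left side if the sum is negative; then
    the claim holds by sign alone.\<close>
  proof (cases "(\<Sum>\<sigma>\<in>simplices K k. H \<sigma>) \<le> 0")
    case False
    hence "1 * (\<Sum>\<sigma>\<in>simplices K k. H \<sigma>) \<le> fact (Suc k) * (\<Sum>\<sigma>\<in>simplices K k. H \<sigma>)"
      by (intro mult_right_mono fact_ge_1) auto
    thus ?thesis using fin by simp
  qed (use nonneg in linarith)
  thus ?thesis unfolding H_def p_def e_def .
qed

text \<open>The norm of a cochain counts the signs -1, so it is half the number of simplices minus
  half the sign sum; apply this to a minimizing \<psi>.\<close>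

lemma csy_norm_paley_ge:
  assumes odd: "odd CARD('p::prime_card)" and k: "k \<ge> 1" "k < CARD('p)"
  shows "real (csy_norm (paley_simplex CARD('p)) k (paley_cochain CARD('p) k))
    \<ge> 1 / 2 * real (CARD('p) choose (k + 1)) * (1 - paley_const k * real CARD('p) powr (- (2 powr (- real k))))"
proof -
  define K where "K = paley_simplex CARD('p)"
  define \<phi> where "\<phi> = paley_cochain CARD('p) k"
  have finS: "finite (simplices K j)" for j
    unfolding K_def paley_simplex_def by (rule finite_simplices_full_simplex) simp
  have "csy_norm K k \<phi> \<in> (\<lambda>\<psi>. cochain_norm K k (\<lambda>\<sigma>. \<phi> \<sigma> + coboundary K (k - 1) \<psi> \<sigma>)) ` cochains K (k - 1)"
    unfolding csy_norm_def
  proof (rule Min_in)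
    show "finite ((\<lambda>\<psi>. cochain_norm K k (\<lambda>\<sigma>. \<phi> \<sigma> + coboundary K (k - 1) \<psi> \<sigma>)) ` cochains K (k - 1))"
      by (intro finite_imageI finite_cochains finS)
    have "(\<lambda>_. 0) \<in> cochains K (k - 1)" by (simp add: cochains_def)
    thus "(\<lambda>\<psi>. cochain_norm K k (\<lambda>\<sigma>. \<phi> \<sigma> + coboundary K (k - 1) \<psi> \<sigma>)) ` cochains K (k - 1) \<noteq> {}" by blast
  qed
  then obtain \<psi> where \<psi>: "csy_norm K k \<phi> = cochain_norm K k (\<lambda>\<sigma>. \<phi> \<sigma> + coboundary K (k - 1) \<psi> \<sigma>)" by blast
  define \<Phi> where "\<Phi> = (\<lambda>\<sigma>. \<phi> \<sigma> + coboundary K (k - 1) \<psi> \<sigma>)"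
  have card_S: "card (simplices K k) = CARD('p) choose (k + 1)"
  proof -
    have "simplices K k = {\<sigma>. \<sigma> \<subseteq> {0..<int CARD('p)} \<and> card \<sigma> = k + 1}"
      unfolding simplices_def K_def paley_simplex_def full_simplex_def by (auto intro: finite_subset)
    thus ?thesis by (simp add: n_subsets)
  qed
  have "real (cochain_norm K k \<Phi>) = (\<Sum>\<sigma>\<in>simplices K k. if \<Phi> \<sigma> \<noteq> 0 then 1 else 0)"
    unfolding cochain_norm_def by (simp add: finS sum.If_cases Int_def)
  also have "\<dots> = (\<Sum>\<sigma>\<in>simplices K k. 1 / 2 - bit_sign (\<Phi> \<sigma>) / 2)"
    by (rule sum.cong) (auto simp: bit_sign_def)
  also have "\<dots> = 1 / 2 * real (CARD('p) choose (k + 1)) - (\<Sum>\<sigma>\<in>simplices K k. bit_sign (\<Phi> \<sigma>)) / 2"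
    by (simp add: sum_subtractf sum_divide_distrib card_S)
  also have "\<dots> \<ge> 1 / 2 * real (CARD('p) choose (k + 1))
      - (paley_const k * real (CARD('p) choose (k + 1)) * real CARD('p) powr (- (2 powr (- real k)))) / 2"
    using paley_sign_sum_bound[OF odd k, of \<psi>] unfolding \<Phi>_def \<phi>_def K_def
    by (intro diff_left_mono divide_right_mono) auto
  finally show ?thesis using \<psi> unfolding \<Phi>_def \<phi>_def K_def by (simp add: algebra_simps)
qed

text \<open>A type cannot depend on the variable \<open>p\<close>, so the theorem is proved by contradiction for
  one fixed prime: \<open>test_prime\<close> is a counterexample if there is one.\<close>

definition counterexample :: "nat \<Rightarrow> bool" where
  "counterexample p \<longleftrightarrow> prime p \<and> p > 2 \<and> (\<exists>k\<ge>1. k < p \<and>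
     \<not> real (csy_norm (paley_simplex p) k (paley_cochain p k))
       \<ge> 1 / 2 * real (p choose (k + 1)) * (1 - paley_const k * real p powr (- (2 powr (- real k)))))"

definition test_prime :: nat where
  "test_prime = (if \<exists>p. counterexample p then SOME p. counterexample p else 3)"

text \<open>Needed without hypotheses, because the type and its \<open>prime_card\<close> instance
  cannot carry any; this is the purpose of the default 3.\<close>

lemma prime_test_prime: "prime test_prime"
  using someI_ex[of counterexample] by (auto simp: test_prime_def counterexample_def)

typedef test_index = "{0..<test_prime}"
  using prime_gt_0_nat[OF prime_test_prime] by auto

lemma card_test_index: "CARD(test_index) = test_prime"
  using type_definition.card[OF type_definition_test_index] by simp

instance test_index :: prime_card
  by standard (simp add: card_test_index prime_test_prime)

lemma no_counterexample: "\<not> counterexample p"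
proof
  assume "counterexample p"
  hence ex: "counterexample test_prime"
    using someI_ex[of counterexample] by (auto simp: test_prime_def)
  then obtain k where k: "k \<ge> 1" "k < test_prime"
    "\<not> real (csy_norm (paley_simplex test_prime) k (paley_cochain test_prime k))
       \<ge> 1 / 2 * real (test_prime choose (k + 1)) * (1 - paley_const k * real test_prime powr (- (2 powr (- real k))))"
    unfolding counterexample_def by blast
  have "odd test_prime"
    using ex unfolding counterexample_def by (metis prime_odd_nat)
  thus False
    using csy_norm_paley_ge[where ?'p = test_index, of k] k unfolding card_test_index by blast
qed

theorem theorem5p6:
  fixes k :: nat
  assumes "k \<ge> 1"
  shows "\<exists>C::real. \<forall>p::nat. prime p \<and> p > 2 \<and> k < p \<longrightarrow>
           real (csy_norm (paley_simplex p) k (paley_cochain p k))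
             \<ge> 1 / 2 * real (p choose (k + 1)) * (1 - C * real p powr (- (2 powr (- real k))))"
  \<comment> \<open>The witness for \<open>C\<close> is \<open>paley_const k\<close>, which does not
    involve \<open>p\<close>.\<close>
  using no_counterexample assms unfolding counterexample_def by blast

end
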